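(* Let the stiffness matrix satisfy $\mathbf A\in\mathcal D_a(\eta_L)$ with $\eta_L>d$ and let $\mathbf A$ be invertible in $\ell^2(\mathbb Z^d)$; set $s^*=\eta_L-d$. For any $0<s<s^*$, if $u\in\mathcal A^s_B$ then $r(u_\Lambda)\in\mathcal A^s_B$ for any finite index set $\Lambda\subset\mathbb Z^d$, with $$\|r(u_\Lambda)\|_{\mathcal A^s_B}\lesssim\|u\|_{\mathcal A^s_B},$$ where the hidden constant is independent of $u$ and $\Lambda$.
   Context: Let $d\ge1$, $\Omega=(0,2\pi)^d$, $\phi_k(x)=(2\pi)^{-d/2}e^{ik\cdot x}$ for $k\in\mathbb Z^d$, $\hat v_k=(v,\phi_k)_{L^2(\Omega)}$. $V=H^1_p(\Omega)$: $H^1$ functions $2\pi$-periodic in each direction, norm $\|v\|^2=\sum_k(1+|k|^2)|\hat v_k|^2$ ($|k|$ Euclidean). $H^{-1}_p(\Omega)$ is its (anti)dual, $\hat f_k=\langle f,\phi_k\rangle$, $\|f\|^2=\sum_k(1+|k|^2)^{-1}|\hat f_k|^2$. For $\Lambda\subset\mathbb Z^d$, $P_\Lambda$ keeps only the Fourier coefficients with index in $\Lambda$; $V_\Lambda=\mathrm{span}\{\phi_k:k\in\Lambda\}$. $Lu=-\nabla\cdot(\nu\nabla u)+\sigma u$ with sufficiently smooth real ($2\pi$-periodic) coefficients bounded above and below by positive constants; $a(u,v)=\int_\Omega\nu\nabla u\cdot\nabla\bar v+\int_\Omega\sigma u\bar v$; $f\in H^{-1}_p(\Omega)$; $u\in V$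 solves $a(u,v)=\langle f,v\rangle$ for all $v\in V$; for finite $\Lambda$, $u_\Lambda\in V_\Lambda$ solves $a(u_\Lambda,v)=\langle f,v\rangle$ for all $v\in V_\Lambda$; $r(u_\Lambda)=f-Lu_\Lambda$. Stiffness matrix: $\mathbf A=(a_{\ell,k})_{\ell,k\in\mathbb Z^d}$, $a_{\ell,k}=\frac{a(\phi_k,\phi_\ell)}{c_\ell c_k}$, $c_k=\sqrt{1+|k|^2}$. $\mathbf A\in\mathcal D_a(\eta_L)$ means that for some $c_L>0$, $|a_{\ell,k}|\le c_L(1+|\ell-k|)^{-\eta_L}$ for all $\ell,k$. Best $N$-term error: $E_N(v)=\inf_{|\Lambda|=N}\|v-P_\Lambda v\|$ ($E_0(v)=\|v\|$). Algebraic class, for $s>0$: $\mathcal A^s_B=\{v\in V:\ \|v\|_{\mathcal A^s_B}:=\|v\|+\sup_{N\ge1}E_N(v)N^{s/d}<\infty\}$. The same notation $\mathcal A_B^s$ is used for forms in $H^{-1}_p(\Omega)$, with $V$ and its norm replaced by $H^{-1}_p(\Omega)$ and its norm. *)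

theory Defs
  imports "HOL-Analysis.Analysis"
begin

section \<open>Periodic functions and Fourier coefficients\<close>

text \<open>
  The dimension is \<open>d = CARD('d)\<close>.  A function on \<open>\<Omega> = (0, 2\<pi>)\<^sup>d\<close> is represented
  by a function on the whole space that is \<open>2\<pi>\<close>-periodic in each direction; functions are not
  quotiented by equality almost everywhere.
\<close>

definition Omega :: "(real^'d) set" where
  "Omega = box 0 (\<chi> j. 2 * pi)"

definition periodic :: "(real^'d \<Rightarrow> 'b) \<Rightarrow> bool" where
  "periodic v \<longleftrightarrow> (\<forall>x j. v (x + axis j (2 * pi)) = v x)"

definition L2p :: "(real^'d \<Rightarrow> complex) set" where
  "L2p = {v. periodic v \<and> v \<in> borel_measurable (lebesgue_on Omega) \<and>
             integrable (lebesgue_on Omega) (\<lambda>x. (cmod (v x))\<^sup>2)}"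

definition knorm :: "int^'d \<Rightarrow> real" where
  "knorm k = norm ((\<chi> j. real_of_int (k $ j)) :: real^'d)"

definition phi :: "int^'d \<Rightarrow> real^'d \<Rightarrow> complex" where
  "phi k x = complex_of_real ((2 * pi) powr (- (real CARD('d) / 2))) *
             exp (\<i> * complex_of_real (\<Sum>j\<in>UNIV. real_of_int (k $ j) * x $ j))"

definition fcoeff :: "(real^'d \<Rightarrow> complex) \<Rightarrow> int^'d \<Rightarrow> complex" where
  "fcoeff v k = (LINT x|lebesgue_on Omega. v x * cnj (phi k x))"

definition cwt :: "int^'d \<Rightarrow> real" where
  "cwt k = sqrt (1 + (knorm k)\<^sup>2)"

section \<open>The space V of periodic \<open>H\<^sup>1\<close> functions and its antidual\<close>

definition partial_deriv :: "'d \<Rightarrow> (real^'d \<Rightarrow> complex) \<Rightarrow> real^'d \<Rightarrow> complex" where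
  "partial_deriv j \<psi> x = frechet_derivative \<psi> (at x) (axis j 1)"

definition C1p :: "(real^'d \<Rightarrow> complex) set" where
  "C1p = {\<psi>. periodic \<psi> \<and> (\<forall>x. \<psi> differentiable (at x)) \<and>
             (\<forall>j. continuous_on UNIV (partial_deriv j \<psi>))}"

text \<open>
  Weak derivatives of periodic functions: testing against periodic functions over one period
  is what excludes jumps across the faces of \<open>\<Omega>\<close>.
\<close>

definition weak_partial :: "'d \<Rightarrow> (real^'d \<Rightarrow> complex) \<Rightarrow> (real^'d \<Rightarrow> complex) \<Rightarrow> bool" where
  "weak_partial j v g \<longleftrightarrow>
     (\<forall>\<psi>\<in>C1p. (LINT x|lebesgue_on Omega. v x * partial_deriv j \<psi> x) =
              - (LINT x|lebesgue_on Omega. g x * \<psi> x))"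

definition H1p :: "(real^'d \<Rightarrow> complex) set" where
  "H1p = {v \<in> L2p. \<forall>j. \<exists>g\<in>L2p. weak_partial j v g}"

text \<open>The weak derivative is unique up to a null set, which the form below does not see.\<close>

definition wderiv :: "'d \<Rightarrow> (real^'d \<Rightarrow> complex) \<Rightarrow> real^'d \<Rightarrow> complex" where
  "wderiv j v = (SOME g. g \<in> L2p \<and> weak_partial j v g)"

definition H1_norm :: "(real^'d \<Rightarrow> complex) \<Rightarrow> real" where
  "H1_norm v = sqrt (\<Sum>\<^sub>\<infinity>k. (1 + (knorm k)\<^sup>2) * (cmod (fcoeff v k))\<^sup>2)"

text \<open>
  Elements of the antidual are bounded antilinear functionals on \<open>H1p\<close>; their values
  outside \<open>H1p\<close> are irrelevant.
\<close>

definition Hm1p :: "((real^'d \<Rightarrow> complex) \<Rightarrow> complex) set" where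
  "Hm1p = {f. (\<forall>v\<in>H1p. \<forall>w\<in>H1p. f (\<lambda>x. v x + w x) = f v + f w) \<and>
              (\<forall>c. \<forall>v\<in>H1p. f (\<lambda>x. c * v x) = cnj c * f v) \<and>
              (\<exists>C. \<forall>v\<in>H1p. cmod (f v) \<le> C * H1_norm v)}"

definition dual_fcoeff :: "((real^'d \<Rightarrow> complex) \<Rightarrow> complex) \<Rightarrow> int^'d \<Rightarrow> complex" where
  "dual_fcoeff f k = f (phi k)"

definition Hm1_norm :: "((real^'d \<Rightarrow> complex) \<Rightarrow> complex) \<Rightarrow> real" where
  "Hm1_norm f = sqrt (\<Sum>\<^sub>\<infinity>k. inverse (1 + (knorm k)\<^sup>2) * (cmod (dual_fcoeff f k))\<^sup>2)"

section \<open>The elliptic problem and its Galerkin approximation\<close>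

text \<open>
  Coefficients are only required to be continuous; any further smoothness enters
  quantitatively only through the off-diagonal decay of the stiffness matrix.
\<close>

definition admissible_coeff :: "(real^'d \<Rightarrow> real) \<Rightarrow> bool" where
  "admissible_coeff g \<longleftrightarrow> periodic g \<and> continuous_on UNIV g \<and>
     (\<exists>m M. 0 < m \<and> (\<forall>x. m \<le> g x \<and> g x \<le> M))"

definition aform ::
  "(real^'d \<Rightarrow> real) \<Rightarrow> (real^'d \<Rightarrow> real) \<Rightarrow> (real^'d \<Rightarrow> complex) \<Rightarrow> (real^'d \<Rightarrow> complex) \<Rightarrow> complex"
where
  "aform \<nu> \<sigma> u v =
     (LINT x|lebesgue_on Omega.
        complex_of_real (\<nu> x) * (\<Sum>j\<in>UNIV. wderiv j u x * cnj (wderiv j v x))) +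
     (LINT x|lebesgue_on Omega. complex_of_real (\<sigma> x) * u x * cnj (v x))"

definition weak_solution ::
  "(real^'d \<Rightarrow> real) \<Rightarrow> (real^'d \<Rightarrow> real) \<Rightarrow> ((real^'d \<Rightarrow> complex) \<Rightarrow> complex) \<Rightarrow>
   (real^'d \<Rightarrow> complex) \<Rightarrow> bool"
where
  "weak_solution \<nu> \<sigma> f u \<longleftrightarrow> u \<in> H1p \<and> (\<forall>v\<in>H1p. aform \<nu> \<sigma> u v = f v)"

text \<open>The span of the \<open>\<phi>\<^sub>k\<close>, \<open>k \<in> \<Lambda>\<close>, for finite \<open>\<Lambda>\<close>.\<close>

definition VL :: "(int^'d) set \<Rightarrow> (real^'d \<Rightarrow> complex) set" where
  "VL \<Lambda> = {v. \<exists>c. v = (\<lambda>x. \<Sum>k\<in>\<Lambda>. c k * phi k x)}"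

definition galerkin_solution ::
  "(real^'d \<Rightarrow> real) \<Rightarrow> (real^'d \<Rightarrow> real) \<Rightarrow> ((real^'d \<Rightarrow> complex) \<Rightarrow> complex) \<Rightarrow>
   (int^'d) set \<Rightarrow> (real^'d \<Rightarrow> complex) \<Rightarrow> bool"
where
  "galerkin_solution \<nu> \<sigma> f \<Lambda> w \<longleftrightarrow> w \<in> VL \<Lambda> \<and> (\<forall>v\<in>VL \<Lambda>. aform \<nu> \<sigma> w v = f v)"

text \<open>\<open>L\<close> is the operator from \<open>V\<close> to its antidual induced by the form.\<close>

definition Lop ::
  "(real^'d \<Rightarrow> real) \<Rightarrow> (real^'d \<Rightarrow> real) \<Rightarrow> (real^'d \<Rightarrow> complex) \<Rightarrow>
   (real^'d \<Rightarrow> complex) \<Rightarrow> complex"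
where
  "Lop \<nu> \<sigma> u = (\<lambda>v. aform \<nu> \<sigma> u v)"

definition residual ::
  "(real^'d \<Rightarrow> real) \<Rightarrow> (real^'d \<Rightarrow> real) \<Rightarrow> ((real^'d \<Rightarrow> complex) \<Rightarrow> complex) \<Rightarrow>
   (real^'d \<Rightarrow> complex) \<Rightarrow> (real^'d \<Rightarrow> complex) \<Rightarrow> complex"
where
  "residual \<nu> \<sigma> f w = (\<lambda>v. f v - Lop \<nu> \<sigma> w v)"

section \<open>The stiffness matrix\<close>

definition stiffness ::
  "(real^'d \<Rightarrow> real) \<Rightarrow> (real^'d \<Rightarrow> real) \<Rightarrow> int^'d \<Rightarrow> int^'d \<Rightarrow> complex"
where
  "stiffness \<nu> \<sigma> l k =
     aform \<nu> \<sigma> (phi k) (phi l) / (complex_of_real (cwt l) * complex_of_real (cwt k))"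

definition Da :: "real \<Rightarrow> (int^'d \<Rightarrow> int^'d \<Rightarrow> complex) set" where
  "Da \<eta> = {A. \<exists>c>0. \<forall>l k. cmod (A l k) \<le> c * (1 + knorm (l - k)) powr (- \<eta>)}"

definition ell2 :: "('i \<Rightarrow> complex) set" where
  "ell2 = {x. (\<lambda>k. (cmod (x k))\<^sup>2) summable_on UNIV}"

definition ell2_norm :: "('i \<Rightarrow> complex) \<Rightarrow> real" where
  "ell2_norm x = sqrt (\<Sum>\<^sub>\<infinity>k. (cmod (x k))\<^sup>2)"

definition mat_apply :: "('i \<Rightarrow> 'i \<Rightarrow> complex) \<Rightarrow> ('i \<Rightarrow> complex) \<Rightarrow> 'i \<Rightarrow> complex" where
  "mat_apply A x = (\<lambda>l. \<Sum>\<^sub>\<infinity>k. A l k * x k)"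

definition ell2_bounded_op :: "(('i \<Rightarrow> complex) \<Rightarrow> 'i \<Rightarrow> complex) \<Rightarrow> bool" where
  "ell2_bounded_op T \<longleftrightarrow>
     (\<forall>x\<in>ell2. T x \<in> ell2) \<and>
     (\<forall>x\<in>ell2. \<forall>y\<in>ell2. T (\<lambda>k. x k + y k) = (\<lambda>k. T x k + T y k)) \<and>
     (\<forall>c. \<forall>x\<in>ell2. T (\<lambda>k. c * x k) = (\<lambda>k. c * T x k)) \<and>
     (\<exists>C. \<forall>x\<in>ell2. ell2_norm (T x) \<le> C * ell2_norm x)"

text \<open>
  The summability clause makes sure that the row sums are genuine, since \<open>infsum\<close> is 0 on
  non-summable families.
\<close>

definition ell2_invertible :: "('i \<Rightarrow> 'i \<Rightarrow> complex) \<Rightarrow> bool" where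
  "ell2_invertible A \<longleftrightarrow>
     (\<forall>x\<in>ell2. \<forall>l. (\<lambda>k. A l k * x k) summable_on UNIV) \<and>
     ell2_bounded_op (mat_apply A) \<and>
     (\<exists>B. ell2_bounded_op B \<and>
          (\<forall>x\<in>ell2. B (mat_apply A x) = x \<and> mat_apply A (B x) = x))"

section \<open>Best N-term approximation and the algebraic classes\<close>

text \<open>
  The projections are only needed for finite \<open>\<Lambda>\<close>.  On functionals, \<open>proj_Hm1 \<Lambda> f\<close> has
  the coefficient \<open>\<langle>f, \<phi>\<^sub>k\<rangle>\<close> for \<open>k \<in> \<Lambda>\<close> and 0 otherwise.
\<close>

definition proj_H1 :: "(int^'d) set \<Rightarrow> (real^'d \<Rightarrow> complex) \<Rightarrow> real^'d \<Rightarrow> complex" where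
  "proj_H1 \<Lambda> v = (\<lambda>x. \<Sum>k\<in>\<Lambda>. fcoeff v k * phi k x)"

definition proj_Hm1 ::
  "(int^'d) set \<Rightarrow> ((real^'d \<Rightarrow> complex) \<Rightarrow> complex) \<Rightarrow> (real^'d \<Rightarrow> complex) \<Rightarrow> complex"
where
  "proj_Hm1 \<Lambda> f = (\<lambda>v. \<Sum>k\<in>\<Lambda>. dual_fcoeff f k * cnj (fcoeff v k))"

text \<open>
  \<open>E\<^sub>N\<close> and the algebraic class for a space \<open>X\<close> of complex-valued maps (functions or
  functionals) with norm \<open>nrm\<close> and projections \<open>P\<close>.
\<close>

definition best_err ::
  "(('x \<Rightarrow> complex) \<Rightarrow> real) \<Rightarrow> ((int^'d) set \<Rightarrow> ('x \<Rightarrow> complex) \<Rightarrow> 'x \<Rightarrow> complex) \<Rightarrow>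
   nat \<Rightarrow> ('x \<Rightarrow> complex) \<Rightarrow> real"
where
  "best_err nrm P N v =
     (INF \<Lambda>\<in>{\<Lambda>. finite \<Lambda> \<and> card \<Lambda> = N}. nrm (\<lambda>x. v x - P \<Lambda> v x))"

definition alg_norm ::
  "(('x \<Rightarrow> complex) \<Rightarrow> real) \<Rightarrow> ((int^'d) set \<Rightarrow> ('x \<Rightarrow> complex) \<Rightarrow> 'x \<Rightarrow> complex) \<Rightarrow>
   real \<Rightarrow> ('x \<Rightarrow> complex) \<Rightarrow> real"
where
  "alg_norm nrm P s v =
     nrm v + (SUP N\<in>{1..}. best_err nrm P N v * real N powr (s / real CARD('d)))"

definition alg_class ::
  "('x \<Rightarrow> complex) set \<Rightarrow> (('x \<Rightarrow> complex) \<Rightarrow> real) \<Rightarrow>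
   ((int^'d) set \<Rightarrow> ('x \<Rightarrow> complex) \<Rightarrow> 'x \<Rightarrow> complex) \<Rightarrow> real \<Rightarrow> ('x \<Rightarrow> complex) set"
where
  "alg_class X nrm P s =
     {v \<in> X. bdd_above ((\<lambda>N. best_err nrm P N v * real N powr (s / real CARD('d))) ` {1..})}"

abbreviation AsB_H1 :: "real \<Rightarrow> (real^'d \<Rightarrow> complex) set" where
  "AsB_H1 \<equiv> alg_class H1p H1_norm proj_H1"

abbreviation AsB_norm_H1 :: "real \<Rightarrow> (real^'d \<Rightarrow> complex) \<Rightarrow> real" where
  "AsB_norm_H1 \<equiv> alg_norm H1_norm proj_H1"

abbreviation AsB_Hm1 :: "real \<Rightarrow> ((real^'d \<Rightarrow> complex) \<Rightarrow> complex) set" where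
  "AsB_Hm1 \<equiv> alg_class Hm1p Hm1_norm proj_Hm1"

abbreviation AsB_norm_Hm1 :: "real \<Rightarrow> ((real^'d \<Rightarrow> complex) \<Rightarrow> complex) \<Rightarrow> real" where
  "AsB_norm_Hm1 \<equiv> alg_norm Hm1_norm proj_Hm1"

end

theory Submission
  imports Defs
begin

text \<open>
  In the rescaled Fourier coordinates \<open>U\<^sub>k = c\<^sub>k \<hat>u\<^sub>k\<close>, \<open>W\<^sub>k = c\<^sub>k \<hat>w\<^sub>k\<close> (for the Galerkin solution \<open>w\<close>) and
  \<open>F\<^sub>l = f(\<phi>\<^sub>l) / c\<^sub>l\<close>, the problem becomes \<open>A U = F\<close>, and \<open>W\<close>, supported in \<open>\<Lambda>\<close>, solves the
  finite section \<open>A\<^sub>\<Lambda> W = F\<close> on \<open>\<Lambda>\<close>. Hence \<open>W = X A U\<close>, where \<open>X\<close> is the inverse of \<open>A\<^sub>\<Lambda>\<close> extended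
  by zero, and the rescaled residual is \<open>r = R U\<close> with the single matrix \<open>R = A - A X A\<close>. The two
  norms of the theorem are those of the same approximation class of sequences, evaluated at \<open>U\<close> and
  at \<open>r\<close>. So it is enough that \<open>R\<close> decays off the diagonal like \<open>A\<close> with a constant that does not
  depend on \<open>\<Lambda>\<close>, and that matrices with this decay map the approximation class to itself.

  Uniform decay of \<open>X\<close> is a quantitative form of Jaffard's theorem. Coercivity of the form gives a
  \<open>t > 0\<close> such that \<open>B = 1 - t A\<^sub>\<Lambda>\<close> has operator norm at most some \<open>\<rho> < 1\<close>, for all \<open>\<Lambda>\<close>
  (\<open>contracts_one_minus\<close>). The decay constant of \<open>B\<^sup>n\<close> grows at most geometrically, with a ratio that
  may exceed 1; but the decay constant of a square \<open>B\<^sup>n B\<^sup>n\<close> is controlled by that of \<open>B\<^sup>n\<close> times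
  absolute row sums, and these interpolate between the decay constant and the operator norm \<open>\<rho>\<^sup>n\<close>.
  Each use of this improves the growth ratio (\<open>power_rate_step\<close>), and finitely many uses bring it
  below 1, so that the Neumann series of \<open>X\<close> converges in the decay class
  (\<open>neumann_series_decay\<close>, \<open>galerkin_residual_matrix\<close>).

  For the second claim, \<open>U\<close> is split into differences of its best approximations with \<open>2\<^sup>j\<close> terms. The
  image of each piece is kept only near the support of the piece, in a neighbourhood that is the
  larger the earlier the piece, so that all neighbourhoods together have about \<open>2\<^sup>J\<close> points while the
  neglected tails sum to \<open>O(2\<^sup>-\<^sup>t\<^sup>J)\<close>, \<open>t = s / d\<close>
  (\<open>decaying_matrix_preserves_algebraic_class\<close>). This is where \<open>s < \<eta> - d\<close> enters.

  The identity \<open>A U = F\<close> for arbitrary \<open>u\<close> in \<open>V\<close> needs Parseval's identity in dimension \<open>d\<close>. It follows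
  from the density of trigonometric polynomials: a square integrable function is approximated by
  continuous functions that vanish on the boundary of the period cell, these are functions on the
  torus, and the Stone-Weierstrass theorem applies there (\<open>trig_dense_L2\<close>). With Parseval the Fourier
  norm of \<open>V\<close> is the integral norm, the form is bounded and coercive in it, and \<open>a(u, \<phi>\<^sub>l)\<close> is the
  sum of the \<open>\<hat>u\<^sub>k a(\<phi>\<^sub>k, \<phi>\<^sub>l)\<close> (\<open>aform_expansion\<close>).
\<close>

section \<open>Finite and infinite sums\<close>

lemma L2_set_triangle_norm:
  fixes f g :: "'i \<Rightarrow> 'b::real_normed_vector"
  shows "L2_set (\<lambda>l. norm (f l + g l)) A \<le> L2_set (\<lambda>l. norm (f l)) A + L2_set (\<lambda>l. norm (g l)) A"
proof -
  have "L2_set (\<lambda>l. norm (f l + g l)) A \<le> L2_set (\<lambda>l. norm (f l) + norm (g l)) A"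
    by (rule L2_set_mono) (auto simp: norm_triangle_ineq)
  also have "\<dots> \<le> L2_set (\<lambda>l. norm (f l)) A + L2_set (\<lambda>l. norm (g l)) A"
    by (rule L2_set_triangle_ineq)
  finally show ?thesis .
qed

lemma L2_set_triangle_norm_sum:
  fixes f :: "'j \<Rightarrow> 'i \<Rightarrow> 'b::real_normed_vector"
  assumes "finite J"
  shows "L2_set (\<lambda>l. norm (\<Sum>j\<in>J. f j l)) A \<le> (\<Sum>j\<in>J. L2_set (\<lambda>l. norm (f j l)) A)"
  using assms
proof (induction J rule: finite_induct)
  case empty
  then show ?case by (simp add: L2_set_def)
next
  case (insert j J)
  then show ?case
    using L2_set_triangle_norm[of "f j" "\<lambda>l. \<Sum>i\<in>J. f i l" A] by simp
qed

lemma has_sum_finite_sum: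
  fixes f :: "'j \<Rightarrow> 'i \<Rightarrow> 'b::{topological_comm_monoid_add}"
  assumes "\<And>j. j \<in> J \<Longrightarrow> (f j has_sum s j) A"
  shows "((\<lambda>k. \<Sum>j\<in>J. f j k) has_sum (\<Sum>j\<in>J. s j)) A"
  using assms by (induction J rule: infinite_finite_induct) (auto intro: has_sum_add)

lemma has_sum_subtract:
  fixes f g :: "'i \<Rightarrow> 'b::real_normed_vector"
  assumes "(f has_sum a) A" "(g has_sum b) A"
  shows "((\<lambda>k. f k - g k) has_sum (a - b)) A"
  using has_sum_add[OF assms(1), of "\<lambda>k. - g k" "- b"] assms(2) by (simp add: has_sum_uminus)

section \<open>Square summable families and their approximation errors\<close>

abbreviation drop_on :: "'i set \<Rightarrow> ('i \<Rightarrow> complex) \<Rightarrow> 'i \<Rightarrow> complex" where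
  "drop_on S U \<equiv> \<lambda>k. if k \<in> S then 0 else U k"

text \<open>
  The error functional of the approximation classes, transported to sequences by the rescaled Fourier
  coefficients.
\<close>

definition seq_err :: "nat \<Rightarrow> ('i \<Rightarrow> complex) \<Rightarrow> real" where
  "seq_err N U = (INF \<Lambda>\<in>{\<Lambda>. finite \<Lambda> \<and> card \<Lambda> = N}. ell2_norm (drop_on \<Lambda> U))"

abbreviation l2 :: "('i \<Rightarrow> complex) \<Rightarrow> 'i set \<Rightarrow> real" where
  "l2 U L \<equiv> L2_set (\<lambda>k. cmod (U k)) L"

lemma ell2_norm_nonneg: "0 \<le> ell2_norm U"
  by (simp add: ell2_norm_def infsum_nonneg)

lemma L2_set_le_ell2_norm:
  assumes "U \<in> ell2" "finite L"
  shows "l2 U L \<le> ell2_norm U"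
  using assms unfolding L2_set_def ell2_norm_def ell2_def
  by (intro real_sqrt_le_mono finite_sum_le_infsum) auto

lemma ell2_normI:
  assumes "\<And>L. finite L \<Longrightarrow> l2 U L \<le> b"
  shows "U \<in> ell2" "ell2_norm U \<le> b"
proof -
  have b: "0 \<le> b" using assms[of "{}"] by simp
  have s: "(\<Sum>k\<in>L. (cmod (U k))\<^sup>2) \<le> b\<^sup>2" if "finite L" for L
  proof -
    have "(l2 U L)\<^sup>2 \<le> b\<^sup>2" using assms[OF that] by (intro power_mono) auto
    then show ?thesis by (simp add: L2_set_def sum_nonneg)
  qed
  have sm: "(\<lambda>k. (cmod (U k))\<^sup>2) summable_on UNIV"
    by (rule nonneg_bdd_above_summable_on) (auto intro!: bdd_aboveI[of _ "b\<^sup>2"] s)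
  then show "U \<in> ell2" by (simp add: ell2_def)
  have "(\<Sum>\<^sub>\<infinity>k. (cmod (U k))\<^sup>2) \<le> b\<^sup>2"
    by (rule infsum_le_finite_sums[OF sm]) (use s in auto)
  then show "ell2_norm U \<le> b"
    unfolding ell2_norm_def using b real_le_lsqrt by (simp add: real_le_lsqrt infsum_nonneg)
qed

lemma ell2_norm_restrict:
  assumes "U \<in> ell2" "\<And>k. cmod (V k) \<le> cmod (U k)"
  shows "V \<in> ell2" "ell2_norm V \<le> ell2_norm U"
proof -
  have "l2 V L \<le> ell2_norm U" if "finite L" for L
    by (rule order_trans[OF L2_set_mono L2_set_le_ell2_norm[OF assms(1) that]]) (use assms in auto)
  from ell2_normI[of V, OF this] show "V \<in> ell2" "ell2_norm V \<le> ell2_norm U" by auto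
qed

lemma seq_err_nonneg:
  assumes "infinite (UNIV :: 'i set)"
  shows "0 \<le> seq_err N (U :: 'i \<Rightarrow> complex)"
proof -
  obtain X :: "'i set" where "finite X" "card X = N"
    using infinite_arbitrarily_large[OF assms] by blast
  then show ?thesis unfolding seq_err_def
    by (intro cINF_greatest) (auto intro: ell2_norm_nonneg)
qed

lemma seq_err_lessD:
  assumes "infinite (UNIV :: 'i set)" "seq_err N (U :: 'i \<Rightarrow> complex) < b"
  shows "\<exists>S. finite S \<and> card S = N \<and> ell2_norm (drop_on S U) < b"
proof -
  obtain X :: "'i set" where "finite X" "card X = N"
    using infinite_arbitrarily_large[OF assms(1)] by blast
  then have "(\<lambda>\<Lambda>. ell2_norm (drop_on \<Lambda> U)) ` {\<Lambda>. finite \<Lambda> \<and> card \<Lambda> = N} \<noteq> {}"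
    by blast
  from cInf_lessD[OF this assms(2)[unfolded seq_err_def]] show ?thesis by auto
qed

lemma le_mult_right_limit:
  fixes a m K0 :: real
  assumes "\<And>K. K0 < K \<Longrightarrow> a \<le> m * K"
  shows "a \<le> m * K0"
proof (rule tendsto_lowerbound)
  show "((\<lambda>K. m * K) \<longlongrightarrow> m * K0) (at_right K0)" by (intro tendsto_intros)
  show "\<forall>\<^sub>F K in at_right K0. a \<le> m * K"
    using assms by (auto simp: eventually_at_filter)
qed simp

section \<open>Weights of off-diagonal decay\<close>

text \<open>
  The properties of \<open>w(m) = (1 + |m|)\<^sup>-\<^sup>\<eta>\<close> on \<open>\<int>\<^sup>d\<close> that matter for matrices with entries dominated by
  \<open>w(l - k)\<close>. \<open>w_split\<close> expresses that one of two steps covers at least half of the way; it makes the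
  class of dominated matrices an algebra. \<open>tail\<close> measures summability by counting points instead of
  radii: off a suitable set of at most \<open>y\<close> points the sum is \<open>O(y\<^sup>-\<^sup>p)\<close>, which for this \<open>w\<close> holds with
  \<open>p = (\<eta> - d) / d\<close>. Counting is what best approximation with \<open>N\<close> terms sees.
\<close>

locale lattice_weight =
  fixes w :: "'i::ab_group_add \<Rightarrow> real" and D p T :: real
  assumes w_nonneg: "0 \<le> w a" and w_le_1: "w a \<le> 1" and w_zero: "w 0 = 1"
    and w_split: "w a \<le> D * w (a + b) \<or> w b \<le> D * w (a + b)"
    and p_pos: "0 < p"
    and tail: "1 \<le> y \<Longrightarrow> \<exists>B. finite B \<and> real (card B) \<le> y \<and>
                 (\<forall>F. finite F \<longrightarrow> F \<inter> B = {} \<longrightarrow> sum w F \<le> T * y powr (- p))"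
begin

text \<open>
  A bound of all finite sums of \<open>w\<close>: the exceptional set of \<open>tail\<close> for \<open>y = 1\<close> has at most one point.
\<close>

definition mass :: real where "mass = 1 + T"

definition decays :: "real \<Rightarrow> 'i set \<Rightarrow> ('i \<Rightarrow> 'i \<Rightarrow> complex) \<Rightarrow> bool" where
  "decays x \<Lambda> X \<longleftrightarrow> (\<forall>l\<in>\<Lambda>. \<forall>k\<in>\<Lambda>. cmod (X l k) \<le> x * w (l - k))"

lemma D_ge_1: "1 \<le> D"
  using w_split[of 0 0] by (simp add: w_zero)

lemma T_nonneg: "0 \<le> T"
proof -
  obtain B where "\<And>F. finite F \<Longrightarrow> F \<inter> B = {} \<Longrightarrow> sum w F \<le> T * 1 powr (- p)"
    using tail[of 1] by auto
  from this[of "{}"] show ?thesis by simp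
qed

lemma mass_ge_1: "1 \<le> mass"
  using T_nonneg by (simp add: mass_def)

lemma sum_w_le: "finite F \<Longrightarrow> sum w F \<le> mass"
proof -
  assume F: "finite F"
  obtain B where B: "finite B" "real (card B) \<le> 1"
    and t: "\<And>F. finite F \<Longrightarrow> F \<inter> B = {} \<Longrightarrow> sum w F \<le> T * 1 powr (- p)"
    using tail[of 1] by auto
  have "sum w F = sum w (F \<inter> B) + sum w (F - B)"
    by (rule sum.Int_Diff[OF F])
  also have "sum w (F \<inter> B) \<le> sum (\<lambda>_. 1) (F \<inter> B)"
    by (rule sum_mono) (rule w_le_1)
  also have "\<dots> \<le> 1"
    using B card_mono[of B "F \<inter> B"] by auto
  also have "sum w (F - B) \<le> T"
    using t[of "F - B"] F by auto
  finally show ?thesis by (simp add: mass_def)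
qed

lemma sum_w_row: "finite F \<Longrightarrow> (\<Sum>m\<in>F. w (l - m)) \<le> mass"
  using sum_w_le[of "(\<lambda>m. l - m) ` F"] by (simp add: sum.reindex inj_on_def)

lemma sum_w_col: "finite F \<Longrightarrow> (\<Sum>m\<in>F. w (m - k)) \<le> mass"
  using sum_w_le[of "(\<lambda>m. m - k) ` F"] by (simp add: sum.reindex inj_on_def)

text \<open>
  At each intermediate index one of the two factors already decays like \<open>w(l - k)\<close>, up to the constant
  \<open>D\<close>, so only the absolute sum of the other factor is left. The bound is linear in each sum; this is
  what lets the operator norm in through \<open>sum_le_interpolated\<close>.
\<close>

lemma product_decay:
  assumes "finite \<Lambda>"
    and X: "\<And>m. m \<in> \<Lambda> \<Longrightarrow> cmod (X m) \<le> x * w (l - m)"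
    and Y: "\<And>m. m \<in> \<Lambda> \<Longrightarrow> cmod (Y m) \<le> y * w (m - k)"
    and "0 \<le> x" "0 \<le> y"
    and \<xi>: "(\<Sum>m\<in>\<Lambda>. cmod (X m)) \<le> \<xi>" and \<upsilon>: "(\<Sum>m\<in>\<Lambda>. cmod (Y m)) \<le> \<upsilon>"
  shows "cmod (\<Sum>m\<in>\<Lambda>. X m * Y m) \<le> D * (x * \<upsilon> + y * \<xi>) * w (l - k)"
proof -
  let ?c = "D * w (l - k)"
  have c: "0 \<le> ?c" using D_ge_1 w_nonneg by simp
  have summand: "cmod (X m) * cmod (Y m) \<le> ?c * (x * cmod (Y m) + y * cmod (X m))" if m: "m \<in> \<Lambda>" for m
  proof -
    have eq: "(l - m) + (m - k) = l - k" by simp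
    from w_split[of "l - m" "m - k"] eq
    consider "w (l - m) \<le> ?c" | "w (m - k) \<le> ?c" by metis
    then show ?thesis
    proof cases
      case 1
      have "cmod (X m) \<le> x * ?c"
        using X[OF m] mult_left_mono[OF 1 \<open>0 \<le> x\<close>] by linarith
      then have "cmod (X m) * cmod (Y m) \<le> x * ?c * cmod (Y m)"
        by (rule mult_right_mono) simp
      also have "\<dots> \<le> ?c * (x * cmod (Y m) + y * cmod (X m))"
        using mult_nonneg_nonneg[OF c mult_nonneg_nonneg[OF \<open>0 \<le> y\<close> norm_ge_zero[of "X m"]]]
        by (simp add: algebra_simps)
      finally show ?thesis .
    next
      case 2
      have "cmod (Y m) \<le> y * ?c"
        using Y[OF m] mult_left_mono[OF 2 \<open>0 \<le> y\<close>] by linarith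
      then have "cmod (X m) * cmod (Y m) \<le> cmod (X m) * (y * ?c)"
        by (rule mult_left_mono) simp
      also have "\<dots> \<le> ?c * (x * cmod (Y m) + y * cmod (X m))"
        using mult_nonneg_nonneg[OF c mult_nonneg_nonneg[OF \<open>0 \<le> x\<close> norm_ge_zero[of "Y m"]]]
        by (simp add: algebra_simps)
      finally show ?thesis .
    qed
  qed
  have "cmod (\<Sum>m\<in>\<Lambda>. X m * Y m) \<le> (\<Sum>m\<in>\<Lambda>. cmod (X m) * cmod (Y m))"
    using norm_sum[of "\<lambda>m. X m * Y m" \<Lambda>] by (simp add: norm_mult)
  also have "\<dots> \<le> (\<Sum>m\<in>\<Lambda>. ?c * (x * cmod (Y m) + y * cmod (X m)))"
    by (rule sum_mono) (rule summand)
  also have "\<dots> = ?c * (x * (\<Sum>m\<in>\<Lambda>. cmod (Y m)) + y * (\<Sum>m\<in>\<Lambda>. cmod (X m)))"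
    by (simp add: sum_distrib_left[symmetric] sum.distrib)
  also have "\<dots> \<le> ?c * (x * \<upsilon> + y * \<xi>)"
    by (intro mult_left_mono add_mono \<xi> \<upsilon> c assms)
  finally show ?thesis by (simp add: mult_ac)
qed

definition alg_const :: real where "alg_const = 2 * D * mass"

lemma alg_const_ge_1: "1 \<le> alg_const"
  using mult_mono[OF D_ge_1 mass_ge_1] D_ge_1 mass_ge_1 by (simp add: alg_const_def)

lemma product_decay_alg:
  assumes "finite \<Lambda>"
    and X: "\<And>m. m \<in> \<Lambda> \<Longrightarrow> cmod (X m) \<le> x * w (l - m)"
    and Y: "\<And>m. m \<in> \<Lambda> \<Longrightarrow> cmod (Y m) \<le> y * w (m - k)"
    and "0 \<le> x" "0 \<le> y"
  shows "cmod (\<Sum>m\<in>\<Lambda>. X m * Y m) \<le> alg_const * x * y * w (l - k)"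
proof -
  have "(\<Sum>m\<in>\<Lambda>. cmod (X m)) \<le> (\<Sum>m\<in>\<Lambda>. x * w (l - m))"
    by (rule sum_mono) (rule X)
  also have "\<dots> \<le> x * mass"
    unfolding sum_distrib_left[symmetric]
    by (rule mult_left_mono[OF sum_w_row[OF assms(1)] \<open>0 \<le> x\<close>])
  finally have \<xi>: "(\<Sum>m\<in>\<Lambda>. cmod (X m)) \<le> x * mass" .
  have "(\<Sum>m\<in>\<Lambda>. cmod (Y m)) \<le> (\<Sum>m\<in>\<Lambda>. y * w (m - k))"
    by (rule sum_mono) (rule Y)
  also have "\<dots> \<le> y * mass"
    unfolding sum_distrib_left[symmetric]
    by (rule mult_left_mono[OF sum_w_col[OF assms(1)] \<open>0 \<le> y\<close>])
  finally have \<upsilon>: "(\<Sum>m\<in>\<Lambda>. cmod (Y m)) \<le> y * mass" .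
  have "cmod (\<Sum>m\<in>\<Lambda>. X m * Y m) \<le> D * (x * (y * mass) + y * (x * mass)) * w (l - k)"
    by (rule product_decay[OF assms \<xi> \<upsilon>])
  then show ?thesis by (simp add: alg_const_def algebra_simps)
qed

text \<open>
  The \<open>y\<close> largest places of the weight are handled by the Cauchy-Schwarz inequality and cost
  \<open>\<surd>y\<close> times the Euclidean norm, the others are handled by the decay.
\<close>

lemma sum_le_interpolated:
  assumes "finite \<Lambda>" "inj_on \<pi> \<Lambda>"
    and f: "\<And>m. m \<in> \<Lambda> \<Longrightarrow> cmod (f m) \<le> x * w (\<pi> m)" and "0 \<le> x"
    and \<epsilon>: "l2 f \<Lambda> \<le> \<epsilon>" and y: "1 \<le> y"
  shows "(\<Sum>m\<in>\<Lambda>. cmod (f m)) \<le> sqrt y * \<epsilon> + x * T * y powr (- p)"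
proof -
  obtain B where B: "finite B" "real (card B) \<le> y"
    and t: "\<And>F. finite F \<Longrightarrow> F \<inter> B = {} \<Longrightarrow> sum w F \<le> T * y powr (- p)"
    using tail[OF y] by auto
  define N where "N = {m \<in> \<Lambda>. \<pi> m \<in> B}"
  have fin: "finite N" using assms(1) by (simp add: N_def)
  have \<epsilon>0: "0 \<le> \<epsilon>" using \<epsilon> L2_set_nonneg order_trans by blast
  have "card N \<le> card B"
    by (rule card_inj_on_le[of \<pi>]) (auto simp: N_def B intro: inj_on_subset[OF assms(2)])
  then have cN: "real (card N) \<le> y" using B by linarith
  have "(\<Sum>m\<in>N. \<bar>1\<bar> * \<bar>cmod (f m)\<bar>) \<le> L2_set (\<lambda>_. 1) N * l2 f N"
    by (rule L2_set_mult_ineq)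
  also have "\<dots> \<le> sqrt y * \<epsilon>"
  proof (rule mult_mono)
    show "L2_set (\<lambda>_. 1::real) N \<le> sqrt y" using cN by (simp add: L2_set_constant)
    have "l2 f N \<le> l2 f \<Lambda>"
      unfolding L2_set_def using assms(1) by (intro real_sqrt_le_mono sum_mono2) (auto simp: N_def)
    then show "l2 f N \<le> \<epsilon>" using \<epsilon> by linarith
  qed (use y in auto)
  finally have 1: "(\<Sum>m\<in>N. cmod (f m)) \<le> sqrt y * \<epsilon>" by simp
  have "(\<Sum>m\<in>\<Lambda> - N. cmod (f m)) \<le> (\<Sum>m\<in>\<Lambda> - N. x * w (\<pi> m))"
    by (rule sum_mono) (use f in auto)
  also have "\<dots> = x * sum w (\<pi> ` (\<Lambda> - N))"
    unfolding sum_distrib_left[symmetric]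
    by (subst sum.reindex) (auto intro: inj_on_subset[OF assms(2)])
  also have "\<dots> \<le> x * (T * y powr (- p))"
    by (intro mult_left_mono t \<open>0 \<le> x\<close>) (use assms(1) in \<open>auto simp: N_def\<close>)
  finally have 2: "(\<Sum>m\<in>\<Lambda> - N. cmod (f m)) \<le> x * T * y powr (- p)" by simp
  have "(\<Sum>m\<in>\<Lambda>. cmod (f m)) = (\<Sum>m\<in>\<Lambda> - N. cmod (f m)) + (\<Sum>m\<in>N. cmod (f m))"
    by (rule sum.subset_diff) (auto simp: N_def assms(1))
  then show ?thesis using 1 2 by linarith
qed

text \<open>
  Young's inequality for convolutions (equivalently the Schur test), on finite sections.
\<close>

lemma young_finite:
  assumes "finite F" and "finite L"
    and g: "\<And>m. 0 \<le> g m" and \<gamma>: "\<And>F. finite F \<Longrightarrow> sum g F \<le> \<gamma>"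
    and R: "\<And>l k. l \<in> L \<Longrightarrow> k \<in> F \<Longrightarrow> cmod (R l k) \<le> g (l - k :: 'i)"
  shows "l2 (\<lambda>l. \<Sum>k\<in>F. R l k * v k) L \<le> \<gamma> * l2 v F"
proof -
  have \<gamma>0: "0 \<le> \<gamma>" using \<gamma>[of "{}"] by simp
  have row: "(\<Sum>m\<in>F. g (l - m)) \<le> \<gamma>" for l
    using \<gamma>[of "(\<lambda>m. l - m) ` F"] assms(1) by (simp add: sum.reindex inj_on_def)
  have col: "(\<Sum>l\<in>L. g (l - k)) \<le> \<gamma>" for k
    using \<gamma>[of "(\<lambda>m. m - k) ` L"] assms(2) by (simp add: sum.reindex inj_on_def)
  have one: "(cmod (\<Sum>k\<in>F. R l k * v k))\<^sup>2 \<le> \<gamma> * (\<Sum>k\<in>F. g (l - k) * (cmod (v k))\<^sup>2)"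
    if l: "l \<in> L" for l
  proof -
    have "cmod (\<Sum>k\<in>F. R l k * v k) \<le> (\<Sum>k\<in>F. cmod (R l k * v k))"
      by (rule norm_sum)
    also have "\<dots> \<le> (\<Sum>k\<in>F. \<bar>sqrt (g (l - k))\<bar> * \<bar>sqrt (g (l - k)) * cmod (v k)\<bar>)"
      using R[OF l] g by (intro sum_mono) (auto simp: norm_mult abs_mult mult.assoc[symmetric] intro!: mult_right_mono)
    also have "\<dots> \<le> L2_set (\<lambda>k. sqrt (g (l - k))) F * L2_set (\<lambda>k. sqrt (g (l - k)) * cmod (v k)) F"
      by (rule L2_set_mult_ineq)
    finally have "(cmod (\<Sum>k\<in>F. R l k * v k))\<^sup>2 \<le>
       (L2_set (\<lambda>k. sqrt (g (l - k))) F * L2_set (\<lambda>k. sqrt (g (l - k)) * cmod (v k)) F)\<^sup>2"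
      by (rule power_mono) simp
    also have "\<dots> = (\<Sum>k\<in>F. g (l - k)) * (\<Sum>k\<in>F. g (l - k) * (cmod (v k))\<^sup>2)"
      using g by (simp add: L2_set_def power_mult_distrib sum_nonneg)
    also have "\<dots> \<le> \<gamma> * (\<Sum>k\<in>F. g (l - k) * (cmod (v k))\<^sup>2)"
      using g by (intro mult_right_mono row sum_nonneg) auto
    finally show ?thesis .
  qed
  have "(\<Sum>l\<in>L. (cmod (\<Sum>k\<in>F. R l k * v k))\<^sup>2) \<le> (\<Sum>l\<in>L. \<gamma> * (\<Sum>k\<in>F. g (l - k) * (cmod (v k))\<^sup>2))"
    by (rule sum_mono) (rule one)
  also have "\<dots> = \<gamma> * (\<Sum>k\<in>F. (\<Sum>l\<in>L. g (l - k)) * (cmod (v k))\<^sup>2)"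
    unfolding sum_distrib_left[symmetric] sum_distrib_right by (subst sum.swap) (rule refl)
  also have "\<dots> \<le> \<gamma> * (\<Sum>k\<in>F. \<gamma> * (cmod (v k))\<^sup>2)"
    by (intro mult_left_mono sum_mono mult_right_mono col \<gamma>0) auto
  also have "\<dots> = \<gamma>\<^sup>2 * (\<Sum>k\<in>F. (cmod (v k))\<^sup>2)"
    by (simp add: sum_distrib_left[symmetric] power2_eq_square)
  finally have "l2 (\<lambda>l. \<Sum>k\<in>F. R l k * v k) L \<le> sqrt (\<gamma>\<^sup>2 * (\<Sum>k\<in>F. (cmod (v k))\<^sup>2))"
    unfolding L2_set_def by (rule real_sqrt_le_mono)
  then show ?thesis using \<gamma>0 by (simp add: L2_set_def real_sqrt_mult)
qed

section \<open>Powers of a contraction\<close>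

definition contracts :: "real \<Rightarrow> 'i set \<Rightarrow> ('i \<Rightarrow> 'i \<Rightarrow> complex) \<Rightarrow> bool" where
  "contracts e \<Lambda> X \<longleftrightarrow> (\<forall>v. l2 (\<lambda>l. \<Sum>m\<in>\<Lambda>. X l m * v m) \<Lambda> \<le> e * l2 v \<Lambda>)"

lemma contractsD:
  "contracts e \<Lambda> X \<Longrightarrow> l2 (\<lambda>l. \<Sum>m\<in>\<Lambda>. X l m * v m) \<Lambda> \<le> e * l2 v \<Lambda>"
  by (simp add: contracts_def)

primrec mpow :: "'i set \<Rightarrow> ('i \<Rightarrow> 'i \<Rightarrow> complex) \<Rightarrow> nat \<Rightarrow> 'i \<Rightarrow> 'i \<Rightarrow> complex" where
  "mpow \<Lambda> X 0 = (\<lambda>l k. if l = k then 1 else 0)"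
| "mpow \<Lambda> X (Suc n) = (\<lambda>l k. \<Sum>m\<in>\<Lambda>. X l m * mpow \<Lambda> X n m k)"

lemma mpow_add:
  assumes "finite \<Lambda>" "l \<in> \<Lambda>"
  shows "mpow \<Lambda> X (a + b) l k = (\<Sum>m\<in>\<Lambda>. mpow \<Lambda> X a l m * mpow \<Lambda> X b m k)"
  using assms(2)
proof (induction a arbitrary: l)
  case 0
  then show ?case using assms(1)
    by (simp add: if_distrib[of "\<lambda>c. c * _"] cong: if_cong)
next
  case (Suc a)
  have "mpow \<Lambda> X (Suc a + b) l k = (\<Sum>m\<in>\<Lambda>. X l m * (\<Sum>n\<in>\<Lambda>. mpow \<Lambda> X a m n * mpow \<Lambda> X b n k))"
    using Suc.IH by simp
  also have "\<dots> = (\<Sum>n\<in>\<Lambda>. \<Sum>m\<in>\<Lambda>. X l m * mpow \<Lambda> X a m n * mpow \<Lambda> X b n k)"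
    unfolding sum_distrib_left mult.assoc by (rule sum.swap)
  finally show ?case by (simp add: sum_distrib_right)
qed

lemma contracts_mpow:
  assumes "finite \<Lambda>" "contracts \<rho> \<Lambda> X" "0 \<le> \<rho>"
  shows "contracts (\<rho> ^ n) \<Lambda> (mpow \<Lambda> X n)"
proof (induction n)
  case 0
  have "(\<Sum>m\<in>\<Lambda>. (if l = m then 1 else 0) * v m) = v l" if "l \<in> \<Lambda>" for l and v :: "'i \<Rightarrow> complex"
    using assms(1) that by (simp add: if_distrib[of "\<lambda>c. c * _"] cong: if_cong)
  then show ?case by (auto simp: contracts_def intro!: L2_set_mono)
next
  case (Suc n)
  show ?case unfolding contracts_def
  proof
    fix v
    have eq: "(\<Sum>k\<in>\<Lambda>. mpow \<Lambda> X (Suc n) l k * v k) = (\<Sum>m\<in>\<Lambda>. X l m * (\<Sum>k\<in>\<Lambda>. mpow \<Lambda> X n m k * v k))" for l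
      unfolding mpow.simps sum_distrib_left sum_distrib_right mult.assoc by (rule sum.swap)
    have "l2 (\<lambda>l. \<Sum>k\<in>\<Lambda>. mpow \<Lambda> X (Suc n) l k * v k) \<Lambda>
        \<le> \<rho> * l2 (\<lambda>m. \<Sum>k\<in>\<Lambda>. mpow \<Lambda> X n m k * v k) \<Lambda>"
      unfolding eq by (rule contractsD[OF assms(2)])
    also have "\<dots> \<le> \<rho> * (\<rho> ^ n * l2 v \<Lambda>)"
      using Suc.IH \<open>0 \<le> \<rho>\<close> unfolding contracts_def by (intro mult_left_mono) auto
    finally show "l2 (\<lambda>l. \<Sum>k\<in>\<Lambda>. mpow \<Lambda> X (Suc n) l k * v k) \<Lambda>
        \<le> \<rho> ^ Suc n * l2 v \<Lambda>" by (simp add: mult.assoc)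
  qed
qed

lemma contracts_col:
  assumes "finite \<Lambda>" "contracts e \<Lambda> X" "k \<in> \<Lambda>"
  shows "l2 (\<lambda>l. X l k) \<Lambda> \<le> e"
proof -
  let ?v = "\<lambda>m. if m = k then 1 else (0::complex)"
  have "l2 (\<lambda>l. \<Sum>m\<in>\<Lambda>. X l m * ?v m) \<Lambda> \<le> e * l2 ?v \<Lambda>"
    by (rule contractsD[OF assms(2)])
  moreover have "(\<Sum>m\<in>\<Lambda>. X l m * ?v m) = X l k" for l
    using assms by (simp add: if_distrib[of "\<lambda>c. _ * c"] cong: if_cong)
  moreover have "l2 ?v \<Lambda> = 1"
  proof -
    have "(\<Sum>m\<in>\<Lambda>. (cmod (?v m))\<^sup>2) = (\<Sum>m\<in>\<Lambda>. if m = k then 1 else 0)"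
      by (intro sum.cong) auto
    also have "\<dots> = 1" using assms by simp
    finally show ?thesis by (simp only: L2_set_def real_sqrt_one)
  qed
  ultimately show ?thesis by simp
qed

text \<open>
  Testing with the conjugated row produces the squared Euclidean norm of that row as one component
  of the image, so the operator norm controls rows as well as columns.
\<close>

lemma contracts_row:
  assumes "finite \<Lambda>" "contracts e \<Lambda> X" "l \<in> \<Lambda>"
  shows "l2 (\<lambda>k. X l k) \<Lambda> \<le> e"
proof -
  let ?v = "\<lambda>m. cnj (X l m)" and ?r = "l2 (\<lambda>k. X l k) \<Lambda>"
  have "(\<Sum>m\<in>\<Lambda>. X l m * ?v m) = complex_of_real (\<Sum>m\<in>\<Lambda>. (cmod (X l m))\<^sup>2)"
    unfolding of_real_sum by (intro sum.cong refl complex_norm_square[symmetric])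
  then have "cmod (\<Sum>m\<in>\<Lambda>. X l m * ?v m) = (\<Sum>m\<in>\<Lambda>. (cmod (X l m))\<^sup>2)"
    by (simp only: norm_of_real) (simp add: sum_nonneg)
  then have "?r\<^sup>2 = cmod (\<Sum>m\<in>\<Lambda>. X l m * ?v m)"
    by (simp add: L2_set_def sum_nonneg)
  also have "\<dots> \<le> l2 (\<lambda>l. \<Sum>m\<in>\<Lambda>. X l m * ?v m) \<Lambda>"
    by (rule member_le_L2_set[OF assms(1,3)])
  also have "\<dots> \<le> e * l2 ?v \<Lambda>"
    by (rule contractsD[OF assms(2)])
  finally have *: "?r * ?r \<le> e * ?r" by (simp add: power2_eq_square)
  show ?thesis
  proof (cases "?r = 0")
    case True
    have "0 \<le> l2 (\<lambda>m. X m l) \<Lambda>" by simp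
    also have "\<dots> \<le> e" by (rule contracts_col[OF assms])
    finally show ?thesis using True by simp
  next
    case False
    then have "0 < ?r" using L2_set_nonneg[of "\<lambda>k. cmod (X l k)" \<Lambda>] by linarith
    with * show ?thesis by simp
  qed
qed


text \<open>
  A ratio \<open>q\<close> for the geometric growth of the decay constants of powers. It is important that
  \<open>K\<close> is chosen before the finite set and the matrix.
\<close>

definition power_rate :: "real \<Rightarrow> real \<Rightarrow> real \<Rightarrow> bool" where
  "power_rate c \<rho> q \<longleftrightarrow> (\<exists>K\<ge>0. \<forall>\<Lambda> X n. finite \<Lambda> \<longrightarrow> decays c \<Lambda> X \<longrightarrow> contracts \<rho> \<Lambda> X \<longrightarrow>
     decays (K * q ^ n) \<Lambda> (mpow \<Lambda> X n))"

lemma decays_mono: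
  assumes "decays x \<Lambda> X" "x \<le> y" shows "decays y \<Lambda> X"
  using assms(1) unfolding decays_def
  by (meson assms(2) mult_right_mono order_trans w_nonneg)

lemma power_rate_mono:
  assumes "power_rate c \<rho> q" "0 \<le> q" "q \<le> q'"
  shows "power_rate c \<rho> q'"
proof -
  obtain K where K: "0 \<le> K" and d: "\<And>\<Lambda> X n. finite \<Lambda> \<Longrightarrow> decays c \<Lambda> X \<Longrightarrow> contracts \<rho> \<Lambda> X \<Longrightarrow>
     decays (K * q ^ n) \<Lambda> (mpow \<Lambda> X n)"
    using assms(1) unfolding power_rate_def by blast
  have "K * q ^ n \<le> K * q' ^ n" for n
    using K assms by (intro mult_left_mono power_mono) auto
  then show ?thesis unfolding power_rate_def using K d decays_mono by blast
qed

lemma power_rate_init: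
  assumes "0 \<le> c"
  shows "power_rate c \<rho> (alg_const * c)"
proof -
  have ac: "0 \<le> alg_const" using alg_const_ge_1 by linarith
  have "decays ((alg_const * c) ^ n) \<Lambda> (mpow \<Lambda> X n)" if "finite \<Lambda>" "decays c \<Lambda> X" for \<Lambda> X n
  proof (induction n)
    case 0
    then show ?case by (auto simp: decays_def w_zero w_nonneg)
  next
    case (Suc n)
    show ?case unfolding decays_def
    proof (intro ballI)
      fix l k assume lk: "l \<in> \<Lambda>" "k \<in> \<Lambda>"
      have "cmod (\<Sum>m\<in>\<Lambda>. X l m * mpow \<Lambda> X n m k) \<le> alg_const * c * (alg_const * c) ^ n * w (l - k)"
        by (rule product_decay_alg) (use that Suc lk assms ac in \<open>auto simp: decays_def\<close>)
      then show "cmod (mpow \<Lambda> X (Suc n) l k) \<le> (alg_const * c) ^ Suc n * w (l - k)"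
        by simp
    qed
  qed
  then show ?thesis unfolding power_rate_def by (intro exI[of _ 1]) auto
qed

text \<open>
  One squaring step moves a growth ratio from \<open>\<rho> a\<close> to \<open>\<rho> a\<^sup>\<gamma>\<close> with this \<open>\<gamma>\<close>, which is less than 1.
\<close>

definition rate_exponent :: real where "rate_exponent = (p + 1) / (2 * p + 1)"

text \<open>
  Squaring \<open>B\<^sup>n\<close> multiplies its decay constant by its row and column sums, which are at most
  \<open>\<surd>y \<rho>\<^sup>n + K T (\<rho> a)\<^sup>n y\<^sup>-\<^sup>p\<close> for every \<open>y \<ge> 1\<close>. The choice \<open>y = (a\<^sup>2\<^sup>h)\<^sup>n\<close> with \<open>h = 1 / (2 p + 1)\<close> balances
  the two terms: both become multiples of \<open>\<sigma>\<^sup>n\<close> with \<open>\<sigma> = \<rho> a\<^sup>h < \<rho> a\<close>. So \<open>B\<^sup>2\<^sup>n\<close> grows like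
  \<open>(\<rho> a \<sigma>)\<^sup>n\<close>, and the new ratio is the geometric mean of \<open>\<rho> a\<close> and \<open>\<sigma>\<close>.
\<close>

lemma power_rate_step:
  assumes c: "0 \<le> c" and \<rho>: "0 < \<rho>" and a: "1 < a" and rate: "power_rate c \<rho> (\<rho> * a)"
  shows "power_rate c \<rho> (\<rho> * a powr rate_exponent)"
proof -
  define h where "h = 1 / (2 * p + 1)"
  define \<sigma> where "\<sigma> = \<rho> * a powr h"
  define q' where "q' = \<rho> * a powr rate_exponent"
  have \<sigma>: "0 < \<sigma>" and q': "0 < q'" using \<rho> a by (auto simp: \<sigma>_def q'_def)
  have "rate_exponent + rate_exponent = (2 * p + 1 + 1) / (2 * p + 1)"
    by (simp add: rate_exponent_def add_divide_distrib[symmetric])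
  then have imp: "rate_exponent + rate_exponent = 1 + h"
    using p_pos divide_self[of "2 * p + 1"] add_divide_distrib[of "2 * p + 1" 1 "2 * p + 1"]
    unfolding h_def by linarith
  have hp: "1 - 2 * h * p = h"
    using p_pos by (simp add: h_def field_simps)
  have sq: "q'\<^sup>2 = (\<rho> * a) * \<sigma>"
  proof -
    have "q'\<^sup>2 = \<rho> * \<rho> * a powr (rate_exponent + rate_exponent)"
      unfolding q'_def power2_eq_square powr_add by simp
    also have "\<dots> = (\<rho> * a) * \<sigma>"
      unfolding imp powr_add using a by (simp add: \<sigma>_def)
    finally show ?thesis .
  qed
  obtain K where K: "0 \<le> K" and d: "\<And>\<Lambda> X n. finite \<Lambda> \<Longrightarrow> decays c \<Lambda> X \<Longrightarrow> contracts \<rho> \<Lambda> X \<Longrightarrow>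
     decays (K * (\<rho> * a) ^ n) \<Lambda> (mpow \<Lambda> X n)"
    using rate unfolding power_rate_def by blast
  have ac: "0 \<le> alg_const" using alg_const_ge_1 by linarith
  define K1 where "K1 = 2 * D * K * (1 + K * T)"
  have K1: "0 \<le> K1" using K T_nonneg D_ge_1 by (simp add: K1_def)
  have even: "decays (K1 * q' ^ (2 * n)) \<Lambda> (mpow \<Lambda> X (2 * n))"
    if fin: "finite \<Lambda>" and dX: "decays c \<Lambda> X" and cX: "contracts \<rho> \<Lambda> X" for \<Lambda> X n
    unfolding decays_def
  proof (intro ballI)
    fix l k assume lk: "l \<in> \<Lambda>" "k \<in> \<Lambda>"
    define x where "x = K * (\<rho> * a) ^ n"
    define y where "y = (a powr (2 * h)) ^ n"
    define \<xi> where "\<xi> = sqrt y * \<rho> ^ n + x * T * y powr (- p)"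
    have x: "0 \<le> x" using K \<rho> a by (simp add: x_def)
    have "1 \<le> a powr (2 * h)" using a p_pos by (intro ge_one_powr_ge_zero) (auto simp: h_def)
    then have y: "1 \<le> y" by (simp add: y_def)
    have dn: "\<And>l k. l \<in> \<Lambda> \<Longrightarrow> k \<in> \<Lambda> \<Longrightarrow> cmod (mpow \<Lambda> X n l k) \<le> x * w (l - k)"
      using d[OF fin dX cX] by (auto simp: decays_def x_def)
    have cn: "contracts (\<rho> ^ n) \<Lambda> (mpow \<Lambda> X n)"
      using contracts_mpow[OF fin cX] \<rho> by simp
    have row: "(\<Sum>m\<in>\<Lambda>. cmod (mpow \<Lambda> X n l m)) \<le> \<xi>"
      unfolding \<xi>_def using dn lk x y contracts_row[OF fin cn lk(1)]
      by (intro sum_le_interpolated[of \<Lambda> "\<lambda>m. l - m"] fin) (auto simp: inj_on_def)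
    have col: "(\<Sum>m\<in>\<Lambda>. cmod (mpow \<Lambda> X n m k)) \<le> \<xi>"
      unfolding \<xi>_def using dn lk x y contracts_col[OF fin cn lk(2)]
      by (intro sum_le_interpolated[of \<Lambda> "\<lambda>m. m - k"] fin) (auto simp: inj_on_def)
    have "cmod (\<Sum>m\<in>\<Lambda>. mpow \<Lambda> X n l m * mpow \<Lambda> X n m k) \<le> D * (x * \<xi> + x * \<xi>) * w (l - k)"
      by (rule product_decay) (use fin dn lk x row col in auto)
    also have "D * (x * \<xi> + x * \<xi>) = K1 * q' ^ (2 * n)"
    proof -
      have "sqrt y = (a powr h) ^ n"
      proof -
        have "y = ((a powr h) ^ n)\<^sup>2"
          by (simp add: y_def power_mult[symmetric] mult.commute[of n] powr_add[symmetric]) 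
             (simp add: power_mult power2_eq_square powr_add[symmetric])
        then show ?thesis by simp
      qed
      then have 1: "sqrt y * \<rho> ^ n = \<sigma> ^ n" by (simp add: \<sigma>_def power_mult_distrib mult.commute)
      have "y powr (- p) = (a powr (- (2 * h * p))) ^ n"
        using a by (simp add: y_def powr_realpow[symmetric] powr_powr) (simp add: mult_ac)
      then have "(\<rho> * a) ^ n * y powr (- p) = (\<rho> * (a powr 1 * a powr (- (2 * h * p)))) ^ n"
        using a by (simp add: power_mult_distrib)
      also have "a powr 1 * a powr (- (2 * h * p)) = a powr h"
        unfolding powr_add[symmetric] using hp by simp
      finally have 2: "(\<rho> * a) ^ n * y powr (- p) = \<sigma> ^ n" by (simp add: \<sigma>_def)
      have "x * T * y powr (- p) = K * T * ((\<rho> * a) ^ n * y powr (- p))" by (simp add: x_def)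
      then have "\<xi> = (1 + K * T) * \<sigma> ^ n"
        unfolding \<xi>_def 1 2 by (simp add: algebra_simps)
      then have "D * (x * \<xi> + x * \<xi>) = K1 * ((\<rho> * a) * \<sigma>) ^ n"
        by (simp add: x_def K1_def power_mult_distrib algebra_simps)
      then show ?thesis by (simp add: sq[symmetric] power_mult)
    qed
    finally show "cmod (mpow \<Lambda> X (2 * n) l k) \<le> K1 * q' ^ (2 * n) * w (l - k)"
      using mpow_add[OF fin lk(1), of X n n k] by (simp add: mult_2)
  qed
  \<comment> \<open>The second summand pays for the additional factor of an odd power.\<close>
  define K2 where "K2 = K1 + alg_const * c * K1 / q'"
  have K12: "K1 \<le> K2" and K2': "alg_const * c * K1 \<le> K2 * q'"
    using K1 ac c q' by (auto simp: K2_def field_simps)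
  have "decays (K2 * q' ^ n) \<Lambda> (mpow \<Lambda> X n)"
    if fin: "finite \<Lambda>" and dX: "decays c \<Lambda> X" and cX: "contracts \<rho> \<Lambda> X" for \<Lambda> X n
  proof (cases "even n")
    case True
    then obtain m where n: "n = 2 * m" by blast
    show ?thesis
      using decays_mono[OF even[OF that, of m], of "K2 * q' ^ n"] K12 q' by (simp add: n mult_right_mono)
  next
    case False
    then obtain m where n: "n = Suc (2 * m)" by (metis oddE Suc_eq_plus1)
    have "decays (alg_const * c * (K1 * q' ^ (2 * m))) \<Lambda> (mpow \<Lambda> X n)"
      unfolding decays_def
    proof (intro ballI)
      fix l k assume lk: "l \<in> \<Lambda>" "k \<in> \<Lambda>"
      have "cmod (\<Sum>j\<in>\<Lambda>. X l j * mpow \<Lambda> X (2 * m) j k) \<le> alg_const * c * (K1 * q' ^ (2 * m)) * w (l - k)"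
        by (rule product_decay_alg) (use fin dX even[OF that, of m] lk K1 q' c in \<open>auto simp: decays_def\<close>)
      then show "cmod (mpow \<Lambda> X n l k) \<le> alg_const * c * (K1 * q' ^ (2 * m)) * w (l - k)"
        by (simp add: n)
    qed
    moreover have "alg_const * c * (K1 * q' ^ (2 * m)) \<le> K2 * q' ^ n"
      using mult_right_mono[OF K2', of "q' ^ (2 * m)"] q' by (simp add: n mult_ac)
    ultimately show ?thesis by (rule decays_mono)
  qed
  moreover have "0 \<le> K2" using K1 K12 by linarith
  ultimately show ?thesis unfolding power_rate_def q'_def by blast
qed

text \<open>
  The iterated ratios \<open>\<rho> a\<^bsup>\<gamma>^i\<^esup>\<close> tend to \<open>\<rho> < 1\<close>.
\<close>

lemma power_rate_less_1:
  assumes c: "0 \<le> c" and \<rho>: "0 < \<rho>" "\<rho> < 1"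
  shows "\<exists>q. 0 < q \<and> q < 1 \<and> power_rate c \<rho> q"
proof -
  \<comment> \<open>Chosen such that \<open>\<rho> * a\<close> dominates the initial ratio \<open>alg_const * c\<close>.\<close>
  define a where "a = max 2 (alg_const * c / \<rho>)"
  have a: "1 < a" by (simp add: a_def)
  have imp: "0 < rate_exponent" "rate_exponent < 1" using p_pos by (auto simp: rate_exponent_def field_simps)
  have rate: "power_rate c \<rho> (\<rho> * a powr (rate_exponent ^ i))" for i
  proof (induction i)
    case 0
    have "alg_const * c \<le> \<rho> * a"
      using \<rho> by (simp add: a_def max_def field_simps)
    then show ?case
      using power_rate_mono[OF power_rate_init[OF c, of \<rho>]] alg_const_ge_1 c a by simp
  next
    case (Suc i)
    have "1 < a powr (rate_exponent ^ i)"
      using a imp by simp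
    from power_rate_step[OF c \<rho>(1) this Suc] show ?case
      by (simp add: powr_powr mult.commute)
  qed
  have "(\<lambda>i. \<rho> * a powr (rate_exponent ^ i)) \<longlonglongrightarrow> \<rho> * a powr 0"
    using imp a by (intro tendsto_intros LIMSEQ_realpow_zero) auto
  then have "\<forall>\<^sub>F i in sequentially. \<rho> * a powr (rate_exponent ^ i) < 1"
    using \<rho> a by (intro order_tendstoD) auto
  then obtain i where "\<rho> * a powr (rate_exponent ^ i) < 1"
    by (auto simp: eventually_sequentially)
  then show ?thesis using rate[of i] \<rho> a by (intro exI[of _ "\<rho> * a powr (rate_exponent ^ i)"]) auto
qed

lemma neumann_series_decay:
  assumes c: "0 \<le> c" and \<rho>: "0 < \<rho>" "\<rho> < 1"
  shows "\<exists>K\<ge>0. \<forall>\<Lambda> X. finite \<Lambda> \<longrightarrow> decays c \<Lambda> X \<longrightarrow> contracts \<rho> \<Lambda> X \<longrightarrow>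
    (\<exists>Y. decays K \<Lambda> Y \<and> (\<forall>l\<in>\<Lambda>. \<forall>k\<in>\<Lambda>. (\<lambda>n. mpow \<Lambda> X n l k) sums Y l k))"
proof -
  obtain q where q: "0 < q" "q < 1" and "power_rate c \<rho> q"
    using power_rate_less_1[OF assms] by blast
  then obtain K where K: "0 \<le> K" and d: "\<And>\<Lambda> X n. finite \<Lambda> \<Longrightarrow> decays c \<Lambda> X \<Longrightarrow> contracts \<rho> \<Lambda> X \<Longrightarrow>
     decays (K * q ^ n) \<Lambda> (mpow \<Lambda> X n)"
    unfolding power_rate_def by blast
  have "\<exists>Y. decays (K / (1 - q)) \<Lambda> Y \<and> (\<forall>l\<in>\<Lambda>. \<forall>k\<in>\<Lambda>. (\<lambda>n. mpow \<Lambda> X n l k) sums Y l k)"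
    if "finite \<Lambda>" "decays c \<Lambda> X" "contracts \<rho> \<Lambda> X" for \<Lambda> X
  proof (intro exI conjI ballI)
    let ?Y = "\<lambda>l k. \<Sum>n. mpow \<Lambda> X n l k"
    have b: "cmod (mpow \<Lambda> X n l k) \<le> (K * w (l - k)) * q ^ n" if "l \<in> \<Lambda>" "k \<in> \<Lambda>" for l k n
      using d[OF \<open>finite \<Lambda>\<close> \<open>decays c \<Lambda> X\<close> \<open>contracts \<rho> \<Lambda> X\<close>, of n] that
      by (auto simp: decays_def mult_ac)
    have s: "summable (\<lambda>n. (K * w (l - k)) * q ^ n)" for l k
      using q by (intro summable_mult summable_geometric) auto
    show "(\<lambda>n. mpow \<Lambda> X n l k) sums ?Y l k" if "l \<in> \<Lambda>" "k \<in> \<Lambda>" for l k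
      using b[OF that] by (intro summable_sums summable_comparison_test'[OF s]) auto
    show "decays (K / (1 - q)) \<Lambda> ?Y" unfolding decays_def
    proof (intro ballI)
      fix l k assume lk: "l \<in> \<Lambda>" "k \<in> \<Lambda>"
      have "cmod (?Y l k) \<le> (\<Sum>n. (K * w (l - k)) * q ^ n)"
        using b[OF lk] by (intro norm_suminf_le s) 
      also have "\<dots> = (K * w (l - k)) * (1 / (1 - q))"
        using q by (subst suminf_mult) (auto simp: suminf_geometric intro: summable_geometric)
      finally show "cmod (?Y l k) \<le> K / (1 - q) * w (l - k)" by simp
    qed
  qed
  moreover have "0 \<le> K / (1 - q)" using K q by simp
  ultimately show ?thesis by blast
qed

text \<open>
  The partial sums telescope to \<open>W\<close> minus the image of \<open>W\<close> under a power of \<open>X\<close>, and the powers tend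
  to 0 because \<open>X\<close> is a contraction.
\<close>

lemma neumann_series_solves:
  assumes fin: "finite \<Lambda>" and con: "contracts \<rho> \<Lambda> X" and \<rho>: "0 \<le> \<rho>" "\<rho> < 1"
    and Y: "\<And>l k. l \<in> \<Lambda> \<Longrightarrow> k \<in> \<Lambda> \<Longrightarrow> (\<lambda>n. mpow \<Lambda> X n l k) sums Y l k"
    and W: "\<And>l. l \<in> \<Lambda> \<Longrightarrow> W l - (\<Sum>k\<in>\<Lambda>. X l k * W k) = g l"
    and l: "l \<in> \<Lambda>"
  shows "W l = (\<Sum>m\<in>\<Lambda>. Y l m * g m)"
proof -
  have step: "(\<Sum>m\<in>\<Lambda>. mpow \<Lambda> X n l m * g m) =
      (\<Sum>m\<in>\<Lambda>. mpow \<Lambda> X n l m * W m) - (\<Sum>m\<in>\<Lambda>. mpow \<Lambda> X (Suc n) l m * W m)" for n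
  proof -
    have X1: "mpow \<Lambda> X 1 m k = X m k" if "k \<in> \<Lambda>" for m k
      using fin that by (simp add: if_distrib[of "\<lambda>c. _ * c"] cong: if_cong)
    have "(\<Sum>m\<in>\<Lambda>. mpow \<Lambda> X n l m * g m) = (\<Sum>m\<in>\<Lambda>. mpow \<Lambda> X n l m * (W m - (\<Sum>k\<in>\<Lambda>. X m k * W k)))"
      using W by (intro sum.cong) auto
    also have "\<dots> = (\<Sum>m\<in>\<Lambda>. mpow \<Lambda> X n l m * W m) - (\<Sum>m\<in>\<Lambda>. \<Sum>k\<in>\<Lambda>. mpow \<Lambda> X n l m * X m k * W k)"
      by (simp add: right_diff_distrib sum_subtractf sum_distrib_left mult.assoc)
    also have "(\<Sum>m\<in>\<Lambda>. \<Sum>k\<in>\<Lambda>. mpow \<Lambda> X n l m * X m k * W k) = (\<Sum>k\<in>\<Lambda>. mpow \<Lambda> X (n + 1) l k * W k)"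
      unfolding mpow_add[OF fin l] sum_distrib_right using X1
      by (subst sum.swap) (intro sum.cong refl, auto)
    finally show ?thesis by simp
  qed
  have partial: "(\<Sum>n<N. \<Sum>m\<in>\<Lambda>. mpow \<Lambda> X n l m * g m) = W l - (\<Sum>m\<in>\<Lambda>. mpow \<Lambda> X N l m * W m)" for N
  proof (induction N)
    case 0
    then show ?case using fin l by (simp add: if_distrib[of "\<lambda>c. c * _"] cong: if_cong)
  next
    case (Suc N)
    then show ?case using step[of N] by (simp del: mpow.simps)
  qed
  have z: "(\<lambda>N. mpow \<Lambda> X N l m) \<longlonglongrightarrow> 0" if "m \<in> \<Lambda>" for m
  proof (rule Lim_null_comparison)
    show "\<forall>\<^sub>F N in sequentially. norm (mpow \<Lambda> X N l m) \<le> \<rho> ^ N"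
    proof (intro always_eventually allI)
      fix N
      have "norm (mpow \<Lambda> X N l m) \<le> l2 (\<lambda>l. mpow \<Lambda> X N l m) \<Lambda>"
        by (rule member_le_L2_set[OF fin l])
      also have "\<dots> \<le> \<rho> ^ N"
        by (rule contracts_col[OF fin contracts_mpow[OF fin con \<rho>(1)] that])
      finally show "norm (mpow \<Lambda> X N l m) \<le> \<rho> ^ N" .
    qed
    show "(\<lambda>N. \<rho> ^ N) \<longlonglongrightarrow> 0" using \<rho> by (intro LIMSEQ_realpow_zero)
  qed
  have "(\<lambda>N. W l - (\<Sum>m\<in>\<Lambda>. mpow \<Lambda> X N l m * W m)) \<longlonglongrightarrow> W l - (\<Sum>m\<in>\<Lambda>. 0 * W m)"
    by (intro tendsto_intros z)
  then have "(\<lambda>N. \<Sum>n<N. \<Sum>m\<in>\<Lambda>. mpow \<Lambda> X n l m * g m) \<longlonglongrightarrow> W l"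
    unfolding partial by simp
  moreover have "(\<lambda>n. \<Sum>m\<in>\<Lambda>. mpow \<Lambda> X n l m * g m) sums (\<Sum>m\<in>\<Lambda>. Y l m * g m)"
    by (intro sums_sum sums_mult2 Y l)
  ultimately show ?thesis unfolding sums_def using LIMSEQ_unique by blast
qed


section \<open>Galerkin residuals\<close>

text \<open>
  Stated through the equations only, so that it applies to any exact solution \<open>U\<close> and any Galerkin
  solution \<open>W\<close> for the same right-hand side \<open>F\<close>.
\<close>

definition residual_matrix :: "('i \<Rightarrow> 'i \<Rightarrow> complex) \<Rightarrow> 'i set \<Rightarrow> ('i \<Rightarrow> 'i \<Rightarrow> complex) \<Rightarrow> bool" where
  "residual_matrix A \<Lambda> R \<longleftrightarrow>
    (\<forall>U F W. (\<forall>l. ((\<lambda>k. A l k * U k) has_sum F l) UNIV) \<longrightarrow>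
       (\<forall>l\<in>\<Lambda>. (\<Sum>k\<in>\<Lambda>. A l k * W k) = F l) \<longrightarrow>
       (\<forall>l. ((\<lambda>k. R l k * U k) has_sum (F l - (\<Sum>k\<in>\<Lambda>. A l k * W k))) UNIV))"

text \<open>
  Expanding the square gives \<open>|v - t A v|\<^sup>2 \<le> (1 - 2 t \<alpha> + t\<^sup>2 \<beta>\<^sup>2) |v|\<^sup>2\<close>, and \<open>t = \<alpha> / \<beta>\<^sup>2\<close> minimises the
  factor.
\<close>

lemma contracts_one_minus:
  assumes fin: "finite \<Lambda>" and \<alpha>: "0 < \<alpha>" "\<alpha> \<le> \<beta>"
    and bound: "contracts \<beta> \<Lambda> A"
    and coercive: "\<And>v. \<alpha> * (\<Sum>l\<in>\<Lambda>. (cmod (v l))\<^sup>2) \<le> Re (\<Sum>l\<in>\<Lambda>. cnj (v l) * (\<Sum>k\<in>\<Lambda>. A l k * v k))"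
  shows "contracts (sqrt (1 - \<alpha>\<^sup>2 / \<beta>\<^sup>2)) \<Lambda> (\<lambda>l k. (if l = k then 1 else 0) - of_real (\<alpha> / \<beta>\<^sup>2) * A l k)"
  unfolding contracts_def
proof
  fix v
  define t where "t = \<alpha> / \<beta>\<^sup>2"
  define Av where "Av l = (\<Sum>k\<in>\<Lambda>. A l k * v k)" for l
  define n2 where "n2 = (\<Sum>l\<in>\<Lambda>. (cmod (v l))\<^sup>2)"
  have \<beta>: "0 < \<beta>" using \<alpha> by simp
  have n2: "0 \<le> n2" by (simp add: n2_def sum_nonneg)
  have eq: "(\<Sum>m\<in>\<Lambda>. ((if l = m then 1 else 0) - of_real t * A l m) * v m) = v l - of_real t * Av l"
    if "l \<in> \<Lambda>" for l
    using fin that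
    by (simp add: left_diff_distrib sum_subtractf Av_def sum_distrib_left mult.assoc
        if_distrib[of "\<lambda>c. c * _"] cong: if_cong)
  have pw: "(cmod (v l - of_real t * Av l))\<^sup>2 =
      (cmod (v l))\<^sup>2 - 2 * t * Re (cnj (v l) * Av l) + t\<^sup>2 * (cmod (Av l))\<^sup>2" for l
    by (simp add: cmod_power2) (simp add: power2_eq_square algebra_simps)
  have "l2 Av \<Lambda> \<le> \<beta> * l2 v \<Lambda>"
    unfolding Av_def by (rule contractsD[OF bound])
  then have "(l2 Av \<Lambda>)\<^sup>2 \<le> (\<beta> * l2 v \<Lambda>)\<^sup>2"
    by (rule power_mono) simp
  then have A2: "(\<Sum>l\<in>\<Lambda>. (cmod (Av l))\<^sup>2) \<le> \<beta>\<^sup>2 * n2"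
    by (simp add: L2_set_def power_mult_distrib sum_nonneg n2_def)
  have co: "\<alpha> * n2 \<le> (\<Sum>l\<in>\<Lambda>. Re (cnj (v l) * Av l))"
    using coercive[of v] by (simp add: n2_def Av_def)
  have "(\<Sum>l\<in>\<Lambda>. (cmod (v l - of_real t * Av l))\<^sup>2) =
      n2 - 2 * t * (\<Sum>l\<in>\<Lambda>. Re (cnj (v l) * Av l)) + t\<^sup>2 * (\<Sum>l\<in>\<Lambda>. (cmod (Av l))\<^sup>2)"
    unfolding pw sum.distrib sum_subtractf n2_def sum_distrib_left by simp
  also have "\<dots> \<le> n2 - 2 * t * (\<alpha> * n2) + t\<^sup>2 * (\<beta>\<^sup>2 * n2)"
    using \<alpha> \<beta> by (intro add_mono diff_mono mult_left_mono co A2 order_refl) (auto simp: t_def)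
  also have "\<dots> = (1 - \<alpha>\<^sup>2 / \<beta>\<^sup>2) * n2"
    using \<beta> by (simp add: t_def field_simps power2_eq_square)
  finally have *: "(\<Sum>l\<in>\<Lambda>. (cmod (v l - of_real t * Av l))\<^sup>2) \<le> (1 - \<alpha>\<^sup>2 / \<beta>\<^sup>2) * n2" .
  have "l2 (\<lambda>l. \<Sum>m\<in>\<Lambda>. ((if l = m then 1 else 0) - of_real t * A l m) * v m) \<Lambda> =
      l2 (\<lambda>l. v l - of_real t * Av l) \<Lambda>"
    by (rule L2_set_cong) (auto simp: eq)
  also have "\<dots> \<le> sqrt ((1 - \<alpha>\<^sup>2 / \<beta>\<^sup>2) * n2)"
    unfolding L2_set_def by (rule real_sqrt_le_mono) (rule *)
  also have "\<dots> = sqrt (1 - \<alpha>\<^sup>2 / \<beta>\<^sup>2) * l2 v \<Lambda>"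
    by (simp add: real_sqrt_mult L2_set_def n2_def)
  finally show "l2 (\<lambda>l. \<Sum>m\<in>\<Lambda>. ((if l = m then 1 else 0) - of_real (\<alpha> / \<beta>\<^sup>2) * A l m) * v m) \<Lambda>
      \<le> sqrt (1 - \<alpha>\<^sup>2 / \<beta>\<^sup>2) * l2 v \<Lambda>"
    by (simp add: t_def)
qed

text \<open>
  The matrix is \<open>R = A - A X A\<close> with \<open>X\<close> the inverse of the section of \<open>A\<close> to \<open>\<Lambda>\<close>, extended by
  zero. Its decay constant \<open>K\<close> comes from the algebra property and does not depend on \<open>\<Lambda>\<close>.
\<close>

lemma galerkin_residual_matrix:
  assumes c: "0 \<le> c" and A: "\<And>l k. cmod (A l k) \<le> c * w (l - k)"
    and \<alpha>: "0 < \<alpha>"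
    and coercive: "\<forall>\<Lambda> v. finite \<Lambda> \<longrightarrow>
      \<alpha> * (\<Sum>l\<in>\<Lambda>. (cmod (v l))\<^sup>2) \<le> Re (\<Sum>l\<in>\<Lambda>. cnj (v l) * (\<Sum>k\<in>\<Lambda>. A l k * v k))"
  shows "\<exists>K\<ge>0. \<forall>\<Lambda>. finite \<Lambda> \<longrightarrow> (\<exists>R. (\<forall>l k. cmod (R l k) \<le> K * w (l - k)) \<and>
    residual_matrix A \<Lambda> R)"
proof -
  \<comment> \<open>The bound \<open>c * mass\<close> comes from Young's inequality; \<open>2 * \<alpha>\<close> makes \<open>\<alpha> < \<beta>\<close>, so that \<open>\<rho>\<close> is positive.\<close>
  define \<beta> where "\<beta> = max (c * mass) (2 * \<alpha>)"
  define t where "t = \<alpha> / \<beta>\<^sup>2"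
  define \<rho> where "\<rho> = sqrt (1 - \<alpha>\<^sup>2 / \<beta>\<^sup>2)"
  define B where "B l k = (if l = k then 1 else 0) - of_real t * A l k" for l k
  have \<beta>: "2 * \<alpha> \<le> \<beta>" "c * mass \<le> \<beta>" "0 < \<beta>" using \<alpha> by (auto simp: \<beta>_def)
  have t: "0 < t" using \<alpha> \<beta> by (simp add: t_def)
  have "\<alpha>\<^sup>2 < \<beta>\<^sup>2" using \<alpha> \<beta> by (intro power_strict_mono) auto
  then have \<rho>: "0 < \<rho>" "\<rho> < 1" using \<alpha> \<beta> by (auto simp: \<rho>_def)
  have conA: "contracts \<beta> \<Lambda> A" if "finite \<Lambda>" for \<Lambda>
    unfolding contracts_def
  proof
    fix v
    have "l2 (\<lambda>l. \<Sum>m\<in>\<Lambda>. A l m * v m) \<Lambda> \<le> c * mass * l2 v \<Lambda>"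
    proof (rule young_finite[of _ _ "\<lambda>m. c * w m"])
      show "sum (\<lambda>m. c * w m) F \<le> c * mass" if "finite F" for F
        unfolding sum_distrib_left[symmetric] by (intro mult_left_mono sum_w_le that c)
    qed (use that A c w_nonneg in auto)
    also have "\<dots> \<le> \<beta> * l2 v \<Lambda>"
      by (intro mult_right_mono \<beta>) simp
    finally show "l2 (\<lambda>l. \<Sum>m\<in>\<Lambda>. A l m * v m) \<Lambda> \<le> \<beta> * l2 v \<Lambda>" .
  qed
  have conB: "contracts \<rho> \<Lambda> B" if "finite \<Lambda>" for \<Lambda>
    unfolding \<rho>_def B_def t_def
    using contracts_one_minus[OF that \<alpha> _ conA[OF that] coercive[rule_format, OF that]] \<alpha> \<beta> by simp
  have decB: "decays (1 + t * c) \<Lambda> B" for \<Lambda>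
    unfolding decays_def
  proof (intro ballI)
    fix l k
    have "cmod (B l k) \<le> cmod (if l = k then 1 else 0) + cmod (of_real t * A l k)"
      unfolding B_def by (rule norm_triangle_ineq4)
    also have "\<dots> \<le> w (l - k) + t * (c * w (l - k))"
      using t A[of l k] w_nonneg[of "l - k"] by (intro add_mono) (auto simp: w_zero norm_mult)
    finally show "cmod (B l k) \<le> (1 + t * c) * w (l - k)" by (simp add: algebra_simps)
  qed
  have "0 \<le> 1 + t * c" using t c by simp
  from neumann_series_decay[OF this \<rho>] obtain K where K: "0 \<le> K" and
    inv': "\<And>\<Lambda> X. finite \<Lambda> \<Longrightarrow> decays (1 + t * c) \<Lambda> X \<Longrightarrow> contracts \<rho> \<Lambda> X \<Longrightarrow>
      \<exists>Y. decays K \<Lambda> Y \<and> (\<forall>l\<in>\<Lambda>. \<forall>k\<in>\<Lambda>. (\<lambda>n. mpow \<Lambda> X n l k) sums Y l k)"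
    by metis
  have inv: "\<exists>Y. decays K \<Lambda> Y \<and> (\<forall>l\<in>\<Lambda>. \<forall>k\<in>\<Lambda>. (\<lambda>n. mpow \<Lambda> B n l k) sums Y l k)"
    if "finite \<Lambda>" for \<Lambda>
    using that by (intro inv' decB conB)
  have ac: "0 \<le> alg_const" using alg_const_ge_1 by linarith
  define K' where "K' = c + alg_const * c * (alg_const * (t * K) * c)"
  have "0 \<le> K'" using c K t ac by (simp add: K'_def)
  moreover have "\<exists>R. (\<forall>l k. cmod (R l k) \<le> K' * w (l - k)) \<and>
    residual_matrix A \<Lambda> R"
    if fin: "finite \<Lambda>" for \<Lambda>
  proof -
    obtain Y where decY: "decays K \<Lambda> Y"
      and Y: "\<And>l k. l \<in> \<Lambda> \<Longrightarrow> k \<in> \<Lambda> \<Longrightarrow> (\<lambda>n. mpow \<Lambda> B n l k) sums Y l k"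
      using inv[OF fin] by blast
    define Z where "Z m k = (\<Sum>n\<in>\<Lambda>. of_real t * Y m n * A n k)" for m k
    define R where "R l k = A l k - (\<Sum>m\<in>\<Lambda>. A l m * Z m k)" for l k
    have Z: "cmod (Z m k) \<le> alg_const * (t * K) * c * w (m - k)" if "m \<in> \<Lambda>" for m k
      unfolding Z_def
    proof (rule product_decay_alg[OF fin])
      show "cmod (of_real t * Y m n) \<le> t * K * w (m - n)" if "n \<in> \<Lambda>" for n
        using decY \<open>m \<in> \<Lambda>\<close> that t by (simp add: decays_def norm_mult)
    qed (use A t K c in auto)
    have "cmod (\<Sum>m\<in>\<Lambda>. A l m * Z m k) \<le> alg_const * c * (alg_const * (t * K) * c) * w (l - k)" for l k
      by (rule product_decay_alg[OF fin]) (use A Z c K t ac in auto)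
    then have "cmod (R l k) \<le> K' * w (l - k)" for l k
      unfolding R_def K'_def distrib_right
      by (intro order_trans[OF norm_triangle_ineq4] add_mono A)
    moreover have "((\<lambda>k. R l k * U k) has_sum (F l - (\<Sum>k\<in>\<Lambda>. A l k * W k))) UNIV"
      if F: "\<And>l. ((\<lambda>k. A l k * U k) has_sum F l) UNIV"
        and W: "\<And>l. l \<in> \<Lambda> \<Longrightarrow> (\<Sum>k\<in>\<Lambda>. A l k * W k) = F l" for U F W l
    proof -
      have res: "W m - (\<Sum>k\<in>\<Lambda>. B m k * W k) = of_real t * F m" if "m \<in> \<Lambda>" for m
      proof -
        have "(\<Sum>k\<in>\<Lambda>. B m k * W k) = W m - of_real t * (\<Sum>k\<in>\<Lambda>. A m k * W k)"
          using fin that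
          by (simp add: B_def left_diff_distrib sum_subtractf sum_distrib_left mult.assoc
              if_distrib[of "\<lambda>c. c * _"] cong: if_cong)
        then show ?thesis using W[OF that] by simp
      qed
      have Wm: "W m = (\<Sum>n\<in>\<Lambda>. Y m n * (of_real t * F n))" if "m \<in> \<Lambda>" for m
        using Y res that by (intro neumann_series_solves[OF fin conB[OF fin] less_imp_le[OF \<rho>(1)] \<rho>(2)]) auto
      have "((\<lambda>k. Z m k * U k) has_sum W m) UNIV" if "m \<in> \<Lambda>" for m
      proof -
        have "((\<lambda>k. \<Sum>n\<in>\<Lambda>. of_real t * Y m n * (A n k * U k)) has_sum (\<Sum>n\<in>\<Lambda>. of_real t * Y m n * F n)) UNIV"
          (is "(_ has_sum ?s) _")
          by (intro has_sum_finite_sum has_sum_cmult_right F)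
        moreover have "?s = W m" unfolding Wm[OF that] by (intro sum.cong) auto
        ultimately show ?thesis
          unfolding Z_def sum_distrib_right by (simp only: mult.assoc)
      qed
      then have "((\<lambda>k. A l k * U k - (\<Sum>m\<in>\<Lambda>. A l m * (Z m k * U k))) has_sum
          (F l - (\<Sum>m\<in>\<Lambda>. A l m * W m))) UNIV"
        by (intro has_sum_subtract F has_sum_finite_sum has_sum_cmult_right)
      then show ?thesis
        by (simp add: R_def left_diff_distrib sum_distrib_right mult.assoc)
    qed
    ultimately show ?thesis unfolding residual_matrix_def by blast
  qed
  ultimately show ?thesis by blast
qed


section \<open>Decaying matrices and best N-term approximation\<close>

lemma young_ell2:
  assumes g: "\<And>m. 0 \<le> g m" and \<gamma>: "\<And>F. finite F \<Longrightarrow> sum g F \<le> \<gamma>"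
    and R: "\<And>l k. l \<in> L \<Longrightarrow> cmod (R l k) \<le> g (l - k :: 'i)"
    and L: "finite L" and U: "U \<in> ell2"
    and r: "\<And>l. l \<in> L \<Longrightarrow> ((\<lambda>k. R l k * U k) has_sum r l) UNIV"
  shows "l2 r L \<le> \<gamma> * ell2_norm U"
proof (rule tendsto_upperbound)
  show "((\<lambda>F. l2 (\<lambda>l. \<Sum>k\<in>F. R l k * U k) L) \<longlongrightarrow> l2 r L)
      (finite_subsets_at_top UNIV)"
    unfolding L2_set_def using r by (intro tendsto_intros) (auto simp: has_sum_def)
  have \<gamma>0: "0 \<le> \<gamma>" using \<gamma>[of "{}"] by simp
  show "\<forall>\<^sub>F F in finite_subsets_at_top UNIV. l2 (\<lambda>l. \<Sum>k\<in>F. R l k * U k) L \<le> \<gamma> * ell2_norm U"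
  proof (rule eventually_finite_subsets_at_top_weakI)
    fix F :: "'i set" assume F: "finite F"
    have "l2 (\<lambda>l. \<Sum>k\<in>F. R l k * U k) L \<le> \<gamma> * l2 U F"
      by (rule young_finite[OF F L g \<gamma>]) (use R in auto)
    also have "\<dots> \<le> \<gamma> * ell2_norm U"
      by (intro mult_left_mono L2_set_le_ell2_norm U F \<gamma>0)
    finally show "l2 (\<lambda>l. \<Sum>k\<in>F. R l k * U k) L \<le> \<gamma> * ell2_norm U" .
  qed
qed simp

lemma sum_powr_le:
  fixes \<delta> :: real
  assumes "0 < \<delta>"
  shows "(\<Sum>j\<le>J. 2 powr (- \<delta> * real (J - j))) \<le> 1 / (1 - 2 powr (- \<delta>))"
proof -
  have x: "0 < 2 powr (- \<delta>)" "2 powr (- \<delta>) < 1" using assms by (auto simp: powr_less_one)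
  have "(\<Sum>j\<le>J. 2 powr (- \<delta> * real (J - j))) = (\<Sum>j\<le>J. (2 powr (- \<delta>)) ^ (J - j))"
    by (intro sum.cong refl) (simp add: powr_realpow[symmetric] powr_powr)
  also have "\<dots> = (\<Sum>i\<le>J. (2 powr (- \<delta>)) ^ i)"
    by (rule sum.reindex_bij_witness[of _ "\<lambda>i. J - i" "\<lambda>i. J - i"]) auto
  also have "\<dots> \<le> (\<Sum>i. (2 powr (- \<delta>)) ^ i)"
    using x by (intro sum_le_suminf summable_geometric) auto
  also have "\<dots> = 1 / (1 - 2 powr (- \<delta>))"
    using x by (intro suminf_geometric) auto
  finally show ?thesis .
qed

definition decaying_image :: "real \<Rightarrow> ('i \<Rightarrow> 'i \<Rightarrow> complex) \<Rightarrow> ('i \<Rightarrow> complex) \<Rightarrow> ('i \<Rightarrow> complex) \<Rightarrow> bool" where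
  "decaying_image c R U r \<longleftrightarrow> 0 \<le> c \<and> (\<forall>l k. cmod (R l k) \<le> c * w (l - k)) \<and>
     U \<in> ell2 \<and> (\<forall>l. ((\<lambda>k. R l k * U k) has_sum r l) UNIV)"

text \<open>
  Membership of \<open>U\<close> in the approximation class with constant \<open>K\<close>, sampled at powers of 2. The sets
  \<open>S\<close> realise the errors themselves instead of an infimum.
\<close>

definition dyadic_rate :: "real \<Rightarrow> real \<Rightarrow> ('i \<Rightarrow> complex) \<Rightarrow> bool" where
  "dyadic_rate t K U \<longleftrightarrow> ell2_norm U \<le> K \<and> (\<forall>j::nat. \<exists>S. finite S \<and> card S = 2 ^ j \<and>
     ell2_norm (drop_on S U) \<le> K * 2 powr (- t * real j))"

definition sparse_tail :: "real \<Rightarrow> real \<Rightarrow> ('i \<Rightarrow> complex) \<Rightarrow> bool" where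
  "sparse_tail n b r \<longleftrightarrow> (\<exists>\<Sigma>. finite \<Sigma> \<and> real (card \<Sigma>) \<le> n \<and> ell2_norm (drop_on \<Sigma> r) \<le> b)"

text \<open>
  Let \<open>\<Delta>\<^sub>j\<close> be the difference of the near-best approximations of \<open>U\<close> with \<open>2\<^sup>j\<close> and with
  \<open>2\<^sup>j\<^sup>-\<^sup>1\<close> terms, and let \<open>B\<^sub>j\<close> be the exceptional set of \<open>tail\<close> for \<open>y\<^sub>j = 2\<^bsup>\<theta>(J - j)\<^esup>\<close>. The set \<open>\<Sigma>\<close>
  collects, for \<open>j \<le> J\<close>, the translates of \<open>B\<^sub>j\<close> by the support of \<open>\<Delta>\<^sub>j\<close>. Off \<open>\<Sigma>\<close> the piece
  \<open>R \<Delta>\<^sub>j\<close> only sees the tail of the weight and is \<open>O(y\<^sub>j\<^sup>-\<^sup>p 2\<^sup>-\<^sup>t\<^sup>j)\<close>. The cardinality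
  of \<open>\<Sigma>\<close> is \<open>O(2\<^sup>J)\<close> because \<open>\<theta> < 1\<close>, and the sum of the errors is \<open>O(2\<^sup>-\<^sup>t\<^sup>J)\<close> because
  \<open>p \<theta> > t\<close>. Both are possible exactly when \<open>t < p\<close>.
\<close>

lemma dyadic_approximation_of_image:
  assumes t: "0 < t" "t < p"
  shows "\<exists>M\<ge>1. \<exists>E\<ge>0. \<forall>R c U r K J. decaying_image c R U r \<longrightarrow> dyadic_rate t K U \<longrightarrow>
    sparse_tail (M * 2 ^ J) (E * c * K * 2 powr (- t * real J)) r"
proof -
  \<comment> \<open>Halfway between \<open>t / p\<close> and 1, so that both \<open>\<theta> < 1\<close> and \<open>p \<theta> > t\<close>.\<close>
  define \<theta> where "\<theta> = (t / p + 1) / 2"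
  define \<delta>1 where "\<delta>1 = 1 - \<theta>"
  define \<delta>2 where "\<delta>2 = p * \<theta> - t"
  have \<theta>: "0 < \<theta>" "\<theta> < 1" using t p_pos by (auto simp: \<theta>_def field_simps)
  have \<delta>: "0 < \<delta>1" "0 < \<delta>2" using t p_pos by (auto simp: \<theta>_def \<delta>1_def \<delta>2_def field_simps)
  define M where "M = 2 / (1 - 2 powr (- \<delta>1))"
  define E where "E = mass + T * (2 powr t + 1) / (1 - 2 powr (- \<delta>2))"
  have lt1: "2 powr (- \<delta>1) < 1" "2 powr (- \<delta>2) < 1" using \<delta> by (auto simp: powr_less_one)
  have M: "1 \<le> M" using lt1 by (simp add: M_def field_simps)
  have E: "0 \<le> E" using lt1 mass_ge_1 T_nonneg by (simp add: E_def)
  have main: "sparse_tail (M * 2 ^ J) (E * c * K * 2 powr (- t * real J)) r"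
    if im: "decaying_image c R U r" and rate: "dyadic_rate t K U" for R c U r K and J :: nat
  proof -
    have R: "cmod (R l k) \<le> c * w (l - k)" and r: "((\<lambda>k. R l k * U k) has_sum r l) UNIV"
      and c: "0 \<le> c" and U: "U \<in> ell2" for l k
      using im by (auto simp: decaying_image_def)
    have UK: "ell2_norm U \<le> K" using rate by (simp add: dyadic_rate_def)
    have K: "0 \<le> K" using UK ell2_norm_nonneg[of U] by linarith
    obtain S where S: "\<And>j::nat. finite (S j)" "\<And>j. card (S j) = 2 ^ j"
      and SU: "\<And>j. ell2_norm (\<lambda>k. if k \<in> S j then 0 else U k) \<le> K * 2 powr (- t * real j)"
      using rate unfolding dyadic_rate_def by metis
    define y where "y j = 2 powr (\<theta> * real (J - j))" for j
    have y: "1 \<le> y j" for j using \<theta> by (simp add: y_def ge_one_powr_ge_zero)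
    have "\<forall>j. \<exists>B. finite B \<and> real (card B) \<le> y j \<and>
                 (\<forall>F. finite F \<longrightarrow> F \<inter> B = {} \<longrightarrow> sum w F \<le> T * y j powr (- p))"
      using tail y by blast
    then obtain B where B: "\<And>j. finite (B j)" "\<And>j. real (card (B j)) \<le> y j"
      and Bt: "\<And>j F. finite F \<Longrightarrow> F \<inter> B j = {} \<Longrightarrow> sum w F \<le> T * y j powr (- p)"
      by metis
    \<comment> \<open>Contains the support of \<open>\<Delta> j\<close>; for \<open>j = 0\<close> both sets are \<open>S 0\<close>.\<close>
    define P where "P j = S j \<union> S (j - 1)" for j
    define \<Delta> where "\<Delta> j k = (if k \<in> S j then U k else 0) - (if 0 < j \<and> k \<in> S (j - 1) then U k else 0)" for j k
    define \<Sigma> where "\<Sigma> = (\<Union>j\<le>J. (\<lambda>(b, k). b + k) ` (B j \<times> P j))"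
    have finP: "finite (P j)" for j using S by (simp add: P_def)
    have cardP: "real (card (P j)) \<le> 2 * 2 ^ j" for j
    proof -
      have "card (P j) \<le> 2 ^ j + 2 ^ (j - 1)"
        unfolding P_def using card_Un_le[of "S j" "S (j - 1)"] S by simp
      also have "\<dots> \<le> 2 * 2 ^ j" by (simp add: power_increasing)
      finally have "real (card (P j)) \<le> real (2 * 2 ^ j)" by (rule of_nat_mono)
      then show ?thesis by simp
    qed
    have fin\<Sigma>: "finite \<Sigma>" using finP B by (auto simp: \<Sigma>_def)
    have card\<Sigma>: "real (card \<Sigma>) \<le> M * 2 ^ J"
    proof -
      have "card \<Sigma> \<le> (\<Sum>j\<le>J. card ((\<lambda>(b, k). b + k) ` (B j \<times> P j)))"
        unfolding \<Sigma>_def by (rule card_UN_le) simp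
      also have "\<dots> \<le> (\<Sum>j\<le>J. card (B j) * card (P j))"
        using B finP by (intro sum_mono) (metis card_cartesian_product card_image_le finite_cartesian_product)
      finally have "real (card \<Sigma>) \<le> real (\<Sum>j\<le>J. card (B j) * card (P j))" by (rule of_nat_mono)
      also have "\<dots> = (\<Sum>j\<le>J. real (card (B j)) * real (card (P j)))" by simp
      also have "\<dots> \<le> (\<Sum>j\<le>J. y j * (2 * 2 ^ j))"
        by (intro sum_mono mult_mono B cardP) (auto simp: y_def)
      also have "\<dots> = (\<Sum>j\<le>J. 2 * 2 ^ J * 2 powr (- \<delta>1 * real (J - j)))"
      proof (rule sum.cong)
        fix j assume "j \<in> {..J}"
        then have "real (J - j) = real J - real j" by auto
        then have "\<theta> * real (J - j) + real j = real J + - \<delta>1 * real (J - j)"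
          by (simp add: \<delta>1_def algebra_simps)
        then have "2 powr (\<theta> * real (J - j)) * 2 powr real j = 2 powr real J * 2 powr (- \<delta>1 * real (J - j))"
          by (simp only: powr_add[symmetric])
        then show "y j * (2 * 2 ^ j) = 2 * 2 ^ J * 2 powr (- \<delta>1 * real (J - j))"
          by (simp add: y_def powr_realpow)
      qed simp
      also have "\<dots> \<le> 2 * 2 ^ J * (1 / (1 - 2 powr (- \<delta>1)))"
        unfolding sum_distrib_left[symmetric] by (intro mult_left_mono sum_powr_le \<delta>) simp
      finally show ?thesis by (simp add: M_def mult_ac)
    qed
    have \<Delta>2: "l2 (\<Delta> j) (P j) \<le> K * (2 powr t + 1) * 2 powr (- t * real j)" for j
    proof (cases j)
      case 0
      have "l2 (\<Delta> j) (P j) \<le> l2 U (P j)"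
        by (rule L2_set_mono) (auto simp: \<Delta>_def 0)
      also have "\<dots> \<le> K"
        using L2_set_le_ell2_norm[OF U finP, of j] UK by linarith
      also have "\<dots> \<le> K * (2 powr t + 1)" using K by (simp add: distrib_left)
      finally show ?thesis by (simp add: 0)
    next
      case (Suc i)
      have "l2 (\<Delta> j) (P j) =
          l2 (\<lambda>k. (if k \<in> S i then 0 else U k) + - (if k \<in> S j then 0 else U k)) (P j)"
        by (rule L2_set_cong) (auto simp: \<Delta>_def Suc)
      also have "\<dots> \<le> l2 (\<lambda>k. if k \<in> S i then 0 else U k) (P j)
          + l2 (\<lambda>k. - (if k \<in> S j then 0 else U k)) (P j)"
        by (rule L2_set_triangle_norm)
      also have "\<dots> \<le> K * 2 powr (- t * real i) + K * 2 powr (- t * real j)"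
        unfolding norm_minus_cancel
        by (intro add_mono order_trans[OF L2_set_le_ell2_norm[OF _ finP] SU]
            ell2_norm_restrict(1)[OF U]) auto
      also have "2 powr (- t * real i) = 2 powr t * 2 powr (- t * real j)"
        by (simp add: Suc powr_add[symmetric] algebra_simps)
      finally show ?thesis by (simp add: algebra_simps)
    qed
    have "l2 (\<lambda>l. if l \<in> \<Sigma> then 0 else r l) L \<le> E * c * K * 2 powr (- t * real J)"
      if L: "finite L" for L
    proof -
      define L' where "L' = L - \<Sigma>"
      have L': "finite L'" using L by (simp add: L'_def)
      define rest where "rest l = r l - (\<Sum>j\<le>J. \<Sum>k\<in>P j. R l k * \<Delta> j k)" for l
      define UJ where "UJ k = (if k \<in> S J then 0 else U k)" for k
      have telescope: "(\<Sum>j\<le>i. \<Delta> j k) = (if k \<in> S i then U k else 0)" for i k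
        by (induction i) (auto simp: \<Delta>_def)
      have "((\<lambda>k. R l k * UJ k) has_sum rest l) UNIV" for l
      proof -
        have "((\<lambda>k. R l k * \<Delta> j k) has_sum (\<Sum>k\<in>P j. R l k * \<Delta> j k)) UNIV" for j
          by (rule has_sum_finite_neutralI[OF finP]) (auto simp: P_def \<Delta>_def)
        then have "((\<lambda>k. R l k * U k - (\<Sum>j\<le>J. R l k * \<Delta> j k)) has_sum rest l) UNIV"
          unfolding rest_def by (intro has_sum_subtract r has_sum_finite_sum)
        moreover have "R l k * U k - (\<Sum>j\<le>J. R l k * \<Delta> j k) = R l k * UJ k" for k
          unfolding sum_distrib_left[symmetric] telescope by (simp add: UJ_def)
        ultimately show ?thesis by simp
      qed
      then have "l2 rest L' \<le> (c * mass) * ell2_norm UJ"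
        using R c w_nonneg L' ell2_norm_restrict(1)[OF U, of UJ] sum_w_le
        by (intro young_ell2[of "\<lambda>m. c * w m"])
           (auto simp: UJ_def sum_distrib_left[symmetric] intro!: mult_left_mono)
      also have "\<dots> \<le> (c * mass) * (K * 2 powr (- t * real J))"
        unfolding UJ_def using c mass_ge_1 by (intro mult_left_mono SU) auto
      finally have 1: "l2 rest L' \<le> mass * c * K * 2 powr (- t * real J)"
        by (simp add: mult_ac)
      have 2: "l2 (\<lambda>l. \<Sum>k\<in>P j. R l k * \<Delta> j k) L' \<le>
          c * T * K * (2 powr t + 1) * 2 powr (- t * real J) * 2 powr (- \<delta>2 * real (J - j))"
        if j: "j \<in> {..J}" for j
      proof -
        let ?g = "\<lambda>m. if m \<in> B j then 0 else c * w m"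
        have g0: "0 \<le> ?g m" for m using c w_nonneg by simp
        have gs: "sum ?g F \<le> c * (T * y j powr (- p))" if F: "finite F" for F
        proof -
          have "sum ?g F = (\<Sum>m\<in>F - B j. c * w m)"
            by (rule sum.mono_neutral_cong_right) (use F in auto)
          also have "\<dots> \<le> c * (T * y j powr (- p))"
            unfolding sum_distrib_left[symmetric] using F by (intro mult_left_mono c Bt) auto
          finally show ?thesis .
        qed
        have gR: "cmod (R l k) \<le> ?g (l - k)" if "l \<in> L'" "k \<in> P j" for l k
        proof -
          have "l - k \<notin> B j"
          proof
            assume "l - k \<in> B j"
            then have "l \<in> (\<lambda>(b, k). b + k) ` (B j \<times> P j)"
              using that(2) by (intro image_eqI[of _ _ "(l - k, k)"]) auto
            then show False using that(1) j by (auto simp: L'_def \<Sigma>_def)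
          qed
          then show ?thesis using R by simp
        qed
        have cT: "0 \<le> c * (T * y j powr (- p))" using c T_nonneg by simp
        have "l2 (\<lambda>l. \<Sum>k\<in>P j. R l k * \<Delta> j k) L' \<le>
            c * (T * y j powr (- p)) * l2 (\<Delta> j) (P j)"
          by (rule young_finite[OF finP L' g0 gs gR])
        also have "\<dots> \<le> c * (T * y j powr (- p)) * (K * (2 powr t + 1) * 2 powr (- t * real j))"
          by (rule mult_left_mono[OF \<Delta>2 cT])
        also have "y j powr (- p) * 2 powr (- t * real j) = 2 powr (- t * real J) * 2 powr (- \<delta>2 * real (J - j))"
        proof -
          have "real (J - j) = real J - real j" using j by auto
          then have "- (\<theta> * real (J - j) * p) + - t * real j = - t * real J + - \<delta>2 * real (J - j)"
            by (simp add: \<delta>2_def algebra_simps)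
          then have "2 powr (- (\<theta> * real (J - j) * p)) * 2 powr (- t * real j) =
              2 powr (- t * real J) * 2 powr (- \<delta>2 * real (J - j))"
            by (simp only: powr_add[symmetric])
          then show ?thesis by (simp add: y_def powr_powr)
        qed
        then have "c * (T * y j powr (- p)) * (K * (2 powr t + 1) * 2 powr (- t * real j)) =
            c * T * K * (2 powr t + 1) * (2 powr (- t * real J) * 2 powr (- \<delta>2 * real (J - j)))"
          by (metis (no_types, opaque_lifting) mult.assoc mult.left_commute)
        finally show ?thesis by (simp add: mult.assoc)
      qed
      have "l2 (\<lambda>l. if l \<in> \<Sigma> then 0 else r l) L = l2 r L'"
        unfolding L2_set_def L'_def
        by (rule arg_cong[where f = sqrt], rule sum.mono_neutral_cong_right) (use L in auto)
      also have "\<dots> = l2 (\<lambda>l. rest l + (\<Sum>j\<le>J. \<Sum>k\<in>P j. R l k * \<Delta> j k)) L'"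
        by (simp add: rest_def)
      also have "\<dots> \<le> l2 rest L' + l2 (\<lambda>l. \<Sum>j\<le>J. \<Sum>k\<in>P j. R l k * \<Delta> j k) L'"
        by (rule L2_set_triangle_norm)
      also have "l2 (\<lambda>l. \<Sum>j\<le>J. \<Sum>k\<in>P j. R l k * \<Delta> j k) L' \<le>
          (\<Sum>j\<le>J. l2 (\<lambda>l. \<Sum>k\<in>P j. R l k * \<Delta> j k) L')"
        by (rule L2_set_triangle_norm_sum) simp
      also have "\<dots> \<le> (\<Sum>j\<le>J. c * T * K * (2 powr t + 1) * 2 powr (- t * real J) * 2 powr (- \<delta>2 * real (J - j)))"
        by (rule sum_mono) (rule 2)
      also have "\<dots> \<le> c * T * K * (2 powr t + 1) * 2 powr (- t * real J) * (1 / (1 - 2 powr (- \<delta>2)))"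
        unfolding sum_distrib_left[symmetric] using c T_nonneg K
        by (intro mult_left_mono sum_powr_le \<delta>) auto
      finally have "l2 (\<lambda>l. if l \<in> \<Sigma> then 0 else r l) L \<le> mass * c * K * 2 powr (- t * real J)
          + c * T * K * (2 powr t + 1) * 2 powr (- t * real J) * (1 / (1 - 2 powr (- \<delta>2)))"
        using 1 by linarith
      also have "\<dots> = E * c * K * 2 powr (- t * real J)"
      proof -
        define q where "q = 2 powr t + 1"
        show ?thesis unfolding E_def q_def[symmetric] by (simp add: distrib_right)
      qed
      finally show ?thesis .
    qed
    then have "ell2_norm (drop_on \<Sigma> r) \<le> E * c * K * 2 powr (- t * real J)"
      by (rule ell2_normI(2))
    with fin\<Sigma> card\<Sigma> show ?thesis unfolding sparse_tail_def by blast
  qed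
  show ?thesis
    by (rule exI[of _ M], rule conjI[OF M], rule exI[of _ E], rule conjI[OF E], intro allI impI)
       (rule main; assumption)
qed

text \<open>
  For \<open>N \<ge> M\<close> the previous lemma is used with the largest \<open>J\<close> such that \<open>M 2\<^sup>J \<le> N\<close>; for the finitely
  many smaller \<open>N\<close> the norm of \<open>r\<close> is a sufficient bound. Since the infimum in \<open>seq_err\<close> need not be
  attained, everything is proved for all bounds larger than \<open>K\<close> and then passed to the limit.
\<close>

lemma decaying_matrix_preserves_algebraic_class:
  assumes t: "0 < t" "t < p" and inf: "infinite (UNIV :: 'i set)"
  shows "\<exists>C\<ge>0. \<forall>R c U r K. decaying_image c R U r \<longrightarrow> ell2_norm U \<le> K \<longrightarrow>
    (\<forall>N\<ge>1. seq_err N U * real N powr t \<le> K) \<longrightarrow>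
    r \<in> ell2 \<and> ell2_norm r \<le> C * c * K \<and> (\<forall>N\<ge>1. seq_err N r * real N powr t \<le> C * c * K)"
proof -
  obtain M E where M: "1 \<le> M" and E: "0 \<le> E" and main: "\<forall>R c U r K J.
      decaying_image c R U r \<longrightarrow> dyadic_rate t K U \<longrightarrow>
      sparse_tail (M * 2 ^ J) (E * c * K * 2 powr (- t * real J)) r"
    using dyadic_approximation_of_image[OF t] by (elim exE conjE) (rule that; assumption)
  define C where "C = (mass + E) * (2 * M) powr t"
  have pw: "1 \<le> (2 * M) powr t" using M t by (intro ge_one_powr_ge_zero) auto
  have C: "0 \<le> C" using mass_ge_1 E by (simp add: C_def)
  have CG: "mass \<le> C"
  proof -
    have "mass * 1 \<le> (mass + E) * (2 * M) powr t"
      using mass_ge_1 E pw by (intro mult_mono) auto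
    then show ?thesis by (simp add: C_def)
  qed
  have "r \<in> ell2 \<and> ell2_norm r \<le> C * c * K0 \<and> (\<forall>N\<ge>1. seq_err N r * real N powr t \<le> C * c * K0)"
    if im: "decaying_image c R U r" and UK: "ell2_norm U \<le> K0"
      and best: "\<forall>N\<ge>1. seq_err N U * real N powr t \<le> K0"
    for R c U r K0
  proof -
    have R: "cmod (R l k) \<le> c * w (l - k)" and r: "((\<lambda>k. R l k * U k) has_sum r l) UNIV"
      and c: "0 \<le> c" and U: "U \<in> ell2" for l k
      using im by (auto simp: decaying_image_def)
    have K0: "0 \<le> K0" using UK ell2_norm_nonneg[of U] by linarith
    have "l2 r L \<le> (c * mass) * ell2_norm U" if "finite L" for L
      using R r that U c w_nonneg sum_w_le
      by (intro young_ell2[of "\<lambda>m. c * w m"]) (auto simp: sum_distrib_left[symmetric] intro!: mult_left_mono)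
    note rU = ell2_normI[OF this]
    have rK: "ell2_norm r \<le> mass * c * K0"
    proof -
      have "(c * mass) * ell2_norm U \<le> (c * mass) * K0"
        using UK c mass_ge_1 by (intro mult_left_mono) auto
      then show ?thesis using rU(2) by (simp add: mult_ac)
    qed
    also have "\<dots> \<le> C * c * K0" by (intro mult_right_mono CG c K0)
    finally have norm: "ell2_norm r \<le> C * c * K0" .
    have err_le: "seq_err N r \<le> ell2_norm (drop_on \<Sigma> r)"
      if \<Sigma>: "finite \<Sigma>" "card \<Sigma> \<le> N" for \<Sigma> N
    proof -
      have "infinite (UNIV - \<Sigma>)" using inf \<Sigma> by simp
      then obtain X where X: "finite X" "card X = N - card \<Sigma>" "X \<subseteq> UNIV - \<Sigma>"
        using infinite_arbitrarily_large by blast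
      have "card (\<Sigma> \<union> X) = N"
        using X \<Sigma> by (subst card_Un_disjoint) auto
      then have "seq_err N r \<le> ell2_norm (\<lambda>l. if l \<in> \<Sigma> \<union> X then 0 else r l)"
        unfolding seq_err_def using \<Sigma> X
        by (intro cINF_lower) (auto intro!: bdd_belowI[of _ 0] ell2_norm_nonneg)
      also have "\<dots> \<le> ell2_norm (drop_on \<Sigma> r)"
        by (rule ell2_norm_restrict(2)[OF ell2_norm_restrict(1)[OF rU(1)]]) auto
      finally show ?thesis .
    qed
    have "seq_err N r * real N powr t \<le> C * c * K" if N: "1 \<le> N" and K: "K0 < K" for N K
    proof -
      have Kpos: "0 \<le> K" using K K0 by linarith
      show ?thesis
      proof (cases "real N < M")
        case True
        have "seq_err N r \<le> ell2_norm (drop_on {} r)" by (rule err_le) auto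
        also have "\<dots> \<le> mass * c * K"
          using order_trans[OF rK mult_left_mono[of K0 K "mass * c"]] K mass_ge_1 c by simp
        also have "\<dots> \<le> (mass + E) * c * K" using E c Kpos by (intro mult_right_mono) auto
        finally have "seq_err N r * real N powr t \<le> ((mass + E) * c * K) * (2 * M) powr t"
          using True N t E mass_ge_1 c Kpos by (intro mult_mono powr_mono2) auto
        then show ?thesis by (simp add: C_def mult_ac)
      next
        case False
        define J where "J = nat \<lfloor>log 2 (real N / M)\<rfloor>"
        have NM: "1 \<le> real N / M" using False M by simp
        then have l0: "0 \<le> log 2 (real N / M)" by simp
        have J1: "real J \<le> log 2 (real N / M)" and J2: "log 2 (real N / M) < real J + 1"
          using l0 by (auto simp: J_def)
        have "2 powr real J \<le> real N / M" using J1 NM by (simp add: le_log_iff)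
        then have M2: "M * 2 ^ J \<le> real N" using M by (simp add: powr_realpow field_simps)
        have "real N / M < 2 powr (real J + 1)" using J2 NM by (simp add: log_less_iff)
        then have N2: "real N \<le> 2 * M * 2 powr real J" using M by (simp add: powr_add field_simps)
        have "\<exists>S. finite S \<and> card S = 2 ^ j \<and>
            ell2_norm (drop_on S U) \<le> K * 2 powr (- t * real j)" for j :: nat
        proof -
          have "real (2 ^ j) powr t = 2 powr (t * real j)"
            by (simp add: powr_realpow[symmetric] powr_powr mult.commute)
          moreover have "seq_err (2 ^ j) U * real (2 ^ j) powr t \<le> K0"
            using best[rule_format, of "2 ^ j"] by (simp del: of_nat_power)
          ultimately have "seq_err (2 ^ j) U * 2 powr (t * real j) < K" using K by simp
          then have "seq_err (2 ^ j) U < K * 2 powr (- t * real j)"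
            by (simp add: powr_minus field_simps)
          then obtain S where "finite S" "card S = 2 ^ j"
            "ell2_norm (drop_on S U) < K * 2 powr (- t * real j)"
            using seq_err_lessD[OF inf] by blast
          then show ?thesis by (intro exI[of _ S]) auto
        qed
        then have "dyadic_rate t K U" using UK K by (simp add: dyadic_rate_def)
        then have "sparse_tail (M * 2 ^ J) (E * c * K * 2 powr (- t * real J)) r" using main im by blast
        then obtain \<Sigma> where \<Sigma>: "finite \<Sigma>" "real (card \<Sigma>) \<le> M * 2 ^ J"
          and \<Sigma>r: "ell2_norm (drop_on \<Sigma> r) \<le> E * c * K * 2 powr (- t * real J)"
          unfolding sparse_tail_def by blast
        have "card \<Sigma> \<le> N" using \<Sigma>(2) M2 by linarith
        then have "seq_err N r \<le> E * c * K * 2 powr (- t * real J)"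
          using err_le[OF \<Sigma>(1)] \<Sigma>r by force
        then have "seq_err N r * real N powr t \<le> (E * c * K * 2 powr (- t * real J)) * (2 * M * 2 powr real J) powr t"
          using N2 E c Kpos t by (intro mult_mono powr_mono2) auto
        also have "\<dots> = E * c * K * (2 * M) powr t"
          using M by (simp add: powr_mult powr_powr powr_minus field_simps)
        also have "\<dots> \<le> (mass + E) * c * K * (2 * M) powr t"
          using mass_ge_1 c Kpos by (intro mult_right_mono) auto
        finally show ?thesis by (simp add: C_def mult_ac)
      qed
    qed
    then have "seq_err N r * real N powr t \<le> C * c * K0" if "1 \<le> N" for N
      using that by (intro le_mult_right_limit[of K0 _ "C * c"]) auto
    with rU(1) norm show ?thesis by auto
  qed
  then show ?thesis using C by (intro exI[of _ C] conjI allI impI) blast+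
qed

end

section \<open>The polynomial weight on the integer lattice\<close>

lemma knorm_nonneg [simp]: "0 \<le> knorm k"
  by (simp add: knorm_def)

lemma knorm_0 [simp]: "knorm (0 :: int^'d) = 0"
proof -
  have "(\<chi> j. real_of_int ((0 :: int^'d) $ j)) = (0 :: real^'d)" by (simp add: vec_eq_iff)
  then show ?thesis by (simp only: knorm_def norm_zero)
qed

lemma knorm_triangle: "knorm (a + b) \<le> knorm a + knorm b" for a b :: "int^'d"
proof -
  have "(\<chi> j. real_of_int ((a + b) $ j)) = (\<chi> j. real_of_int (a $ j)) + (\<chi> j. real_of_int (b $ j))"
    by (simp add: vec_eq_iff)
  then show ?thesis unfolding knorm_def by (simp only: norm_triangle_ineq)
qed

lemma component_le_knorm: "\<bar>real_of_int (k $ j)\<bar> \<le> knorm k"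
  unfolding knorm_def using component_le_norm_cart[of "\<chi> j. real_of_int (k $ j)" j] by simp

definition cube :: "nat \<Rightarrow> (int^'d) set" where
  "cube r = {m. \<forall>j. \<bar>m $ j\<bar> \<le> int r}"

lemma finite_cube: "finite (cube r :: (int^'d) set)"
  and card_cube: "card (cube r :: (int^'d) set) \<le> (2 * r + 1) ^ CARD('d)"
proof -
  let ?P = "PiE (UNIV :: 'd set) (\<lambda>_. {- int r .. int r})"
  have inj: "inj_on vec_nth (cube r :: (int^'d) set)" by (auto simp: inj_on_def vec_eq_iff)
  have sub: "vec_nth ` (cube r :: (int^'d) set) \<subseteq> ?P" by (auto simp: cube_def abs_le_iff) (smt (verit))+
  have fin: "finite ?P" by (intro finite_PiE) auto
  show "finite (cube r :: (int^'d) set)" using finite_imageD[OF finite_subset[OF sub fin] inj] .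
  have "card (cube r :: (int^'d) set) \<le> card ?P" by (rule card_inj_on_le[OF inj sub fin])
  also have "\<dots> = (2 * r + 1) ^ CARD('d)" by (simp add: card_PiE nat_add_distrib nat_mult_distrib)
  finally show "card (cube r :: (int^'d) set) \<le> (2 * r + 1) ^ CARD('d)" .
qed

lemma knorm_outside_cube:
  assumes "m \<notin> cube r" shows "real r + 1 \<le> knorm m"
proof -
  obtain j where "int r < \<bar>m $ j\<bar>" using assms by (auto simp: cube_def not_le)
  then have "real r + 1 \<le> \<bar>real_of_int (m $ j)\<bar>" by linarith
  then show ?thesis using component_le_knorm[of m j] by linarith
qed

text \<open>
  Points outside the cube of radius \<open>r\<close> lie in dyadic shells, on which the weight is essentially
  constant and whose number of points is comparable to the volume.
\<close>

lemma dyadic_shell: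
  fixes m :: "int^'d"
  assumes "m \<notin> cube r"
  shows "\<exists>i. m \<in> cube (2 ^ Suc i * (r + 1)) \<and> 2 ^ i * (real r + 1) \<le> knorm m"
proof -
  define P where "P i \<longleftrightarrow> m \<in> cube (2 ^ i * (r + 1))" for i
  obtain n where n: "knorm m < 2 ^ n" using real_arch_pow[of 2 "knorm m"] by auto
  have "P n" unfolding P_def cube_def
  proof (intro CollectI allI)
    fix j
    have "\<bar>real_of_int (m $ j)\<bar> < 2 ^ n" using component_le_knorm[of m j] n by linarith
    then have "\<bar>m $ j\<bar> < 2 ^ n" by (metis of_int_abs of_int_less_iff of_int_numeral of_int_power)
    also have "(2::int) ^ n \<le> int (2 ^ n * (r + 1))" by simp
    finally show "\<bar>m $ j\<bar> \<le> int (2 ^ n * (r + 1))" by simp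
  qed
  then have L: "P (LEAST i. P i)" by (rule LeastI)
  show ?thesis
  proof (cases "LEAST i. P i")
    case 0
    then have "m \<in> cube (1 * (r + 1))" using L by (simp add: P_def)
    then have "m \<in> cube (2 * (r + 1))" unfolding cube_def by (auto intro: order_trans)
    then show ?thesis using knorm_outside_cube[OF assms] by (intro exI[of _ 0]) simp
  next
    case (Suc i)
    then have "\<not> P i" using not_less_Least[of i P] by simp
    then have "real (2 ^ i * (r + 1)) + 1 \<le> knorm m" unfolding P_def by (rule knorm_outside_cube)
    then have "2 ^ i * (real r + 1) \<le> knorm m" by (simp add: algebra_simps)
    moreover have "P (Suc i)" using L Suc by simp
    ultimately show ?thesis unfolding P_def by blast
  qed
qed

lemma sum_outside_cube:
  fixes F :: "(int^'d) set"
  assumes \<eta>: "real CARD('d) < \<eta>" and F: "finite F" "F \<inter> cube r = {}"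
  defines "\<delta> \<equiv> \<eta> - real CARD('d)"
  shows "(\<Sum>m\<in>F. (1 + knorm m) powr (- \<eta>)) \<le>
    5 ^ CARD('d) / (1 - 2 powr (- \<delta>)) * (real r + 1) powr (- \<delta>)"
proof -
  let ?w = "\<lambda>m :: int^'d. (1 + knorm m) powr (- \<eta>)"
  let ?d = "CARD('d)"
  have "\<forall>m\<in>F. \<exists>i. m \<in> cube (2 ^ Suc i * (r + 1)) \<and> 2 ^ i * (real r + 1) \<le> knorm m"
    using dyadic_shell F by blast
  then obtain \<iota> where \<iota>: "\<And>m. m \<in> F \<Longrightarrow> m \<in> cube (2 ^ Suc (\<iota> m) * (r + 1))"
      "\<And>m. m \<in> F \<Longrightarrow> 2 ^ \<iota> m * (real r + 1) \<le> knorm m"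
    by metis
  have \<delta>: "0 < \<delta>" using \<eta> by (simp add: \<delta>_def)
  then have q: "0 < 2 powr (- \<delta>)" "2 powr (- \<delta>) < 1" by (auto simp: powr_less_one)
  have shell: "sum ?w {m \<in> F. \<iota> m = i} \<le> 5 ^ ?d * (real r + 1) powr (- \<delta>) * (2 powr (- \<delta>)) ^ i" for i
  proof -
    define n where "n = 2 ^ i * (real r + 1)"
    have n: "1 \<le> n" unfolding n_def
      using mult_mono[of 1 "2 ^ i :: real" 1 "real r + 1"] by simp
    have "sum ?w {m \<in> F. \<iota> m = i} \<le> (\<Sum>m\<in>{m \<in> F. \<iota> m = i}. n powr (- \<eta>))"
    proof (rule sum_mono)
      fix m assume "m \<in> {m \<in> F. \<iota> m = i}"
      then have "n \<le> 1 + knorm m" using \<iota>(2)[of m] by (auto simp: n_def)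
      then show "?w m \<le> n powr (- \<eta>)" using n \<eta> by (intro powr_mono2') auto
    qed
    also have "\<dots> = real (card {m \<in> F. \<iota> m = i}) * n powr (- \<eta>)" by simp
    also have "\<dots> \<le> (5 * n) ^ ?d * n powr (- \<eta>)"
    proof (rule mult_right_mono)
      have "card {m \<in> F. \<iota> m = i} \<le> card (cube (2 ^ Suc i * (r + 1)) :: (int^'d) set)"
        using \<iota>(1) by (intro card_mono finite_cube) auto
      also have "\<dots> \<le> (2 * (2 ^ Suc i * (r + 1)) + 1) ^ ?d" by (rule card_cube)
      finally have "real (card {m \<in> F. \<iota> m = i}) \<le> real ((2 * (2 ^ Suc i * (r + 1)) + 1) ^ ?d)"
        by (rule of_nat_mono)
      also have "\<dots> = (4 * n + 1) ^ ?d" by (simp add: n_def algebra_simps)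
      also have "\<dots> \<le> (5 * n) ^ ?d" using n by (intro power_mono) auto
      finally show "real (card {m \<in> F. \<iota> m = i}) \<le> (5 * n) ^ ?d" .
    qed simp
    also have "(5 * n) ^ ?d * n powr (- \<eta>) = 5 ^ ?d * n powr (- \<delta>)"
      using n by (simp add: power_mult_distrib powr_realpow[symmetric] powr_add[symmetric] \<delta>_def)
    also have "n powr (- \<delta>) = (real r + 1) powr (- \<delta>) * (2 powr (- \<delta>)) ^ i"
      by (simp add: n_def powr_mult powr_realpow[symmetric] powr_powr mult.commute)
    finally show ?thesis by (simp add: mult_ac)
  qed
  have "sum ?w F = (\<Sum>i\<in>\<iota> ` F. sum ?w {m \<in> F. \<iota> m = i})" by (rule sum.image_gen[OF F(1)])
  also have "\<dots> \<le> (\<Sum>i\<in>\<iota> ` F. 5 ^ ?d * (real r + 1) powr (- \<delta>) * (2 powr (- \<delta>)) ^ i)"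
    by (rule sum_mono) (rule shell)
  also have "\<dots> = 5 ^ ?d * (real r + 1) powr (- \<delta>) * (\<Sum>i\<in>\<iota> ` F. (2 powr (- \<delta>)) ^ i)"
    by (simp add: sum_distrib_left)
  also have "(\<Sum>i\<in>\<iota> ` F. (2 powr (- \<delta>)) ^ i) \<le> (\<Sum>i. (2 powr (- \<delta>)) ^ i)"
    using q F by (intro sum_le_suminf summable_geometric) auto
  also have "\<dots> = 1 / (1 - 2 powr (- \<delta>))" using q by (intro suminf_geometric) auto
  finally show ?thesis by (simp add: mult_ac mult_left_mono)
qed

text \<open>
  With \<open>y\<close> points one can fill a cube of radius about \<open>y\<^bsup>1/d\<^esup> / 2\<close>, beyond which the weights sum
  to a multiple of the radius to the power \<open>d - \<eta>\<close>; this is \<open>y\<^sup>-\<^sup>p\<close> with \<open>p = (\<eta> - d) / d\<close>.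
\<close>

lemma lattice_weight_knorm:
  assumes \<eta>: "real CARD('d) < \<eta>"
  shows "\<exists>T. lattice_weight (\<lambda>m :: int^'d. (1 + knorm m) powr (- \<eta>)) (2 powr \<eta>)
    ((\<eta> - real CARD('d)) / real CARD('d)) T"
proof -
  define d where "d = real CARD('d)"
  define \<delta> where "\<delta> = \<eta> - d"
  define T where "T = 5 ^ CARD('d) / (1 - 2 powr (- \<delta>)) * 3 powr \<delta>"
  have d: "0 < d" by (simp add: d_def)
  have \<delta>: "0 < \<delta>" using \<eta> by (simp add: \<delta>_def d_def)
  have \<eta>0: "0 < \<eta>" using \<delta> d by (simp add: \<delta>_def)
  have q: "2 powr (- \<delta>) < 1" using \<delta> by (auto simp: powr_less_one)
  have "lattice_weight (\<lambda>m :: int^'d. (1 + knorm m) powr (- \<eta>)) (2 powr \<eta>) (\<delta> / d) T"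
  proof
    fix a b :: "int^'d"
    have half: "(1 + knorm a) powr (- \<eta>) \<le> 2 powr \<eta> * (1 + knorm c) powr (- \<eta>)"
      if "(1 + knorm c) / 2 \<le> 1 + knorm a" for a c :: "int^'d"
    proof -
      have pos: "0 < 1 + knorm c" using knorm_nonneg[of c] by linarith
      then have "(1 + knorm a) powr (- \<eta>) \<le> ((1 + knorm c) / 2) powr (- \<eta>)"
        using that \<eta>0 by (intro powr_mono2') auto
      also have "\<dots> = 2 powr \<eta> * (1 + knorm c) powr (- \<eta>)"
        using pos by (simp add: powr_divide powr_minus field_simps)
      finally show ?thesis .
    qed
    show "(1 + knorm a) powr (- \<eta>) \<le> 2 powr \<eta> * (1 + knorm (a + b)) powr (- \<eta>) \<or>
        (1 + knorm b) powr (- \<eta>) \<le> 2 powr \<eta> * (1 + knorm (a + b)) powr (- \<eta>)"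
    proof (cases "(1 + knorm (a + b)) / 2 \<le> 1 + knorm a")
      case False
      then have "(1 + knorm (a + b)) / 2 \<le> 1 + knorm b" using knorm_triangle[of a b] by (simp add: field_simps)
      then show ?thesis using half by blast
    qed (use half in blast)
  next
    fix a :: "int^'d"
    have "(1 + knorm a) powr (- \<eta>) \<le> 1 powr (- \<eta>)"
      using \<eta>0 by (intro powr_mono2') auto
    then show "(1 + knorm a) powr (- \<eta>) \<le> 1" by simp
  next
    fix y :: real assume y: "1 \<le> y"
    define z where "z = y powr (1 / d)"
    have z: "1 \<le> z" using y d by (simp add: z_def ge_one_powr_ge_zero)
    define r where "r = nat \<lfloor>(z - 1) / 2\<rfloor>"
    have r1: "2 * real r + 1 \<le> z" and r2: "z \<le> 3 * (real r + 1)"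
    proof -
    have "real r = of_int \<lfloor>(z - 1) / 2\<rfloor>" using z by (simp add: r_def)
    then have "real r \<le> (z - 1) / 2" "(z - 1) / 2 < real r + 1"
      using floor_correct[of "(z - 1) / 2"] by auto
    then show "2 * real r + 1 \<le> z" "z \<le> 3 * (real r + 1)" by (auto simp: field_simps)
  qed
    have zd: "z ^ CARD('d) = y"
      using y d by (simp add: z_def powr_realpow[symmetric] powr_powr d_def)
    have c: "real (card (cube r :: (int^'d) set)) \<le> y"
    proof -
      have "real (card (cube r :: (int^'d) set)) \<le> real ((2 * r + 1) ^ CARD('d))"
        by (rule of_nat_mono) (rule card_cube)
      also have "\<dots> = (2 * real r + 1) ^ CARD('d)" by (simp add: add.commute)
      also have "\<dots> \<le> z ^ CARD('d)" using r1 by (intro power_mono) auto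
      finally show ?thesis by (simp add: zd)
    qed
    have t: "(\<Sum>m\<in>F. (1 + knorm m) powr (- \<eta>)) \<le> T * y powr (- (\<delta> / d))"
      if F: "finite F" "F \<inter> cube r = {}" for F :: "(int^'d) set"
    proof -
      have "(\<Sum>m\<in>F. (1 + knorm m) powr (- \<eta>)) \<le> 5 ^ CARD('d) / (1 - 2 powr (- \<delta>)) * (real r + 1) powr (- \<delta>)"
        unfolding \<delta>_def d_def by (rule sum_outside_cube[OF \<eta> F])
      also have "\<dots> \<le> 5 ^ CARD('d) / (1 - 2 powr (- \<delta>)) * (z / 3) powr (- \<delta>)"
        using r2 z \<delta> q by (intro mult_left_mono powr_mono2') auto
      also have "(z / 3) powr (- \<delta>) = 3 powr \<delta> * y powr (- (\<delta> / d))"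
        using z y by (simp add: powr_divide powr_minus z_def powr_powr field_simps)
      finally show ?thesis by (simp add: T_def mult.assoc)
    qed
    show "\<exists>B. finite B \<and> real (card B) \<le> y \<and> (\<forall>F :: (int^'d) set. finite F \<longrightarrow> F \<inter> B = {} \<longrightarrow>
        (\<Sum>m\<in>F. (1 + knorm m) powr (- \<eta>)) \<le> T * y powr (- (\<delta> / d)))"
    proof (rule exI[of _ "cube r"], intro conjI allI impI)
      show "finite (cube r :: (int^'d) set)" by (rule finite_cube)
      show "real (card (cube r :: (int^'d) set)) \<le> y" by (rule c)
    qed (rule t)
  qed (use \<delta> d in auto)
  then show ?thesis unfolding \<delta>_def d_def by blast
qed

lemma infinite_lattice: "infinite (UNIV :: (int^'d) set)"
proof
  assume "finite (UNIV :: (int^'d) set)"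
  moreover have "inj (\<lambda>n :: int. (\<chi> j. n) :: int^'d)" by (auto simp: inj_def vec_eq_iff)
  ultimately have "finite (UNIV :: int set)" by (metis finite_imageD finite_subset subset_UNIV)
  then show False by (simp add: infinite_UNIV_char_0)
qed

section \<open>Integrals over a period\<close>

abbreviation corner :: "real^'d" where "corner \<equiv> (\<chi> j. 2 * pi)"

abbreviation cell :: "(real^'d) measure" where "cell \<equiv> lebesgue_on Omega"

definition phi_scale :: "'d itself \<Rightarrow> real" where
  "phi_scale _ = (2 * pi) powr (- (real CARD('d) / 2))"

lemma Omega_lebesgue [simp]: "Omega \<in> sets lebesgue"
  by (simp add: Omega_def)

lemma integrable_continuous_Omega:
  fixes f :: "real^'d \<Rightarrow> 'b::euclidean_space"
  assumes "continuous_on UNIV f"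
  shows "integrable (cell) f"
proof -
  have "f absolutely_integrable_on cbox 0 corner"
    by (rule absolutely_integrable_continuous) (rule continuous_on_subset[OF assms], simp)
  then have "f absolutely_integrable_on Omega"
    by (rule set_integrable_subset) (auto simp: Omega_def box_subset_cbox)
  then show ?thesis
    by (simp add: integrable_restrict_space set_integrable_def)
qed

lemma integral_Omega:
  fixes f :: "real^'d \<Rightarrow> 'b::euclidean_space"
  assumes "integrable (cell) f"
  shows "(LINT x|cell. f x) = integral (cbox 0 corner) f"
  using lebesgue_integral_eq_integral[OF assms Omega_lebesgue]
  by (simp add: Omega_def integral_open_interval)

lemma axis_eq_scaleR: "axis j t = t *\<^sub>R axis j (1::real)"
  by (simp add: vec_eq_iff axis_def)

lemma mem_cbox_split:
  "x \<in> cbox u v \<longleftrightarrow> (u $ j \<le> x $ j \<and> x $ j \<le> v $ j) \<and> (\<forall>i. i \<noteq> j \<longrightarrow> u $ i \<le> x $ i \<and> x $ i \<le> v $ i)"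
  for x u v :: "real^'d"
  by (auto simp: mem_box_cart)

lemma axis_component: "axis j t $ i = (if i = j then t else 0)"
  by (simp add: axis_def)

text \<open>
  The box that spans both the period cell and its shift is cut once at \<open>t\<close> and once at \<open>2 \<pi>\<close> in
  direction \<open>j\<close>. The two thin slabs that are cut off are translates of each other by a period.
\<close>

lemma integral_periodic_shift:
  fixes \<Psi> :: "real^'d \<Rightarrow> complex"
  assumes per: "periodic \<Psi>" and cont: "continuous_on UNIV \<Psi>" and t: "0 \<le> t" "t \<le> 1"
  shows "integral (cbox 0 corner) (\<lambda>x. \<Psi> (x + axis j t)) = integral (cbox 0 corner) \<Psi>"
proof -
  define b where "b = corner + axis j t"
  define small :: "real^'d" where "small = (\<chi> i. if i = j then t else 2 * pi)"
  have pi: "1 \<le> 2 * pi" using pi_ge_two by linarith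
  have int: "\<Psi> integrable_on cbox u v" for u v
    using cont continuous_on_subset by (intro integrable_continuous) blast
  have basis: "axis j 1 \<in> (Basis :: (real^'d) set)" by (simp add: axis_in_Basis_iff)
  have "integral (cbox 0 b) \<Psi> = integral (cbox 0 b \<inter> {x. x \<bullet> axis j 1 \<le> t}) \<Psi>
      + integral (cbox 0 b \<inter> {x. x \<bullet> axis j 1 \<ge> t}) \<Psi>"
    by (rule integral_split[OF int basis])
  also have "cbox 0 b \<inter> {x. x \<bullet> axis j 1 \<le> t} = cbox 0 small"
    using t pi by (auto simp: b_def small_def mem_cbox_split[of _ _ _ j] inner_axis axis_component) 
  also have "cbox 0 b \<inter> {x. x \<bullet> axis j 1 \<ge> t} = cbox (axis j t) b"
    using t pi by (auto simp: b_def mem_cbox_split[of _ _ _ j] inner_axis axis_component)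
  finally have 1: "integral (cbox 0 b) \<Psi> = integral (cbox 0 small) \<Psi> + integral (cbox (axis j t) b) \<Psi>" .
  have "integral (cbox 0 b) \<Psi> = integral (cbox 0 b \<inter> {x. x \<bullet> axis j 1 \<le> 2 * pi}) \<Psi>
      + integral (cbox 0 b \<inter> {x. x \<bullet> axis j 1 \<ge> 2 * pi}) \<Psi>"
    by (rule integral_split[OF int basis])
  also have "cbox 0 b \<inter> {x. x \<bullet> axis j 1 \<le> 2 * pi} = cbox 0 corner"
    using t pi by (auto simp: b_def mem_cbox_split[of _ _ _ j] inner_axis axis_component) 
  also have "cbox 0 b \<inter> {x. x \<bullet> axis j 1 \<ge> 2 * pi} = cbox (0 + axis j (2 * pi)) (small + axis j (2 * pi))"
    using t pi by (auto simp: b_def small_def mem_cbox_split[of _ _ _ j] inner_axis axis_component)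
  also have "integral (cbox (0 + axis j (2 * pi)) (small + axis j (2 * pi))) \<Psi> = 
      integral (cbox 0 small) (\<Psi> \<circ> (+) (axis j (2 * pi)))"
    by (rule integral_shift_cbox_plus[symmetric])
  also have "\<Psi> \<circ> (+) (axis j (2 * pi)) = \<Psi>"
    using per by (auto simp: periodic_def add.commute)
  finally have 2: "integral (cbox (axis j t) b) \<Psi> = integral (cbox 0 corner) \<Psi>" using 1 by simp
  have "integral (cbox 0 corner) (\<Psi> \<circ> (+) (axis j t)) = integral (cbox (0 + axis j t) (corner + axis j t)) \<Psi>"
    by (rule integral_shift_cbox_plus)
  then show ?thesis using 2 by (simp add: b_def o_def add.commute)
qed

lemma C1pD:
  assumes "\<Psi> \<in> C1p"
  shows "periodic \<Psi>" "continuous_on UNIV \<Psi>" "continuous_on UNIV (partial_deriv j \<Psi>)" "\<Psi> differentiable (at x)"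
  using assms by (auto simp: C1p_def intro!: differentiable_imp_continuous_on simp: differentiable_on_def)

text \<open>
  The integral of \<open>\<Psi>\<close> over the shifted cell is constant in the shift; its derivative, taken under the
  integral sign, is the integral of the partial derivative. Both the orthogonality of the
  exponentials and integration by parts without boundary terms are instances of this.
\<close>

lemma integral_partial_deriv_eq_0:
  fixes \<Psi> :: "real^'d \<Rightarrow> complex"
  assumes "\<Psi> \<in> C1p"
  shows "(LINT x|cell. partial_deriv j \<Psi> x) = 0"
proof -
  note \<Psi> = C1pD[OF assms]
  have comp: "continuous_on S g \<Longrightarrow> continuous_on S (\<lambda>x. f (g x))" if "continuous_on UNIV f" 
    for f :: "real^'d \<Rightarrow> complex" and g :: "'c::topological_space \<Rightarrow> real^'d" and S
    using that continuous_on_compose2 by blast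
  have "((\<lambda>t. integral (cbox 0 corner) (\<lambda>x. \<Psi> (x + axis j t))) has_vector_derivative
      integral (cbox 0 corner) (\<lambda>x. partial_deriv j \<Psi> (x + axis j 0))) (at 0 within {0..1})"
  proof (rule leibniz_rule_vector_derivative)
    fix t :: real and x :: "real^'d"
    have 1: "((\<lambda>t. x + axis j t) has_derivative (\<lambda>h. h *\<^sub>R axis j 1)) (at t within {0..1})"
    proof -
      have "(\<lambda>t. x + axis j t) = (\<lambda>t. x + t *\<^sub>R axis j (1::real))"
        by (intro ext arg_cong2[where f = "(+)"] refl axis_eq_scaleR)
      then show ?thesis by (auto intro!: derivative_eq_intros)
    qed
    have 2: "(\<Psi> has_derivative frechet_derivative \<Psi> (at (x + axis j t))) (at (x + axis j t))"
      using \<Psi>(4) frechet_derivative_works by blast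
    have lin: "linear (frechet_derivative \<Psi> (at (x + axis j t)))"
      using 2 has_derivative_linear by blast
    have "((\<lambda>t. \<Psi> (x + axis j t)) has_derivative
        (\<lambda>h. frechet_derivative \<Psi> (at (x + axis j t)) (h *\<^sub>R axis j 1))) (at t within {0..1})"
      by (rule has_derivative_compose[OF 1 2])
    then show "((\<lambda>t. \<Psi> (x + axis j t)) has_vector_derivative partial_deriv j \<Psi> (x + axis j t)) (at t within {0..1})"
      by (simp add: has_vector_derivative_def partial_deriv_def linear_scale[OF lin])
  next
    show "(\<lambda>x. \<Psi> (x + axis j t)) integrable_on cbox 0 corner" for t
      by (intro integrable_continuous comp[OF \<Psi>(2)] continuous_intros)
    show "continuous_on ({0..1} \<times> cbox 0 corner) (\<lambda>(t, x). partial_deriv j \<Psi> (x + axis j t))"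
    proof -
      have "(\<lambda>(t, x). partial_deriv j \<Psi> (x + axis j t)) =
          (\<lambda>z. partial_deriv j \<Psi> (snd z + fst z *\<^sub>R axis j (1::real)))"
        by (rule ext, simp only: split_beta, intro arg_cong2[where f = "(+)"] arg_cong[where f = "partial_deriv j \<Psi>"] refl axis_eq_scaleR)
      then show ?thesis by (simp only:) (intro comp[OF \<Psi>(3)] continuous_intros)
    qed
  qed auto
  moreover have "((\<lambda>t. integral (cbox 0 corner) (\<lambda>x. \<Psi> (x + axis j t))) has_vector_derivative 0) (at 0 within {0..1})"
    by (rule has_vector_derivative_transform[of _ _ _ "\<lambda>_. integral (cbox 0 corner) \<Psi>"])
       (auto simp: integral_periodic_shift[OF \<Psi>(1,2)])
  ultimately have "integral (cbox 0 corner) (\<lambda>x. partial_deriv j \<Psi> (x + axis j 0)) = 0"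
    by (rule vector_derivative_unique_within[rotated]) (simp add: trivial_limit_within islimpt_Icc)
  moreover have "axis j (0::real) = 0" by (simp add: vec_eq_iff axis_def)
  ultimately show ?thesis
    by (simp add: integral_Omega[OF integrable_continuous_Omega[OF \<Psi>(3)]])
qed

section \<open>The exponentials\<close>

definition wave :: "int^'d \<Rightarrow> real^'d \<Rightarrow> real" where
  "wave k x = (\<Sum>j\<in>UNIV. real_of_int (k $ j) * x $ j)"

lemma phi_alt: "phi k x = complex_of_real (phi_scale TYPE('d)) * exp (\<i> * complex_of_real (wave k x))"
  for k :: "int^'d"
  by (simp add: phi_def phi_scale_def wave_def)

lemma phi_scale_pos: "0 < phi_scale TYPE('d)"
  by (simp add: phi_scale_def)

lemma wave_add: "wave (k + l) x = wave k x + wave l x"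
  by (simp add: wave_def sum.distrib distrib_right)

lemma wave_minus: "wave (- k) x = - wave k x"
  by (simp add: wave_def sum_negf)

lemma phi_mult: "phi k x * phi l x = complex_of_real (phi_scale TYPE('d)) * phi (k + l) x" for k :: "int^'d"
  by (simp add: phi_alt wave_add distrib_left exp_add)

lemma cnj_phi: "cnj (phi k x) = phi (- k) x"
  by (simp add: phi_alt wave_minus exp_cnj)

lemma phi_0: "phi 0 x = complex_of_real (phi_scale TYPE('d))" for x :: "real^'d"
  by (simp add: phi_alt wave_def)

lemma wave_axis: "wave k (axis j t) = real_of_int (k $ j) * t"
  by (simp add: wave_def axis_def if_distrib cong: if_cong)

lemma linear_wave: "bounded_linear (wave k)"
  unfolding wave_def by (intro bounded_linear_sum bounded_linear_const_mult bounded_linear_vec_nth)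

lemma has_derivative_phi:
  fixes k :: "int^'d"
  shows "(phi k has_derivative (\<lambda>h. \<i> * complex_of_real (wave k h) * phi k x)) (at x)"
proof -
  have 1: "((\<lambda>x. complex_of_real (wave k x)) has_derivative (\<lambda>h. complex_of_real (wave k h))) (at x)"
    by (intro derivative_intros bounded_linear_imp_has_derivative[OF linear_wave])
  have 2: "((\<lambda>x. \<i> * complex_of_real (wave k x)) has_derivative (\<lambda>h. \<i> * complex_of_real (wave k h))) (at x)"
    by (rule has_derivative_mult_right[OF 1])
  have "((\<lambda>x. exp (\<i> * complex_of_real (wave k x))) has_derivative
      (\<lambda>h. exp (\<i> * complex_of_real (wave k x)) * (\<i> * complex_of_real (wave k h)))) (at x)"
    by (rule has_derivative_compose[OF 2 DERIV_exp[unfolded has_field_derivative_def]])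
  from has_derivative_mult_right[OF this, of "complex_of_real (phi_scale TYPE('d))"]
  show ?thesis unfolding phi_alt[abs_def] by (simp only: mult_ac)
qed

lemma continuous_phi: "continuous_on S (phi k)"
  by (intro continuous_at_imp_continuous_on ballI has_derivative_continuous[OF has_derivative_phi])

lemma partial_deriv_phi: "partial_deriv j (phi k) x = \<i> * of_int (k $ j) * phi k x"
proof -
  have "frechet_derivative (phi k) (at x) = (\<lambda>h. \<i> * complex_of_real (wave k h) * phi k x)"
    by (rule frechet_derivative_at[OF has_derivative_phi, symmetric])
  then show ?thesis by (simp add: partial_deriv_def wave_axis)
qed

lemma periodic_phi: "periodic (phi k)"
  unfolding periodic_def
proof (intro allI)
  fix x j
  have "wave k (x + axis j (2 * pi)) = wave k x + wave k (axis j (2 * pi))"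
    using linear_wave bounded_linear.linear linear_add by blast
  moreover have "exp (\<i> * complex_of_real (real_of_int (k $ j) * (2 * pi))) = 1"
    using exp_integer_2pi[of "of_int (k $ j)"] by (simp add: mult_ac)
  ultimately show "phi k (x + axis j (2 * pi)) = phi k x"
    by (simp add: phi_alt wave_axis distrib_left exp_add)
qed

lemma phi_C1p: "phi k \<in> C1p"
  unfolding C1p_def
proof (intro CollectI conjI allI)
  show "phi k differentiable at x" for x
    using has_derivative_phi differentiable_def by blast
  show "continuous_on UNIV (partial_deriv j (phi k))" for j
    unfolding partial_deriv_phi by (intro continuous_intros continuous_phi)
qed (rule periodic_phi)

lemma partial_deriv_phi_mult:
  assumes "\<psi> \<in> C1p"
  shows "partial_deriv j (\<lambda>x. phi k x * \<psi> x) x = \<i> * of_int (k $ j) * phi k x * \<psi> x + phi k x * partial_deriv j \<psi> x"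
    and "(\<lambda>x. phi k x * \<psi> x) differentiable at x"
proof -
  have 1: "(\<psi> has_derivative frechet_derivative \<psi> (at x)) (at x)"
    using C1pD(4)[OF assms] frechet_derivative_works by blast
  have 2: "((\<lambda>x. phi k x * \<psi> x) has_derivative (\<lambda>h. phi k x * frechet_derivative \<psi> (at x) h +
      (\<i> * complex_of_real (wave k h) * phi k x) * \<psi> x)) (at x)"
    by (rule has_derivative_mult[OF has_derivative_phi 1])
  then have "frechet_derivative (\<lambda>x. phi k x * \<psi> x) (at x) = (\<lambda>h. phi k x * frechet_derivative \<psi> (at x) h +
      (\<i> * complex_of_real (wave k h) * phi k x) * \<psi> x)"
    by (rule frechet_derivative_at[symmetric])
  then show "partial_deriv j (\<lambda>x. phi k x * \<psi> x) x = \<i> * of_int (k $ j) * phi k x * \<psi> x + phi k x * partial_deriv j \<psi> x"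
    by (simp add: partial_deriv_def wave_axis)
  show "(\<lambda>x. phi k x * \<psi> x) differentiable at x" using 2 differentiable_def by blast
qed

lemma phi_mult_C1p:
  assumes "\<psi> \<in> C1p" shows "(\<lambda>x. phi k x * \<psi> x) \<in> C1p"
  unfolding C1p_def
proof (intro CollectI conjI allI)
  show "periodic (\<lambda>x. phi k x * \<psi> x)"
    using periodic_phi[of k] C1pD(1)[OF assms] by (auto simp: periodic_def)
  show "continuous_on UNIV (partial_deriv j (\<lambda>x. phi k x * \<psi> x))" for j
    unfolding partial_deriv_phi_mult(1)[OF assms]
    by (intro continuous_intros continuous_phi C1pD[OF assms])
qed (rule partial_deriv_phi_mult(2)[OF assms])

lemma weak_partial_phi: "weak_partial j (phi k) (\<lambda>x. \<i> * of_int (k $ j) * phi k x)"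
  unfolding weak_partial_def
proof
  fix \<psi> :: "real^'a \<Rightarrow> complex" assume \<psi>: "\<psi> \<in> C1p"
  have i1: "integrable (cell) (\<lambda>x. \<i> * of_int (k $ j) * phi k x * \<psi> x)"
    by (intro integrable_continuous_Omega continuous_intros continuous_phi C1pD[OF \<psi>])
  have i2: "integrable (cell) (\<lambda>x. phi k x * partial_deriv j \<psi> x)"
    by (intro integrable_continuous_Omega continuous_intros continuous_phi C1pD[OF \<psi>])
  have "(LINT x|cell. partial_deriv j (\<lambda>x. phi k x * \<psi> x) x) = 0"
    by (rule integral_partial_deriv_eq_0[OF phi_mult_C1p[OF \<psi>]])
  then have "(LINT x|cell. \<i> * of_int (k $ j) * phi k x * \<psi> x) +
      (LINT x|cell. phi k x * partial_deriv j \<psi> x) = 0"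
    unfolding partial_deriv_phi_mult(1)[OF \<psi>] Bochner_Integration.integral_add[OF i1 i2] .
  then show "(LINT x|cell. phi k x * partial_deriv j \<psi> x) =
      - (LINT x|cell. \<i> * of_int (k $ j) * phi k x * \<psi> x)"
    by (simp add: eq_neg_iff_add_eq_0 add.commute)
qed

lemma measure_Omega: "measure (lebesgue_on (Omega :: (real^'d) set)) Omega = (2 * pi) ^ CARD('d)"
proof -
  have "measure (lebesgue_on (Omega :: (real^'d) set)) Omega = measure lebesgue (box 0 corner :: (real^'d) set)"
    by (simp add: measure_restrict_space Omega_def)
  also have "\<dots> = measure lborel (cbox 0 corner :: (real^'d) set)"
    by (simp add: measure_lborel_box_eq measure_lborel_cbox_eq box_eq_empty)
  also have "\<dots> = (2 * pi) ^ CARD('d)"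
  proof -
    have "0 \<in> (cbox 0 corner :: (real^'d) set)" by (simp add: mem_box_cart)
    then have "cbox 0 corner \<noteq> ({} :: (real^'d) set)" by blast
    then show ?thesis by (subst content_cbox_cart) auto
  qed
  finally show ?thesis .
qed

lemma integral_phi:
  fixes k :: "int^'d"
  shows "(LINT x|cell. complex_of_real (phi_scale TYPE('d)) * phi k x) = (if k = 0 then 1 else 0)"
proof (cases "k = 0")
  case True
  have "phi_scale TYPE('d) * phi_scale TYPE('d) * (2 * pi) ^ CARD('d) = 1"
  proof -
    have "(2 * pi) ^ CARD('d) = (2 * pi) powr real CARD('d)"
      by (rule powr_realpow[symmetric]) simp
    then show ?thesis by (simp only: phi_scale_def powr_add[symmetric]) simp
  qed
  moreover have "(LINT x|cell. complex_of_real (phi_scale TYPE('d)) * phi k x) =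
      complex_of_real (phi_scale TYPE('d) * phi_scale TYPE('d) * (2 * pi) ^ CARD('d))"
    by (simp add: True phi_0 measure_Omega scaleR_conv_of_real)
  ultimately show ?thesis using True by (simp only: of_real_1 if_True refl)
next
  case False
  then obtain j where j: "k $ j \<noteq> 0" by (auto simp: vec_eq_iff)
  have "(LINT x|cell. \<i> * of_int (k $ j) * phi k x) = 0"
    using integral_partial_deriv_eq_0[OF phi_C1p, of j k] unfolding partial_deriv_phi .
  then show ?thesis using j False by simp
qed

lemma phi_orthonormal:
  fixes k l :: "int^'d"
  shows "(LINT x|cell. phi k x * cnj (phi l x)) = (if k = l then 1 else 0)"
  using integral_phi[of "k - l"] by (simp add: cnj_phi phi_mult)


section \<open>Square integrable functions\<close>

definition L2_Omega :: "(real^'d \<Rightarrow> complex) set" where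
  "L2_Omega = {g. g \<in> borel_measurable (cell) \<and>
     integrable (cell) (\<lambda>x. (cmod (g x))\<^sup>2)}"

definition norm_sq :: "(real^'d \<Rightarrow> complex) \<Rightarrow> real" where
  "norm_sq g = (LINT x|cell. (cmod (g x))\<^sup>2)"

lemma norm_sq_nonneg: "0 \<le> norm_sq g"
  by (simp add: norm_sq_def)

lemma L2_OmegaD:
  assumes "g \<in> L2_Omega"
  shows "g \<in> borel_measurable (cell)" "integrable (cell) (\<lambda>x. (cmod (g x))\<^sup>2)"
  using assms by (auto simp: L2_Omega_def)

lemma integrable_const_Omega: "integrable (lebesgue_on (Omega :: (real^'d) set)) (\<lambda>_. c :: 'b::euclidean_space)"
  by (rule integrable_continuous_Omega) simp

lemma L2_Omega_dominated:
  assumes "f \<in> borel_measurable (cell)" "integrable (cell) b"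
    "\<And>x. (cmod (f x))\<^sup>2 \<le> b x"
  shows "f \<in> L2_Omega"
proof -
  have "integrable (cell) (\<lambda>x. (cmod (f x))\<^sup>2)"
  proof (rule Bochner_Integration.integrable_bound[OF assms(2)])
    show "AE x in cell. norm ((cmod (f x))\<^sup>2) \<le> norm (b x)"
      using assms(3) by (intro AE_I2) (smt (verit) real_norm_def zero_le_power2)
  qed (use assms(1) in measurable)
  then show ?thesis using assms(1) by (simp add: L2_Omega_def)
qed

lemma continuous_L2_Omega:
  assumes "continuous_on UNIV g" shows "g \<in> L2_Omega"
  using integrable_continuous_Omega[OF assms] assms
  by (auto simp: L2_Omega_def intro!: integrable_continuous_Omega continuous_intros)

lemma phi_L2_Omega: "phi k \<in> L2_Omega"
  by (intro continuous_L2_Omega continuous_phi)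

lemma sum_square_le: "(a + b)\<^sup>2 \<le> 2 * a\<^sup>2 + 2 * (b :: real)\<^sup>2"
  using sum_squares_bound[of a b] by (simp add: power2_sum)

lemma cmod_add_sq: "(cmod (a + b))\<^sup>2 \<le> 2 * (cmod a)\<^sup>2 + 2 * (cmod b)\<^sup>2"
  by (rule order_trans[OF power_mono[OF norm_triangle_ineq] sum_square_le]) simp

lemma L2_Omega_add:
  assumes "g \<in> L2_Omega" "h \<in> L2_Omega"
  shows "(\<lambda>x. g x + h x) \<in> L2_Omega" "norm_sq (\<lambda>x. g x + h x) \<le> 2 * norm_sq g + 2 * norm_sq h"
proof -
  note gh = L2_OmegaD[OF assms(1)] L2_OmegaD[OF assms(2)]
  let ?b = "\<lambda>x. 2 * (cmod (g x))\<^sup>2 + 2 * (cmod (h x))\<^sup>2"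
  have b: "integrable (cell) ?b" using gh by auto
  show 1: "(\<lambda>x. g x + h x) \<in> L2_Omega"
    by (rule L2_Omega_dominated[OF _ b]) (use gh cmod_add_sq in auto)
  have "norm_sq (\<lambda>x. g x + h x) \<le> (LINT x|cell. ?b x)"
    unfolding norm_sq_def by (rule integral_mono[OF L2_OmegaD(2)[OF 1] b]) (rule cmod_add_sq)
  also have "\<dots> = 2 * norm_sq g + 2 * norm_sq h" using gh by (simp add: norm_sq_def)
  finally show "norm_sq (\<lambda>x. g x + h x) \<le> 2 * norm_sq g + 2 * norm_sq h" .
qed

lemma L2_Omega_cmult:
  assumes "g \<in> L2_Omega"
  shows "(\<lambda>x. c * g x) \<in> L2_Omega" "norm_sq (\<lambda>x. c * g x) = (cmod c)\<^sup>2 * norm_sq g"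
  using assms by (auto simp: L2_Omega_def norm_sq_def norm_mult power_mult_distrib)

lemma L2_Omega_diff:
  assumes "g \<in> L2_Omega" "h \<in> L2_Omega"
  shows "(\<lambda>x. g x - h x) \<in> L2_Omega"
  using L2_Omega_add(1)[OF assms(1) L2_Omega_cmult(1)[OF assms(2), of "-1"]] by simp

lemma L2_Omega_sum:
  assumes "\<And>k. k \<in> F \<Longrightarrow> g k \<in> L2_Omega"
  shows "(\<lambda>x. \<Sum>k\<in>F. g k x) \<in> L2_Omega"
  using assms by (induction F rule: infinite_finite_induct) (auto intro: L2_Omega_add continuous_L2_Omega)

lemma mult_le_squares: "\<bar>a\<bar> * \<bar>b\<bar> \<le> a\<^sup>2 + (b :: real)\<^sup>2"
proof -
  have "2 * (\<bar>a\<bar> * \<bar>b\<bar>) \<le> a\<^sup>2 + b\<^sup>2"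
    using sum_squares_bound[of "\<bar>a\<bar>" "\<bar>b\<bar>"] by (simp add: mult.assoc)
  moreover have "0 \<le> \<bar>a\<bar> * \<bar>b\<bar>" by simp
  ultimately show ?thesis by linarith
qed

lemma integrable_weighted_product:
  assumes \<nu>: "\<nu> \<in> borel_measurable (cell)" "\<And>x. cmod (\<nu> x) \<le> B"
    and "g \<in> L2_Omega" "h \<in> L2_Omega"
  shows "integrable (cell) (\<lambda>x. \<nu> x * (g x * cnj (h x)))"
proof (rule Bochner_Integration.integrable_bound)
  note gh = L2_OmegaD[OF assms(3)] L2_OmegaD[OF assms(4)]
  show "integrable (cell) (\<lambda>x. B * ((cmod (g x))\<^sup>2 + (cmod (h x))\<^sup>2))" using gh by auto
  have [measurable]: "g \<in> borel_measurable (cell)" "h \<in> borel_measurable (cell)"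
    "\<nu> \<in> borel_measurable (cell)" using gh \<nu> by auto
  have [measurable]: "(\<lambda>x. cnj (h x)) \<in> borel_measurable (cell)"
    by (rule measurable_compose[OF _ borel_measurable_continuous_onI]) (auto intro: continuous_intros)
  show "(\<lambda>x. \<nu> x * (g x * cnj (h x))) \<in> borel_measurable (cell)" by measurable
  show "AE x in cell. norm (\<nu> x * (g x * cnj (h x))) \<le> norm (B * ((cmod (g x))\<^sup>2 + (cmod (h x))\<^sup>2))"
  proof (rule AE_I2)
    fix x
    have B: "0 \<le> B" using \<nu>(2)[of x] norm_ge_zero order_trans by blast
    have "cmod (\<nu> x) * (cmod (g x) * cmod (h x)) \<le> B * ((cmod (g x))\<^sup>2 + (cmod (h x))\<^sup>2)"
      using mult_le_squares[of "cmod (g x)" "cmod (h x)"] \<nu>(2)[of x] B by (intro mult_mono) auto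
    then show "norm (\<nu> x * (g x * cnj (h x))) \<le> norm (B * ((cmod (g x))\<^sup>2 + (cmod (h x))\<^sup>2))"
      using B by (simp add: norm_mult)
  qed
qed

lemma integrable_product:
  assumes "g \<in> L2_Omega" "h \<in> L2_Omega"
  shows "integrable (cell) (\<lambda>x. g x * cnj (h x))"
  using integrable_weighted_product[of "\<lambda>_. 1" 1, OF _ _ assms] by simp

lemma weighted_Cauchy_Schwarz:
  assumes \<nu>: "\<nu> \<in> borel_measurable (cell)" "\<And>x. cmod (\<nu> x) \<le> B"
    and g: "g \<in> L2_Omega" and h: "h \<in> L2_Omega"
  shows "cmod (LINT x|cell. \<nu> x * (g x * cnj (h x))) \<le> B * (sqrt (norm_sq g) * sqrt (norm_sq h))"
proof -
  note gh = L2_OmegaD[OF g] L2_OmegaD[OF h]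
  have B: "0 \<le> B" using \<nu>(2)[of 0] norm_ge_zero order_trans by blast
  have int: "integrable (cell) (\<lambda>x. cmod (g x) * cmod (h x))"
    using integrable_norm[OF integrable_product[OF g h]] by (simp add: norm_mult)
  have "cmod (LINT x|cell. \<nu> x * (g x * cnj (h x))) \<le>
      (LINT x|cell. cmod (\<nu> x * (g x * cnj (h x))))"
    by (rule integral_norm_bound)
  also have "\<dots> \<le> (LINT x|cell. B * (cmod (g x) * cmod (h x)))"
    using int integrable_norm[OF integrable_weighted_product[OF assms]] \<nu>(2)
    by (intro integral_mono) (auto simp: norm_mult intro!: mult_right_mono)
  also have "\<dots> = B * (LINT x|cell. cmod (g x) * cmod (h x))" by simp
  also have "(LINT x|cell. cmod (g x) * cmod (h x)) \<le> sqrt (norm_sq g) * sqrt (norm_sq h)"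
  proof -
    let ?I = "LINT x|cell. cmod (g x) * cmod (h x)"
    have "(\<integral>\<^sup>+x. ennreal (cmod (g x)) * ennreal (cmod (h x)) \<partial>cell)\<^sup>2 \<le>
        (\<integral>\<^sup>+x. ennreal (cmod (g x))^2 \<partial>cell) * (\<integral>\<^sup>+x. ennreal (cmod (h x))^2 \<partial>cell)"
      using gh by (intro Cauchy_Schwarz_nn_integral) auto
    also have "(\<integral>\<^sup>+x. ennreal (cmod (g x))^2 \<partial>cell) = ennreal (norm_sq g)"
      unfolding norm_sq_def using gh by (subst nn_integral_eq_integral[symmetric]) (auto simp: ennreal_power)
    also have "(\<integral>\<^sup>+x. ennreal (cmod (h x))^2 \<partial>cell) = ennreal (norm_sq h)"
      unfolding norm_sq_def using gh by (subst nn_integral_eq_integral[symmetric]) (auto simp: ennreal_power)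
    also have "(\<integral>\<^sup>+x. ennreal (cmod (g x)) * ennreal (cmod (h x)) \<partial>cell) = ennreal ?I"
      using int by (subst nn_integral_eq_integral[symmetric]) (auto simp: ennreal_mult)
    finally have "ennreal (?I\<^sup>2) \<le> ennreal (norm_sq g * norm_sq h)"
      by (simp add: ennreal_power ennreal_mult norm_sq_nonneg)
    then have "?I\<^sup>2 \<le> norm_sq g * norm_sq h"
      by (simp add: ennreal_le_iff norm_sq_nonneg)
    then have "?I \<le> sqrt (norm_sq g * norm_sq h)" by (rule real_le_rsqrt)
    then show ?thesis by (simp add: real_sqrt_mult)
  qed
  finally show ?thesis using B by (simp add: mult_left_mono)
qed

lemma norm_sq_eq_0_AE:
  assumes "g \<in> L2_Omega" "norm_sq g = 0"
  shows "AE x in cell. g x = 0"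
  using integral_nonneg_eq_0_iff_AE[OF L2_OmegaD(2)[OF assms(1)]] assms(2) by (auto simp: norm_sq_def)

section \<open>Fourier coefficients\<close>

lemma fcoeff_add:
  assumes "g \<in> L2_Omega" "h \<in> L2_Omega"
  shows "fcoeff (\<lambda>x. g x + h x) k = fcoeff g k + fcoeff h k"
  unfolding fcoeff_def distrib_right
  by (intro Bochner_Integration.integral_add integrable_product assms phi_L2_Omega)

lemma fcoeff_cmult: "fcoeff (\<lambda>x. c * g x) k = c * fcoeff g k"
  by (simp add: fcoeff_def mult.assoc)

lemma fcoeff_diff:
  assumes "g \<in> L2_Omega" "h \<in> L2_Omega"
  shows "fcoeff (\<lambda>x. g x - h x) k = fcoeff g k - fcoeff h k"
  unfolding fcoeff_def left_diff_distrib
  by (intro Bochner_Integration.integral_diff integrable_product assms phi_L2_Omega)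

lemma fcoeff_phi: "fcoeff (phi l) k = (if k = l then 1 else 0)"
  using phi_orthonormal[of l k] by (auto simp: fcoeff_def)

lemma trig_L2_Omega: "(\<lambda>x. \<Sum>k\<in>F. c k * phi k x) \<in> L2_Omega"
  by (intro L2_Omega_sum L2_Omega_cmult phi_L2_Omega)

lemma fcoeff_trig:
  assumes "finite F"
  shows "fcoeff (\<lambda>x. \<Sum>l\<in>F. c l * phi l x) k = (if k \<in> F then c k else 0)"
  using assms
proof (induction F rule: finite_induct)
  case empty
  then show ?case by (simp add: fcoeff_def)
next
  case (insert l F)
  have "fcoeff (\<lambda>x. c l * phi l x + (\<Sum>l\<in>F. c l * phi l x)) k = c l * fcoeff (phi l) k + (if k \<in> F then c k else 0)"
    by (subst fcoeff_add) (auto simp: fcoeff_cmult insert.IH intro: L2_Omega_cmult phi_L2_Omega trig_L2_Omega)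
  then show ?case using insert by (auto simp: fcoeff_phi)
qed

lemma norm_sq_diff_phi:
  assumes g: "g \<in> L2_Omega"
  shows "norm_sq (\<lambda>x. g x - c * phi k x) = norm_sq g - (cmod (fcoeff g k))\<^sup>2 + (cmod (fcoeff g k - c))\<^sup>2"
proof -
  have pw: "(cmod (a - b))\<^sup>2 = (cmod a)\<^sup>2 - 2 * Re (a * cnj b) + (cmod b)\<^sup>2" for a b
    by (simp add: cmod_power2) (simp add: power2_eq_square algebra_simps)
  have cp: "(\<lambda>x. c * phi k x) \<in> L2_Omega" by (intro L2_Omega_cmult phi_L2_Omega)
  note int = integrable_product[OF g cp]
  have ns1: "norm_sq (phi k) = 1"
  proof -
    have "complex_of_real (norm_sq (phi k)) = (LINT x|cell. complex_of_real ((cmod (phi k x))\<^sup>2))"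
      unfolding norm_sq_def by (rule integral_complex_of_real[symmetric])
    also have "\<dots> = (LINT x|cell. phi k x * cnj (phi k x))"
      by (intro Bochner_Integration.integral_cong refl complex_norm_square)
    finally show ?thesis by (simp add: phi_orthonormal)
  qed
  define r where "r x = Re (g x * cnj (c * phi k x))" for x
  have r: "integrable (cell) r"
      "(LINT x|cell. r x) = Re (LINT x|cell. g x * cnj (c * phi k x))"
    unfolding r_def using integrable_Re[OF int] integral_Re[OF int] by auto
  have "norm_sq (\<lambda>x. g x - c * phi k x) = (LINT x|cell.
      (cmod (g x))\<^sup>2 - 2 * r x + (cmod (c * phi k x))\<^sup>2)"
    unfolding norm_sq_def pw r_def ..
  also have "\<dots> = norm_sq g - 2 * Re (LINT x|cell. g x * cnj (c * phi k x)) + norm_sq (\<lambda>x. c * phi k x)"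
    unfolding r(2)[symmetric] norm_sq_def using r(1) L2_OmegaD[OF g] L2_OmegaD[OF cp] by simp
  also have "(LINT x|cell. g x * cnj (c * phi k x)) = cnj c * fcoeff g k"
    by (simp add: fcoeff_def mult.left_commute)
  also have "norm_sq (\<lambda>x. c * phi k x) = (cmod c)\<^sup>2"
    by (simp add: L2_Omega_cmult phi_L2_Omega ns1)
  finally show ?thesis by (simp add: pw mult.commute)
qed

text \<open>
  Pythagoras: the best coefficients are the Fourier coefficients. It gives Bessel's inequality for
  \<open>c\<close> the Fourier coefficients, and it bounds the defect in Parseval's identity by the
  distance to any trigonometric polynomial.
\<close>

lemma norm_sq_diff_trig:
  assumes g: "g \<in> L2_Omega" and F: "finite F"
  shows "norm_sq (\<lambda>x. g x - (\<Sum>k\<in>F. c k * phi k x)) =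
    norm_sq g - (\<Sum>k\<in>F. (cmod (fcoeff g k))\<^sup>2) + (\<Sum>k\<in>F. (cmod (fcoeff g k - c k))\<^sup>2)"
  using F
proof (induction F rule: finite_induct)
  case (insert k F)
  let ?T = "\<lambda>x. \<Sum>k\<in>F. c k * phi k x"
  have gT: "(\<lambda>x. g x - ?T x) \<in> L2_Omega" by (intro L2_Omega_diff g trig_L2_Omega)
  have "fcoeff (\<lambda>x. g x - ?T x) k = fcoeff g k"
    using insert by (simp add: fcoeff_diff[OF g trig_L2_Omega] fcoeff_trig)
  then have "norm_sq (\<lambda>x. (g x - ?T x) - c k * phi k x) =
      norm_sq (\<lambda>x. g x - ?T x) - (cmod (fcoeff g k))\<^sup>2 + (cmod (fcoeff g k - c k))\<^sup>2"
    using norm_sq_diff_phi[OF gT] by simp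
  then show ?case using insert by (simp add: algebra_simps)
qed simp

lemma Bessel:
  assumes "g \<in> L2_Omega" "finite F"
  shows "(\<Sum>k\<in>F. (cmod (fcoeff g k))\<^sup>2) \<le> norm_sq g"
  using norm_sq_diff_trig[OF assms, of "fcoeff g"] norm_sq_nonneg[of "\<lambda>x. g x - (\<Sum>k\<in>F. fcoeff g k * phi k x)"]
  by simp

section \<open>Density of trigonometric polynomials\<close>

text \<open>
  The inductive presentation makes the algebra property (\<open>trig_mult\<close>) and membership proofs direct;
  \<open>trig_eq_sum\<close> recovers the usual form.
\<close>

inductive_set trig :: "(real^'d \<Rightarrow> complex) set" where
  trig_phi: "phi k \<in> trig"
| trig_cmult: "f \<in> trig \<Longrightarrow> (\<lambda>x. c * f x) \<in> trig"
| trig_add: "f \<in> trig \<Longrightarrow> g \<in> trig \<Longrightarrow> (\<lambda>x. f x + g x) \<in> trig"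

lemma trig_eq_sum:
  assumes "f \<in> trig"
  shows "\<exists>F c. finite F \<and> f = (\<lambda>x. \<Sum>k\<in>F. c k * phi k x)"
  using assms
proof induction
  case (trig_phi k)
  show ?case by (intro exI[of _ "{k}"] exI[of _ "\<lambda>_. 1"]) auto
next
  case (trig_cmult f a)
  then obtain F c where "finite F" "f = (\<lambda>x. \<Sum>k\<in>F. c k * phi k x)" by blast
  then show ?case
    by (intro exI[of _ F] exI[of _ "\<lambda>k. a * c k"]) (auto simp: sum_distrib_left mult.assoc)
next
  case (trig_add f g)
  then obtain F c F' c' where f: "finite F" "f = (\<lambda>x. \<Sum>k\<in>F. c k * phi k x)"
    and g: "finite F'" "g = (\<lambda>x. \<Sum>k\<in>F'. c' k * phi k x)" by blast
  let ?c = "\<lambda>k. (if k \<in> F then c k else 0) + (if k \<in> F' then c' k else 0)"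
  have "f x + g x = (\<Sum>k\<in>F \<union> F'. ?c k * phi k x)" for x
  proof -
    have "f x = (\<Sum>k\<in>F \<union> F'. (if k \<in> F then c k else 0) * phi k x)"
      unfolding f(2) using f g by (intro sum.mono_neutral_cong_left) auto
    moreover have "g x = (\<Sum>k\<in>F \<union> F'. (if k \<in> F' then c' k else 0) * phi k x)"
      unfolding g(2) using f g by (intro sum.mono_neutral_cong_left) auto
    ultimately show ?thesis by (simp add: distrib_right sum.distrib)
  qed
  then show ?case using f g by (intro exI[of _ "F \<union> F'"] exI[of _ ?c]) auto
qed

lemma trig_mult:
  assumes "f \<in> trig" "g \<in> trig" shows "(\<lambda>x. f x * g x) \<in> trig"
  using assms(1)
proof induction
  case (trig_phi k)
  show ?case using assms(2)
  proof induction
    case (trig_phi l)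
    show ?case unfolding phi_mult by (intro trig.intros)
  next
    case (trig_cmult f c)
    from trig.trig_cmult[OF this(2), of c] show ?case by (simp add: mult.left_commute)
  next
    case (trig_add f h)
    from trig.trig_add[OF this(3,4)] show ?case by (simp add: distrib_left)
  qed
next
  case (trig_cmult f c)
  from trig.trig_cmult[OF this(2), of c] show ?case by (simp add: mult.assoc)
next
  case (trig_add f h)
  from trig.trig_add[OF this(3,4)] show ?case by (simp add: distrib_right)
qed

lemma trig_const: "(\<lambda>x :: real^'d. c) \<in> trig"
proof -
  have "(\<lambda>x :: real^'d. c / complex_of_real (phi_scale TYPE('d)) * phi 0 x) \<in> trig"
    by (intro trig.intros)
  then show ?thesis using phi_scale_pos[where 'd = 'd] by (simp add: phi_0)
qed

lemma trig_cos_sin: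
  "(\<lambda>x :: real^'d. complex_of_real (cos (x $ j))) \<in> trig" "(\<lambda>x :: real^'d. complex_of_real (sin (x $ j))) \<in> trig"
proof -
  let ?s = "complex_of_real (phi_scale TYPE('d))"
  have s: "?s \<noteq> 0" using phi_scale_pos[where 'd = 'd] by simp
  have e: "exp (\<i> * complex_of_real (x $ j)) = phi (axis j 1) x / ?s"
     "exp (- (\<i> * complex_of_real (x $ j))) = phi (- axis j 1) x / ?s" for x :: "real^'d"
  proof -
    have "wave (axis j 1) x = x $ j"
      by (simp add: wave_def axis_def if_distrib[of real_of_int] if_distrib[of "\<lambda>c. c * _"] cong: if_cong)
    then show "exp (\<i> * complex_of_real (x $ j)) = phi (axis j 1) x / ?s"
     "exp (- (\<i> * complex_of_real (x $ j))) = phi (- axis j 1) x / ?s"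
      using s by (auto simp: phi_alt wave_minus)
  qed
  have "complex_of_real (cos (x $ j)) = (1 / (2 * ?s)) * phi (axis j 1) x + (1 / (2 * ?s)) * phi (- axis j 1) x"
    for x :: "real^'d"
    by (simp add: cos_of_real[symmetric] cos_exp_eq e add_divide_distrib mult.commute)
  then show "(\<lambda>x :: real^'d. complex_of_real (cos (x $ j))) \<in> trig"
    by (simp only:) (intro trig.intros)
  have "complex_of_real (sin (x $ j)) = (1 / (2 * \<i> * ?s)) * phi (axis j 1) x + (- 1 / (2 * \<i> * ?s)) * phi (- axis j 1) x"
    for x :: "real^'d"
  proof -
    have alg: "(a / s - b / s) / t = 1 / (t * s) * a + - 1 / (t * s) * b" for a b s t :: complex
      by (simp add: diff_divide_distrib mult.commute)
    show ?thesis unfolding sin_of_real[symmetric] sin_exp_eq e alg ..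
  qed
  then show "(\<lambda>x :: real^'d. complex_of_real (sin (x $ j))) \<in> trig"
    by (simp only:) (intro trig.intros)
qed

text \<open>
  The period cell with opposite faces glued, embedded in a Euclidean space. A function on the closed
  cell that vanishes on its boundary factors through this map, and the coordinates of the image are
  trigonometric polynomials that separate points.
\<close>

definition torus :: "real^'d \<Rightarrow> complex^'d" where
  "torus x = (\<chi> j. cis (x $ j))"

lemma continuous_torus: "continuous_on S torus"
  unfolding torus_def cis_conv_exp by (intro continuous_intros)

lemma torus_injective_inside:
  fixes x y :: "real^'d"
  assumes "x \<in> cbox 0 corner" "y \<in> cbox 0 corner" "torus x = torus y"
  shows "x = y \<or> ((\<exists>j. x $ j = 0 \<or> x $ j = 2 * pi) \<and> (\<exists>j. y $ j = 0 \<or> y $ j = 2 * pi))"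
proof (cases "x = y")
  case False
  then obtain j where j: "x $ j \<noteq> y $ j" by (auto simp: vec_eq_iff)
  have r: "0 \<le> x $ j" "x $ j \<le> 2 * pi" "0 \<le> y $ j" "y $ j \<le> 2 * pi"
    using assms by (auto simp: mem_box_cart)
  have "cis (x $ j) = cis (y $ j)" using assms(3) by (auto simp: torus_def vec_eq_iff)
  then have "sin (x $ j) = sin (y $ j) \<and> cos (x $ j) = cos (y $ j)" by (auto simp: complex_eq_iff)
  then obtain n :: int where n: "x $ j = y $ j + 2 * pi * n" using sin_cos_eq_iff by blast
  then have "\<bar>2 * pi * n\<bar> \<le> 2 * pi" using r by linarith
  then have "\<bar>real_of_int n\<bar> \<le> 1" using pi_gt_zero by (simp add: abs_mult)
  moreover have "n \<noteq> 0" using n j by auto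
  ultimately have "n = 1 \<or> n = - 1" by linarith
  then have "(x $ j = 0 \<or> x $ j = 2 * pi) \<and> (y $ j = 0 \<or> y $ j = 2 * pi)" using n r by auto
  then show ?thesis by blast
qed simp

lemma continuous_on_quotient:
  fixes q :: "'a::t2_space \<Rightarrow> 'b::t2_space" and f :: "'b \<Rightarrow> 'c::topological_space"
  assumes K: "compact K" and q: "continuous_on K q" and fq: "continuous_on K (\<lambda>x. f (q x))"
  shows "continuous_on (q ` K) f"
proof -
  have "closed (f -` B \<inter> q ` K)" if B: "closed B" for B
  proof -
    have "f -` B \<inter> q ` K = q ` ((\<lambda>x. f (q x)) -` B \<inter> K)" by auto
    moreover have "closed ((\<lambda>x. f (q x)) -` B \<inter> K)"
      using fq B continuous_on_closed_vimage[OF compact_imp_closed[OF K]] by blast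
    then have "compact ((\<lambda>x. f (q x)) -` B \<inter> K)"
      using K compact_Int_closed[of K] by (metis Int_absorb2 Int_commute inf_le2)
    then have "compact (q ` ((\<lambda>x. f (q x)) -` B \<inter> K))"
      by (rule compact_continuous_image[rotated]) (rule continuous_on_subset[OF q], auto)
    ultimately show ?thesis by (simp add: compact_imp_closed)
  qed
  then show ?thesis
    using continuous_on_closed_vimage[OF compact_imp_closed[OF compact_continuous_image[OF q K]]] by blast
qed

lemma trig_approx_real:
  fixes \<psi> :: "real^'d \<Rightarrow> real"
  assumes cont: "continuous_on (cbox 0 corner) \<psi>"
    and bdry: "\<And>x j. x $ j = 0 \<or> x $ j = 2 * pi \<Longrightarrow> \<psi> x = 0" and e: "0 < e"
  shows "\<exists>T\<in>trig. \<forall>x\<in>cbox 0 corner. cmod (complex_of_real (\<psi> x) - T x) < e"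
proof -
  let ?K = "cbox 0 corner :: (real^'d) set"
  define f where "f z = \<psi> (SOME x. x \<in> ?K \<and> torus x = z)" for z
  have f: "f (torus x) = \<psi> x" if x: "x \<in> ?K" for x
  proof -
    define y where "y = (SOME y. y \<in> ?K \<and> torus y = torus x)"
    have "y \<in> ?K \<and> torus y = torus x" unfolding y_def by (rule someI) (use x in simp)
    then have "y = x \<or> ((\<exists>j. y $ j = 0 \<or> y $ j = 2 * pi) \<and> (\<exists>j. x $ j = 0 \<or> x $ j = 2 * pi))"
      using torus_injective_inside x by blast
    then have "\<psi> y = \<psi> x" using bdry by metis
    then show ?thesis by (simp add: f_def y_def)
  qed
  have "continuous_on ?K (\<lambda>x. f (torus x))"
    using continuous_on_cong[OF refl f, of ?K] cont by simp
  then have contf: "continuous_on (torus ` ?K) f"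
    by (intro continuous_on_quotient continuous_torus compact_cbox)
  define P where "P g \<longleftrightarrow> continuous_on UNIV g \<and> (\<lambda>x. complex_of_real (g (torus x))) \<in> trig"
    for g :: "complex^'d \<Rightarrow> real"
  have "\<exists>g. P g \<and> (\<forall>z\<in>torus ` ?K. \<bar>f z - g z\<bar> < e)"
  proof (rule Stone_Weierstrass_HOL)
    show "compact (torus ` ?K)" by (intro compact_continuous_image continuous_torus compact_cbox)
    show "P (\<lambda>x. c)" for c by (simp add: P_def trig_const)
    show "continuous_on (torus ` ?K) g" if "P g" for g
      using that continuous_on_subset by (auto simp: P_def)
    show "P (\<lambda>x. g x + h x)" "P (\<lambda>x. g x * h x)" if "P g \<and> P h" for g h
      using that by (auto simp: P_def intro!: continuous_intros trig_add trig_mult)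
    show "\<exists>g. P g \<and> g z \<noteq> g z'" if z: "z \<in> torus ` ?K \<and> z' \<in> torus ` ?K \<and> z \<noteq> z'" for z z'
    proof -
      obtain j where "z $ j \<noteq> z' $ j" using z by (auto simp: vec_eq_iff)
      then consider "Re (z $ j) \<noteq> Re (z' $ j)" | "Im (z $ j) \<noteq> Im (z' $ j)" by (auto simp: complex_eq_iff)
      then show ?thesis
      proof cases
        case 1
        have "P (\<lambda>z. Re (z $ j))"
          using trig_cos_sin(1)[of j] by (auto simp: P_def torus_def intro!: continuous_intros)
        then show ?thesis using 1 by blast
      next
        case 2
        have "P (\<lambda>z. Im (z $ j))"
          using trig_cos_sin(2)[of j] by (auto simp: P_def torus_def intro!: continuous_intros)
        then show ?thesis using 2 by blast
      qed
    qed
  qed (use contf e in auto)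
  then obtain g where g: "P g" "\<And>x. x \<in> ?K \<Longrightarrow> \<bar>f (torus x) - g (torus x)\<bar> < e" by blast
  show ?thesis
  proof (rule bexI)
    show "(\<lambda>x. complex_of_real (g (torus x))) \<in> trig" using g(1) by (simp add: P_def)
    show "\<forall>x\<in>?K. cmod (complex_of_real (\<psi> x) - complex_of_real (g (torus x))) < e"
      using g(2) f by (metis norm_of_real of_real_diff)
  qed
qed

lemma trig_approx:
  fixes \<psi> :: "real^'d \<Rightarrow> complex"
  assumes cont: "continuous_on (cbox 0 corner) \<psi>"
    and bdry: "\<And>x j. x $ j = 0 \<or> x $ j = 2 * pi \<Longrightarrow> \<psi> x = 0" and e: "0 < e"
  shows "\<exists>T\<in>trig. \<forall>x\<in>cbox 0 corner. cmod (\<psi> x - T x) < e"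
proof -
  obtain S where S: "S \<in> trig" "\<forall>x\<in>cbox 0 corner. cmod (complex_of_real (Re (\<psi> x)) - S x) < e / 2"
    using trig_approx_real[of "\<lambda>x. Re (\<psi> x)" "e / 2"] cont bdry e by (auto intro!: continuous_intros)
  obtain T where T: "T \<in> trig" "\<forall>x\<in>cbox 0 corner. cmod (complex_of_real (Im (\<psi> x)) - T x) < e / 2"
    using trig_approx_real[of "\<lambda>x. Im (\<psi> x)" "e / 2"] cont bdry e by (auto intro!: continuous_intros)
  show ?thesis
  proof (intro bexI ballI)
    show "(\<lambda>x. S x + \<i> * T x) \<in> trig" by (intro trig.intros S T)
    fix x :: "real^'d" assume x: "x \<in> cbox 0 corner"
    have "\<psi> x - (S x + \<i> * T x) = (complex_of_real (Re (\<psi> x)) - S x) + \<i> * (complex_of_real (Im (\<psi> x)) - T x)"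
      using complex_eq[of "\<psi> x"] by (simp add: algebra_simps)
    also have "cmod \<dots> \<le> cmod (complex_of_real (Re (\<psi> x)) - S x) + cmod (\<i> * (complex_of_real (Im (\<psi> x)) - T x))"
      by (rule norm_triangle_ineq)
    also have "\<dots> < e / 2 + e / 2" using S(2) T(2) x by (intro add_strict_mono) (auto simp: norm_mult)
    finally show "cmod (\<psi> x - (S x + \<i> * T x)) < e" by simp
  qed
qed

definition trig_dense :: "(real^'d \<Rightarrow> complex) \<Rightarrow> bool" where
  "trig_dense g \<longleftrightarrow> (\<forall>e>0. \<exists>T\<in>trig. norm_sq (\<lambda>x. g x - T x) < e)"

lemma trig_in_L2: "T \<in> trig \<Longrightarrow> T \<in> L2_Omega"
  using trig_eq_sum[of T] trig_L2_Omega by blast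

lemma trig_dense_closed:
  assumes g: "g \<in> L2_Omega"
    and approx: "\<And>e. 0 < e \<Longrightarrow> \<exists>h\<in>L2_Omega. trig_dense h \<and> norm_sq (\<lambda>x. g x - h x) < e"
  shows "trig_dense g"
  unfolding trig_dense_def
proof (intro allI impI)
  fix e :: real assume e: "0 < e"
  obtain h where h: "h \<in> L2_Omega" "trig_dense h" "norm_sq (\<lambda>x. g x - h x) < e / 4"
    using approx[of "e / 4"] e by auto
  obtain T where T: "T \<in> trig" "norm_sq (\<lambda>x. h x - T x) < e / 4"
    using h(2) e unfolding trig_dense_def by (meson divide_pos_pos zero_less_numeral)
  have "norm_sq (\<lambda>x. g x - T x) = norm_sq (\<lambda>x. (g x - h x) + (h x - T x))" by simp
  also have "\<dots> \<le> 2 * norm_sq (\<lambda>x. g x - h x) + 2 * norm_sq (\<lambda>x. h x - T x)"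
    by (intro L2_Omega_add L2_Omega_diff g h trig_in_L2 T)
  also have "\<dots> < e" using h T by linarith
  finally show "\<exists>T\<in>trig. norm_sq (\<lambda>x. g x - T x) < e" using T by blast
qed

lemma trig_dense_continuous:
  fixes \<psi> :: "real^'d \<Rightarrow> complex"
  assumes cont: "continuous_on UNIV \<psi>"
    and bdry: "\<And>x j. x $ j = 0 \<or> x $ j = 2 * pi \<Longrightarrow> \<psi> x = 0"
  shows "trig_dense \<psi>"
  unfolding trig_dense_def
proof (intro allI impI)
  fix e :: real assume e: "0 < e"
  define V where "V = (2 * pi) ^ CARD('d)"
  define \<delta> where "\<delta> = sqrt (e / (2 * V))"
  have V: "0 < V" by (simp add: V_def)
  have \<delta>: "0 < \<delta>" using e V by (simp add: \<delta>_def)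
  obtain T where T: "T \<in> trig" "\<And>x. x \<in> cbox 0 corner \<Longrightarrow> cmod (\<psi> x - T x) < \<delta>"
    using trig_approx[of \<psi> \<delta>, OF continuous_on_subset[OF cont]] bdry \<delta> by blast
  have d: "(\<lambda>x. \<psi> x - T x) \<in> L2_Omega"
    by (intro L2_Omega_diff continuous_L2_Omega cont trig_in_L2 T)
  have "norm_sq (\<lambda>x. \<psi> x - T x) \<le> (LINT x|lebesgue_on (Omega :: (real^'d) set). \<delta>\<^sup>2)"
    unfolding norm_sq_def
  proof (rule integral_mono[OF L2_OmegaD(2)[OF d] integrable_const_Omega])
    fix x :: "real^'d" assume "x \<in> space (cell)"
    then have "x \<in> cbox 0 corner" using box_subset_cbox by (auto simp: Omega_def)
    then show "(cmod (\<psi> x - T x))\<^sup>2 \<le> \<delta>\<^sup>2" using T(2)[of x] by (intro power_mono) auto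
  qed
  also have "\<dots> = V * \<delta>\<^sup>2" by (simp add: measure_Omega V_def)
  also have "\<dots> = e / 2" using e V by (simp add: \<delta>_def)
  finally have "norm_sq (\<lambda>x. \<psi> x - T x) < e" using e by simp
  then show "\<exists>T\<in>trig. norm_sq (\<lambda>x. \<psi> x - T x) < e" using T by blast
qed

text \<open>
  The radial retraction onto the disc of radius \<open>M\<close>.
\<close>

definition truncate :: "real \<Rightarrow> complex \<Rightarrow> complex" where
  "truncate M z = of_real (M / max M (cmod z)) * z"

lemma truncate:
  assumes M: "0 < M"
  shows "continuous_on S (truncate M)" "cmod (truncate M z) \<le> M" "cmod (truncate M z) \<le> cmod z"
    "cmod z \<le> M \<Longrightarrow> truncate M z = z"
proof -
  have pos: "0 < max M (cmod z)" for z using M by (simp add: less_max_iff_disj)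
  have nz: "max M (cmod z) \<noteq> 0" for z using pos[of z] by linarith
  show "continuous_on S (truncate M)"
    unfolding truncate_def[abs_def] by (intro continuous_intros continuous_on_max) (use nz in auto)
  have c: "cmod (truncate M z) = M / max M (cmod z) * cmod z"
    using M pos[of z] by (simp add: truncate_def norm_mult norm_divide abs_of_pos)
  show "cmod (truncate M z) \<le> M" unfolding c using M pos[of z] by (simp add: field_simps max_def)
  show "cmod (truncate M z) \<le> cmod z" unfolding c using M pos[of z]
    by (intro mult_left_le_one_le) (auto simp: field_simps max_def)
  show "cmod z \<le> M \<Longrightarrow> truncate M z = z" using M by (simp add: truncate_def max_def)
qed

text \<open>
  Continuous, zero on the boundary of the period cell, and at each point inside the cell equal to 1
  from some \<open>n\<close> on.
\<close>

definition cutoff :: "nat \<Rightarrow> real^'d \<Rightarrow> real" where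
  "cutoff n x = min 1 (real n * (\<Prod>j\<in>UNIV. 1 - cos (x $ j)))"

lemma cutoff:
  fixes x :: "real^'d"
  shows "continuous_on S (cutoff n)" "0 \<le> cutoff n x" "cutoff n x \<le> 1"
    "x $ j = 0 \<or> x $ j = 2 * pi \<Longrightarrow> cutoff n x = 0"
    "x \<in> Omega \<Longrightarrow> \<forall>\<^sub>F n in sequentially. cutoff n x = 1"
proof -
  show "continuous_on S (cutoff n)" unfolding cutoff_def[abs_def] by (intro continuous_intros)
  show "0 \<le> cutoff n x" by (auto simp: cutoff_def intro!: mult_nonneg_nonneg prod_nonneg)
  show "cutoff n x \<le> 1" by (simp add: cutoff_def)
  show "cutoff n x = 0" if "x $ j = 0 \<or> x $ j = 2 * pi"
  proof -
    have "(\<Prod>j\<in>UNIV. 1 - cos (x $ j)) = 0" using that by (intro prod_zero bexI[of _ j]) auto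
    then show ?thesis unfolding cutoff_def by (simp only: mult_zero_right)
  qed
  show "\<forall>\<^sub>F n in sequentially. cutoff n x = 1" if x: "x \<in> Omega"
  proof -
    let ?p = "\<Prod>j\<in>UNIV. 1 - cos (x $ j)"
    have "cos (x $ j) \<noteq> 1" for j
    proof
      assume "cos (x $ j) = 1"
      then obtain n :: int where n: "x $ j = of_int n * 2 * pi" using cos_one_2pi_int by blast
      have "0 < x $ j" "x $ j < 2 * pi" using x by (auto simp: Omega_def mem_box_cart)
      then have "0 < n" "n < 1" using n by (auto simp: zero_less_mult_iff)
      then show False by linarith
    qed
    then have "0 < 1 - cos (x $ j)" for j using cos_le_one[of "x $ j"] by (simp add: less_le)
    then have p: "0 < ?p" by (intro prod_pos) auto
    obtain N where N: "1 < real N * ?p" using ex_less_of_nat_mult[OF p, of 1] by blast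
    show ?thesis unfolding eventually_sequentially
    proof (intro exI allI impI)
      fix n assume "N \<le> n"
      then have "real N * ?p \<le> real n * ?p" using p by (intro mult_right_mono) auto
      then show "cutoff n x = 1" using N by (simp add: cutoff_def)
    qed
  qed
qed

lemma norm_sq_tendsto_0:
  assumes m: "\<And>n. s n \<in> borel_measurable (cell)"
    and b: "integrable (cell) b" "\<And>n x. (cmod (s n x))\<^sup>2 \<le> b x"
    and lim: "AE x in cell. (\<lambda>n. s n x) \<longlonglongrightarrow> 0"
  shows "(\<lambda>n. norm_sq (s n)) \<longlonglongrightarrow> 0"
proof -
  have "(\<lambda>n. LINT x|cell. (cmod (s n x))\<^sup>2) \<longlonglongrightarrow> (LINT x|lebesgue_on (Omega :: (real^'a) set). 0)"
  proof (rule integral_dominated_convergence[OF _ _ b(1)])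
    show "AE x in cell. (\<lambda>n. (cmod (s n x))\<^sup>2) \<longlonglongrightarrow> 0"
      using lim by eventually_elim (metis tendsto_norm_zero tendsto_null_power zero_less_numeral)
  qed (use m b(2) in auto)
  then show ?thesis by (simp add: norm_sq_def)
qed

text \<open>
  For bounded \<open>h\<close>, measurability provides continuous functions converging to \<open>h\<close> almost everywhere;
  after truncation and multiplication with the cutoff they still converge, dominated by a constant,
  and they are uniform limits of trigonometric polynomials. The general case follows by truncating
  \<open>g\<close> at level \<open>n\<close>.
\<close>

lemma trig_dense_L2:
  fixes g :: "real^'d \<Rightarrow> complex"
  assumes g: "g \<in> L2_Omega"
  shows "trig_dense g"
proof -
  have bounded: "trig_dense h" if h: "h \<in> L2_Omega" and hM: "\<And>x. cmod (h x) \<le> M" and M: "0 < M"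
    for h :: "real^'d \<Rightarrow> complex" and M
  proof (rule trig_dense_closed[OF h])
    fix e :: real assume e: "0 < e"
    have "h measurable_on Omega" using L2_OmegaD(1)[OF h] by (simp add: measurable_on_iff_borel_measurable)
    then obtain N F where N: "negligible N" and cF: "\<And>n. continuous_on UNIV (F n)"
      and lim: "\<And>x. x \<notin> N \<Longrightarrow> (\<lambda>n. F n x) \<longlonglongrightarrow> (if x \<in> Omega then h x else 0)"
      unfolding measurable_on_def by blast
    define \<psi> where "\<psi> n x = of_real (cutoff n x) * truncate M (F n x)" for n x
    have cont: "continuous_on UNIV (\<psi> n)" for n
      unfolding \<psi>_def
      by (intro continuous_intros cutoff continuous_on_compose2[OF truncate(1)[OF M, of UNIV] cF]) auto
    have dense: "trig_dense (\<psi> n)" for n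
      by (rule trig_dense_continuous[OF cont]) (auto simp: \<psi>_def cutoff(4))
    have "(\<lambda>n. norm_sq (\<lambda>x. h x - \<psi> n x)) \<longlonglongrightarrow> 0"
    proof (rule norm_sq_tendsto_0[where b = "\<lambda>_. (2 * M)\<^sup>2"])
      show "(\<lambda>x. h x - \<psi> n x) \<in> borel_measurable (cell)" for n
        by (intro L2_OmegaD(1) L2_Omega_diff h continuous_L2_Omega cont)
      show "integrable (lebesgue_on (Omega :: (real^'d) set)) (\<lambda>_. (2 * M)\<^sup>2)" by (rule integrable_const_Omega)
      show "(cmod (h x - \<psi> n x))\<^sup>2 \<le> (2 * M)\<^sup>2" for n x
      proof (rule power_mono)
        have "cmod (\<psi> n x) \<le> 1 * M"
          unfolding \<psi>_def norm_mult using cutoff(2,3)[of n x] truncate(2)[OF M] by (intro mult_mono) auto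
        then show "cmod (h x - \<psi> n x) \<le> 2 * M"
          using norm_triangle_ineq4[of "h x" "\<psi> n x"] hM[of x] by linarith
      qed simp
      show "AE x in cell. (\<lambda>n. h x - \<psi> n x) \<longlonglongrightarrow> 0"
      proof -
        have "AE x in lebesgue. x \<notin> N" using N by (simp add: AE_not_in negligible_iff_null_sets)
        then have "AE x in cell. x \<notin> N" by (simp add: AE_restrict_space_iff eventually_mono)
        moreover have "AE x in lebesgue_on (Omega :: (real^'d) set). x \<in> Omega" by (simp add: AE_restrict_space_iff)
        ultimately show ?thesis
        proof eventually_elim
          fix x assume x: "x \<notin> N" "x \<in> Omega"
          have "(\<lambda>n. F n x) \<longlonglongrightarrow> h x" using lim[OF x(1)] x by simp
          then have "(\<lambda>n. truncate M (F n x)) \<longlonglongrightarrow> truncate M (h x)"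
            using continuous_on_tendsto_compose[OF truncate(1)[OF M, of UNIV]] by simp
          then have tr: "(\<lambda>n. truncate M (F n x)) \<longlonglongrightarrow> h x" using truncate(4)[OF M hM] by simp
          have "(\<lambda>n. cutoff n x) \<longlonglongrightarrow> 1" by (rule tendsto_eventually[OF cutoff(5)[OF x(2)]])
          then have "(\<lambda>n. h x - \<psi> n x) \<longlonglongrightarrow> h x - of_real 1 * h x"
            unfolding \<psi>_def by (intro tendsto_intros tr)
          then show "(\<lambda>n. h x - \<psi> n x) \<longlonglongrightarrow> 0" by simp
        qed
      qed
    qed
    then have "\<forall>\<^sub>F n in sequentially. norm_sq (\<lambda>x. h x - \<psi> n x) < e"
      using e by (rule order_tendstoD)
    then obtain n where "norm_sq (\<lambda>x. h x - \<psi> n x) < e" by (auto simp: eventually_sequentially)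
    then show "\<exists>h'\<in>L2_Omega. trig_dense h' \<and> norm_sq (\<lambda>x. h x - h' x) < e"
      using dense continuous_L2_Omega[OF cont] by blast
  qed
  show ?thesis
  proof (rule trig_dense_closed[OF g])
    fix e :: real assume e: "0 < e"
    define h where "h n x = truncate (real (Suc n)) (g x)" for n x
    have hm: "h n \<in> borel_measurable (cell)" for n
      unfolding h_def using L2_OmegaD(1)[OF g]
      by (intro measurable_compose[OF _ borel_measurable_continuous_onI[OF truncate(1)]]) auto
    have hg: "cmod (h n x) \<le> cmod (g x)" for n x unfolding h_def by (rule truncate(3)) simp
    have hL: "h n \<in> L2_Omega" for n
      by (rule L2_Omega_dominated[OF hm L2_OmegaD(2)[OF g]]) (intro power_mono hg norm_ge_zero)
    have hd: "trig_dense (h n)" for n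
      by (rule bounded[OF hL, of n "real (Suc n)"]) (unfold h_def, rule truncate(2), auto)
    have "(\<lambda>n. norm_sq (\<lambda>x. g x - h n x)) \<longlonglongrightarrow> 0"
    proof (rule norm_sq_tendsto_0[where b = "\<lambda>x. 4 * (cmod (g x))\<^sup>2"])
      show "(\<lambda>x. g x - h n x) \<in> borel_measurable (cell)" for n
        by (intro L2_OmegaD(1) L2_Omega_diff g hL)
      show "integrable (cell) (\<lambda>x. 4 * (cmod (g x))\<^sup>2)" using L2_OmegaD(2)[OF g] by simp
      show "(cmod (g x - h n x))\<^sup>2 \<le> 4 * (cmod (g x))\<^sup>2" for n x
      proof -
        have "cmod (g x - h n x) \<le> 2 * cmod (g x)" using norm_triangle_ineq4[of "g x" "h n x"] hg[of n x] by linarith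
        then have "(cmod (g x - h n x))\<^sup>2 \<le> (2 * cmod (g x))\<^sup>2" by (rule power_mono) simp
        then show ?thesis by simp
      qed
      show "AE x in cell. (\<lambda>n. g x - h n x) \<longlonglongrightarrow> 0"
      proof (rule AE_I2)
        fix x
        obtain N where N: "cmod (g x) < real N" using reals_Archimedean2 by blast
        have "\<forall>\<^sub>F n in sequentially. g x - h n x = 0"
          using eventually_ge_at_top[of N]
        proof eventually_elim
          case (elim n)
          then have "cmod (g x) \<le> real (Suc n)" using N by simp
          then show ?case unfolding h_def by (subst truncate(4)) auto
        qed
        then show "(\<lambda>n. g x - h n x) \<longlonglongrightarrow> 0" by (rule tendsto_eventually)
      qed
    qed
    then have "\<forall>\<^sub>F n in sequentially. norm_sq (\<lambda>x. g x - h n x) < e"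
      using e by (rule order_tendstoD)
    then obtain n where "norm_sq (\<lambda>x. g x - h n x) < e" by (auto simp: eventually_sequentially)
    then show "\<exists>h'\<in>L2_Omega. trig_dense h' \<and> norm_sq (\<lambda>x. g x - h' x) < e"
      using hd hL by blast
  qed
qed

lemma Parseval:
  assumes g: "g \<in> L2_Omega"
  shows "((\<lambda>k. (cmod (fcoeff g k))\<^sup>2) has_sum norm_sq g) UNIV"
  unfolding has_sum_def
proof (rule tendstoI)
  fix e :: real assume "0 < e"
  then obtain T where T: "T \<in> trig" "norm_sq (\<lambda>x. g x - T x) < e"
    using trig_dense_L2[OF g] unfolding trig_dense_def by blast
  obtain F c where F: "finite F" "T = (\<lambda>x. \<Sum>k\<in>F. c k * phi k x)" using trig_eq_sum[OF T(1)] by blast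
  have F1: "norm_sq g - (\<Sum>k\<in>F. (cmod (fcoeff g k))\<^sup>2) < e"
    using norm_sq_diff_trig[OF g F(1), of c] T(2) sum_nonneg[of F "\<lambda>k. (cmod (fcoeff g k - c k))\<^sup>2"]
    unfolding F(2) by simp
  show "\<forall>\<^sub>F X in finite_subsets_at_top UNIV. dist (\<Sum>k\<in>X. (cmod (fcoeff g k))\<^sup>2) (norm_sq g) < e"
    unfolding eventually_finite_subsets_at_top
  proof (intro exI conjI allI impI)
    fix X assume X: "finite X \<and> F \<subseteq> X \<and> X \<subseteq> UNIV"
    have "(\<Sum>k\<in>F. (cmod (fcoeff g k))\<^sup>2) \<le> (\<Sum>k\<in>X. (cmod (fcoeff g k))\<^sup>2)"
      using X by (intro sum_mono2) auto
    then show "dist (\<Sum>k\<in>X. (cmod (fcoeff g k))\<^sup>2) (norm_sq g) < e"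
      using F1 Bessel[OF g, of X] X by (auto simp: dist_real_def)
  qed (use F in auto)
qed

lemma fcoeff_eq_imp_AE_eq:
  assumes g: "g \<in> L2_Omega" and h: "h \<in> L2_Omega" and eq: "\<And>k. fcoeff g k = fcoeff h k"
  shows "AE x in cell. g x = h x"
proof -
  note d = L2_Omega_diff[OF g h]
  have "((\<lambda>k. (cmod (fcoeff (\<lambda>x. g x - h x) k))\<^sup>2) has_sum 0) UNIV"
    by (rule has_sum_0) (simp add: fcoeff_diff[OF g h] eq)
  then have "norm_sq (\<lambda>x. g x - h x) = 0" using Parseval[OF d] has_sum_unique by blast
  from norm_sq_eq_0_AE[OF d this] show ?thesis by simp
qed

section \<open>Periodic Sobolev functions\<close>

lemma L2p_iff: "v \<in> L2p \<longleftrightarrow> periodic v \<and> v \<in> L2_Omega"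
  by (auto simp: L2p_def L2_Omega_def)

lemma H1pD:
  assumes "v \<in> H1p"
  shows "v \<in> L2_Omega" "wderiv j v \<in> L2_Omega" "weak_partial j v (wderiv j v)"
proof -
  show "v \<in> L2_Omega" using assms by (simp add: H1p_def L2p_iff)
  have "\<exists>g. g \<in> L2p \<and> weak_partial j v g" using assms by (auto simp: H1p_def)
  from someI_ex[OF this] show "wderiv j v \<in> L2_Omega" "weak_partial j v (wderiv j v)"
    by (auto simp: wderiv_def L2p_iff)
qed

lemma fcoeff_weak_partial:
  assumes "weak_partial j v g"
  shows "fcoeff g k = \<i> * of_int (k $ j) * fcoeff v k"
proof -
  have "(LINT x|cell. v x * (\<i> * of_int ((- k) $ j) * phi (- k) x)) =
      - (LINT x|cell. g x * phi (- k) x)"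
    using assms phi_C1p[of "- k"] unfolding weak_partial_def partial_deriv_phi[symmetric] by blast
  moreover have "(LINT x|cell. v x * (\<i> * of_int ((- k) $ j) * phi (- k) x)) =
      (LINT x|cell. (- (\<i> * of_int (k $ j))) * (v x * phi (- k) x))"
    by (intro Bochner_Integration.integral_cong) auto
  ultimately show ?thesis by (simp add: fcoeff_def cnj_phi)
qed

lemma fcoeff_wderiv: "v \<in> H1p \<Longrightarrow> fcoeff (wderiv j v) k = \<i> * of_int (k $ j) * fcoeff v k"
  by (rule fcoeff_weak_partial[OF H1pD(3)])

text \<open>
  \<open>wderiv\<close> is an arbitrary choice among the weak derivatives, but all of them have the same Fourier
  coefficients, hence agree almost everywhere. The sesquilinearity of the form rests on this.
\<close>

lemma weak_partial_AE_unique: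
  assumes "v \<in> H1p" "g \<in> L2_Omega" "\<And>k. fcoeff g k = \<i> * of_int (k $ j) * fcoeff v k"
  shows "AE x in cell. wderiv j v x = g x"
  by (rule fcoeff_eq_imp_AE_eq[OF H1pD(2)[OF assms(1)] assms(2)]) (simp add: fcoeff_wderiv assms)

lemma H1pI:
  assumes "periodic v" "v \<in> L2_Omega"
    "\<And>j. \<exists>g. periodic g \<and> g \<in> L2_Omega \<and> weak_partial j v g"
  shows "v \<in> H1p"
  using assms unfolding H1p_def L2p_iff Bex_def by blast

lemma H1p_periodic: "v \<in> H1p \<Longrightarrow> periodic v" "v \<in> H1p \<Longrightarrow> periodic (wderiv j v)"
proof -
  assume v: "v \<in> H1p"
  then show "periodic v" by (simp add: H1p_def L2p_iff)
  have "\<exists>g. g \<in> L2p \<and> weak_partial j v g" using v by (auto simp: H1p_def)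
  from someI_ex[OF this] show "periodic (wderiv j v)" by (simp add: wderiv_def L2p_iff)
qed

lemma integrable_mult_continuous:
  assumes "g \<in> L2_Omega" "continuous_on UNIV \<psi>"
  shows "integrable (cell) (\<lambda>x. g x * \<psi> x)"
  using integrable_product[OF assms(1) continuous_L2_Omega[of "\<lambda>x. cnj (\<psi> x)"]] assms(2)
  by (simp add: continuous_on_cnj)

lemma phi_H1p: "phi k \<in> H1p"
proof (rule H1pI)
  show "\<exists>g. periodic g \<and> g \<in> L2_Omega \<and> weak_partial j (phi k) g" for j
    using weak_partial_phi[of j k] periodic_phi[of k]
    by (intro exI[of _ "\<lambda>x. \<i> * of_int (k $ j) * phi k x"])
       (auto simp: periodic_def intro!: L2_Omega_cmult phi_L2_Omega)
qed (auto intro: periodic_phi phi_L2_Omega)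

lemma H1p_add:
  assumes v: "v \<in> H1p" and w: "w \<in> H1p"
  shows "(\<lambda>x. v x + w x) \<in> H1p"
proof (rule H1pI)
  show "periodic (\<lambda>x. v x + w x)" using H1p_periodic(1)[OF v] H1p_periodic(1)[OF w] by (simp add: periodic_def)
  show "(\<lambda>x. v x + w x) \<in> L2_Omega" by (intro L2_Omega_add H1pD v w)
  show "\<exists>g. periodic g \<and> g \<in> L2_Omega \<and> weak_partial j (\<lambda>x. v x + w x) g" for j
  proof (intro exI conjI)
    show "periodic (\<lambda>x. wderiv j v x + wderiv j w x)"
      using H1p_periodic(2)[OF v, of j] H1p_periodic(2)[OF w, of j] by (simp add: periodic_def)
    show "(\<lambda>x. wderiv j v x + wderiv j w x) \<in> L2_Omega" by (intro L2_Omega_add H1pD v w)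
    show "weak_partial j (\<lambda>x. v x + w x) (\<lambda>x. wderiv j v x + wderiv j w x)"
      using H1pD(3)[OF v, of j] H1pD(3)[OF w, of j]
      by (simp add: weak_partial_def distrib_right Bochner_Integration.integral_add
          integrable_mult_continuous[OF H1pD(1)[OF v] C1pD(3)] integrable_mult_continuous[OF H1pD(1)[OF w] C1pD(3)]
          integrable_mult_continuous[OF H1pD(2)[OF v] C1pD(2)] integrable_mult_continuous[OF H1pD(2)[OF w] C1pD(2)])
  qed
qed

lemma H1p_cmult:
  assumes v: "v \<in> H1p"
  shows "(\<lambda>x. c * v x) \<in> H1p"
proof (rule H1pI)
  show "periodic (\<lambda>x. c * v x)" using H1p_periodic(1)[OF v] by (simp add: periodic_def)
  show "(\<lambda>x. c * v x) \<in> L2_Omega" by (intro L2_Omega_cmult H1pD v)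
  show "\<exists>g. periodic g \<and> g \<in> L2_Omega \<and> weak_partial j (\<lambda>x. c * v x) g" for j
  proof (intro exI conjI)
    show "periodic (\<lambda>x. c * wderiv j v x)" using H1p_periodic(2)[OF v, of j] by (simp add: periodic_def)
    show "(\<lambda>x. c * wderiv j v x) \<in> L2_Omega" by (intro L2_Omega_cmult H1pD v)
    show "weak_partial j (\<lambda>x. c * v x) (\<lambda>x. c * wderiv j v x)"
      using H1pD(3)[OF v, of j] by (simp add: weak_partial_def mult.assoc)
  qed
qed

lemma trig_H1p: "(\<lambda>x. \<Sum>k\<in>F. c k * phi k x) \<in> H1p"
proof (induction F rule: infinite_finite_induct)
  case (insert k F)
  then show ?case using H1p_add[OF H1p_cmult[OF phi_H1p] insert.IH] by simp
qed (use H1p_cmult[OF phi_H1p, of 0] in simp_all)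

lemma cwt_sq: "(cwt k)\<^sup>2 = 1 + (knorm k)\<^sup>2"
  by (simp add: cwt_def)

lemma cwt_pos: "0 < cwt k"
  unfolding cwt_def by (intro real_sqrt_gt_zero) (simp add: add_pos_nonneg)

lemma knorm_sq: "(knorm k)\<^sup>2 = (\<Sum>j\<in>UNIV. (real_of_int (k $ j))\<^sup>2)"
  by (simp add: knorm_def norm_vec_def L2_set_def sum_nonneg)

lemma H1_norm_eq_ell2_norm: "H1_norm v = ell2_norm (\<lambda>k. cwt k * fcoeff v k)"
  unfolding H1_norm_def ell2_norm_def by (simp add: norm_mult power_mult_distrib cwt_sq)

lemma Hm1_norm_eq_ell2_norm: "Hm1_norm f = ell2_norm (\<lambda>k. dual_fcoeff f k / cwt k)"
proof -
  have "inverse (1 + (knorm k)\<^sup>2) * (cmod z)\<^sup>2 = (cmod (z / cwt k))\<^sup>2" for k :: "int^'a" and z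
    unfolding norm_divide power_divide norm_of_real power2_abs cwt_sq by (simp add: field_simps)
  then show ?thesis unfolding Hm1_norm_def ell2_norm_def by (simp only:)
qed

text \<open>
  Parseval's identity for the function and for each of its weak derivatives, whose coefficients are
  \<open>\<i> k\<^sub>j\<close> times those of the function. In particular the series that defines \<open>H1_norm\<close> converges on \<open>H1p\<close>.
\<close>

lemma H1_norm_has_sum:
  assumes v: "v \<in> H1p"
  shows "((\<lambda>k. (cmod (cwt k * fcoeff v k))\<^sup>2) has_sum (norm_sq v + (\<Sum>j\<in>UNIV. norm_sq (wderiv j v)))) UNIV"
proof -
  have "((\<lambda>k. (cmod (fcoeff v k))\<^sup>2 + (\<Sum>j\<in>UNIV. (cmod (fcoeff (wderiv j v) k))\<^sup>2)) has_sum
      (norm_sq v + (\<Sum>j\<in>UNIV. norm_sq (wderiv j v)))) UNIV"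
    by (intro has_sum_add has_sum_finite_sum Parseval H1pD v)
  moreover have "(cmod (fcoeff v k))\<^sup>2 + (\<Sum>j\<in>UNIV. (cmod (fcoeff (wderiv j v) k))\<^sup>2) =
      (cmod (cwt k * fcoeff v k))\<^sup>2" for k
    by (simp add: fcoeff_wderiv[OF v] norm_mult power_mult_distrib cwt_sq knorm_sq distrib_right sum_distrib_right)
  ultimately show ?thesis by simp
qed

lemma H1p_ell2: "v \<in> H1p \<Longrightarrow> (\<lambda>k. cwt k * fcoeff v k) \<in> ell2"
  unfolding ell2_def using H1_norm_has_sum has_sum_imp_summable by blast

lemma H1_norm_nonneg: "0 \<le> H1_norm v"
  unfolding H1_norm_eq_ell2_norm by (rule ell2_norm_nonneg)

lemma H1_norm_sq:
  assumes v: "v \<in> H1p"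
  shows "(H1_norm v)\<^sup>2 = norm_sq v + (\<Sum>j\<in>UNIV. norm_sq (wderiv j v))"
  unfolding H1_norm_eq_ell2_norm ell2_norm_def infsumI[OF H1_norm_has_sum[OF v]]
  by (simp add: norm_sq_nonneg sum_nonneg)

lemma norm_le_H1_norm:
  assumes v: "v \<in> H1p"
  shows "sqrt (norm_sq v) \<le> H1_norm v" "sqrt (norm_sq (wderiv j v)) \<le> H1_norm v"
proof -
  have s: "0 \<le> (\<Sum>j\<in>UNIV. norm_sq (wderiv j v))" by (intro sum_nonneg norm_sq_nonneg)
  have "norm_sq (wderiv j v) \<le> (\<Sum>j\<in>UNIV. norm_sq (wderiv j v))"
    by (rule member_le_sum) (auto intro: norm_sq_nonneg)
  then have "norm_sq v \<le> (H1_norm v)\<^sup>2" "norm_sq (wderiv j v) \<le> (H1_norm v)\<^sup>2"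
    using H1_norm_sq[OF v] s norm_sq_nonneg[of v] by linarith+
  then show "sqrt (norm_sq v) \<le> H1_norm v" "sqrt (norm_sq (wderiv j v)) \<le> H1_norm v"
    using H1_norm_nonneg real_le_lsqrt by auto
qed

section \<open>The elliptic form\<close>

lemma wderiv_add:
  assumes v: "v \<in> H1p" and w: "w \<in> H1p"
  shows "AE x in cell. wderiv j (\<lambda>x. v x + w x) x = wderiv j v x + wderiv j w x"
  by (intro weak_partial_AE_unique H1p_add L2_Omega_add H1pD v w)
     (simp add: fcoeff_add H1pD v w fcoeff_wderiv distrib_left)

lemma wderiv_cmult:
  assumes v: "v \<in> H1p"
  shows "AE x in cell. wderiv j (\<lambda>x. c * v x) x = c * wderiv j v x"
  by (intro weak_partial_AE_unique H1p_cmult L2_Omega_cmult H1pD v)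
     (simp add: fcoeff_cmult fcoeff_wderiv v)

definition weighted_ip :: "(real^'d \<Rightarrow> real) \<Rightarrow> (real^'d \<Rightarrow> complex) \<Rightarrow> (real^'d \<Rightarrow> complex) \<Rightarrow> complex" where
  "weighted_ip \<nu> g h = (LINT x|cell. complex_of_real (\<nu> x) * (g x * cnj (h x)))"

lemma admissible_measurable:
  fixes \<nu> :: "real^'d \<Rightarrow> real"
  assumes "admissible_coeff \<nu>"
  shows "(\<lambda>x. complex_of_real (\<nu> x)) \<in> borel_measurable (cell)"
  using assms by (intro L2_OmegaD continuous_L2_Omega continuous_on_of_real) (simp add: admissible_coeff_def)

lemma admissible_bounds:
  assumes "admissible_coeff \<nu>"
  obtains m M where "0 < m" "\<And>x. m \<le> \<nu> x" "\<And>x. cmod (complex_of_real (\<nu> x)) \<le> M" "0 \<le> M"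
proof -
  obtain m M where m: "0 < m" "\<And>x. m \<le> \<nu> x" "\<And>x. \<nu> x \<le> M"
    using assms by (auto simp: admissible_coeff_def)
  then have "cmod (complex_of_real (\<nu> x)) \<le> M" for x
    by (simp add: abs_le_iff) (smt (verit))
  moreover have "0 \<le> M" using m(1) m(2)[of 0] m(3)[of 0] by linarith
  ultimately show ?thesis using that m by blast
qed

lemma weighted_ip_integrable:
  assumes "admissible_coeff \<nu>" "g \<in> L2_Omega" "h \<in> L2_Omega"
  shows "integrable (cell) (\<lambda>x. complex_of_real (\<nu> x) * (g x * cnj (h x)))"
  using admissible_bounds[OF assms(1)] integrable_weighted_product[OF admissible_measurable[OF assms(1)] _ assms(2,3)]
  by metis

lemma weighted_ip_linear:
  assumes \<nu>: "admissible_coeff \<nu>" and g: "g \<in> L2_Omega" "g' \<in> L2_Omega" and h: "h \<in> L2_Omega"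
  shows "weighted_ip \<nu> (\<lambda>x. g x + g' x) h = weighted_ip \<nu> g h + weighted_ip \<nu> g' h"
    "weighted_ip \<nu> (\<lambda>x. c * g x) h = c * weighted_ip \<nu> g h"
proof -
  have "weighted_ip \<nu> (\<lambda>x. g x + g' x) h = (LINT x|cell.
      complex_of_real (\<nu> x) * (g x * cnj (h x)) + complex_of_real (\<nu> x) * (g' x * cnj (h x)))"
    by (simp add: weighted_ip_def algebra_simps)
  also have "\<dots> = weighted_ip \<nu> g h + weighted_ip \<nu> g' h"
    unfolding weighted_ip_def by (intro Bochner_Integration.integral_add weighted_ip_integrable assms)
  finally show "weighted_ip \<nu> (\<lambda>x. g x + g' x) h = weighted_ip \<nu> g h + weighted_ip \<nu> g' h" .
  show "weighted_ip \<nu> (\<lambda>x. c * g x) h = c * weighted_ip \<nu> g h"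
    by (simp add: weighted_ip_def mult.assoc mult.left_commute[of _ c])
qed

lemma weighted_ip_cnj: "weighted_ip \<nu> h g = cnj (weighted_ip \<nu> g h)"
  unfolding weighted_ip_def by (simp add: Bochner_Integration.integral_cnj[symmetric] mult_ac del: Bochner_Integration.integral_cnj)

lemma weighted_ip_AE:
  assumes \<nu>: "admissible_coeff \<nu>" and g: "g \<in> L2_Omega" "g' \<in> L2_Omega" and h: "h \<in> L2_Omega"
    and eq: "AE x in cell. g x = g' x"
  shows "weighted_ip \<nu> g h = weighted_ip \<nu> g' h"
  unfolding weighted_ip_def
  by (intro integral_cong_AE borel_measurable_integrable weighted_ip_integrable assms)
     (use eq in eventually_elim, simp)

lemma weighted_ip_coercive:
  assumes \<nu>: "admissible_coeff \<nu>" and g: "g \<in> L2_Omega" and m: "\<And>x. m \<le> \<nu> x"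
  shows "m * norm_sq g \<le> Re (weighted_ip \<nu> g g)"
proof -
  note i = weighted_ip_integrable[OF \<nu> g g]
  have "Re (weighted_ip \<nu> g g) = (LINT x|cell. Re (complex_of_real (\<nu> x) * (g x * cnj (g x))))"
    unfolding weighted_ip_def by (rule integral_Re[OF i, symmetric])
  moreover have "m * norm_sq g = (LINT x|cell. m * (cmod (g x))\<^sup>2)"
    by (simp add: norm_sq_def)
  moreover have "(LINT x|cell. m * (cmod (g x))\<^sup>2) \<le>
      (LINT x|cell. Re (complex_of_real (\<nu> x) * (g x * cnj (g x))))"
  proof (rule integral_mono)
    show "integrable (cell) (\<lambda>x. m * (cmod (g x))\<^sup>2)" using L2_OmegaD(2)[OF g] by simp
    show "integrable (cell) (\<lambda>x. Re (complex_of_real (\<nu> x) * (g x * cnj (g x))))"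
      by (rule integrable_Re[OF i])
    show "m * (cmod (g x))\<^sup>2 \<le> Re (complex_of_real (\<nu> x) * (g x * cnj (g x)))" for x
      unfolding complex_norm_square[symmetric] of_real_mult[symmetric] Re_complex_of_real
      by (intro mult_right_mono m) simp
  qed
  ultimately show ?thesis by linarith
qed

text \<open>
  Fixes the two coefficients, so that the form can be treated as one bounded coercive sesquilinear
  form on \<open>H1p\<close>.
\<close>

locale elliptic_form =
  fixes \<nu> \<sigma> :: "real^'d \<Rightarrow> real"
  assumes \<nu>: "admissible_coeff \<nu>" and \<sigma>: "admissible_coeff \<sigma>"
begin

lemma aform_eq:
  assumes "u \<in> H1p" "v \<in> H1p"
  shows "aform \<nu> \<sigma> u v = (\<Sum>j\<in>UNIV. weighted_ip \<nu> (wderiv j u) (wderiv j v)) + weighted_ip \<sigma> u v"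
proof -
  have "(LINT x|cell. complex_of_real (\<nu> x) * (\<Sum>j\<in>UNIV. wderiv j u x * cnj (wderiv j v x)))
      = (\<Sum>j\<in>UNIV. weighted_ip \<nu> (wderiv j u) (wderiv j v))"
    unfolding weighted_ip_def sum_distrib_left
    by (intro Bochner_Integration.integral_sum weighted_ip_integrable \<nu> H1pD assms)
  then show ?thesis by (simp add: aform_def weighted_ip_def mult.assoc)
qed

lemma aform_cnj: "u \<in> H1p \<Longrightarrow> v \<in> H1p \<Longrightarrow> aform \<nu> \<sigma> v u = cnj (aform \<nu> \<sigma> u v)"
  by (simp add: aform_eq weighted_ip_cnj[of _ v u] weighted_ip_cnj[of _ "wderiv _ v"])

lemma aform_add_left:
  assumes u: "u \<in> H1p" and u': "u' \<in> H1p" and v: "v \<in> H1p"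
  shows "aform \<nu> \<sigma> (\<lambda>x. u x + u' x) v = aform \<nu> \<sigma> u v + aform \<nu> \<sigma> u' v"
proof -
  have "weighted_ip \<nu> (wderiv j (\<lambda>x. u x + u' x)) (wderiv j v) =
      weighted_ip \<nu> (\<lambda>x. wderiv j u x + wderiv j u' x) (wderiv j v)" for j
    by (intro weighted_ip_AE wderiv_add L2_Omega_add H1pD H1p_add \<nu> u u' v)
  then show ?thesis
    by (simp add: aform_eq H1p_add assms weighted_ip_linear(1) \<nu> \<sigma> H1pD sum.distrib)
qed

lemma aform_cmult_left:
  assumes u: "u \<in> H1p" and v: "v \<in> H1p"
  shows "aform \<nu> \<sigma> (\<lambda>x. c * u x) v = c * aform \<nu> \<sigma> u v"
proof -
  have "weighted_ip \<nu> (wderiv j (\<lambda>x. c * u x)) (wderiv j v) =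
      weighted_ip \<nu> (\<lambda>x. c * wderiv j u x) (wderiv j v)" for j
    by (intro weighted_ip_AE wderiv_cmult L2_Omega_cmult H1pD H1p_cmult \<nu> u v)
  then show ?thesis
    by (simp add: aform_eq H1p_cmult assms weighted_ip_linear(2)[where g' = u] weighted_ip_linear(2)[where g' = "wderiv _ u"]
        \<nu> \<sigma> H1pD sum_distrib_left distrib_left)
qed

lemma aform_add_right:
  assumes u: "u \<in> H1p" and v: "v \<in> H1p" and v': "v' \<in> H1p"
  shows "aform \<nu> \<sigma> u (\<lambda>x. v x + v' x) = aform \<nu> \<sigma> u v + aform \<nu> \<sigma> u v'"
  using aform_add_left[OF v v' u] aform_cnj[OF H1p_add[OF v v'] u] aform_cnj[OF v u] aform_cnj[OF v' u] by simp

lemma aform_cmult_right: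
  assumes u: "u \<in> H1p" and v: "v \<in> H1p"
  shows "aform \<nu> \<sigma> u (\<lambda>x. c * v x) = cnj c * aform \<nu> \<sigma> u v"
  using aform_cmult_left[OF v u] aform_cnj[OF H1p_cmult[OF v] u] aform_cnj[OF v u] by simp

lemma aform_trig_left:
  assumes v: "v \<in> H1p"
  shows "aform \<nu> \<sigma> (\<lambda>x. \<Sum>k\<in>F. c k * phi k x) v = (\<Sum>k\<in>F. c k * aform \<nu> \<sigma> (phi k) v)"
proof (induction F rule: infinite_finite_induct)
  case (insert k F)
  then show ?case
    using aform_add_left[OF H1p_cmult[OF phi_H1p] trig_H1p v, of "c k" k c F] aform_cmult_left[OF phi_H1p v]
    by simp
qed (use aform_cmult_left[OF v v, of 0] in simp_all)

lemma aform_trig_right: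
  assumes u: "u \<in> H1p"
  shows "aform \<nu> \<sigma> u (\<lambda>x. \<Sum>k\<in>F. c k * phi k x) = (\<Sum>k\<in>F. cnj (c k) * aform \<nu> \<sigma> u (phi k))"
  using aform_trig_left[OF u, of c F] aform_cnj[OF trig_H1p[of c F] u] aform_cnj[OF phi_H1p u] by simp

lemma aform_bounded: "\<exists>\<beta>\<ge>0. \<forall>u\<in>H1p. \<forall>v\<in>H1p. cmod (aform \<nu> \<sigma> u v) \<le> \<beta> * (H1_norm u * H1_norm v)"
proof -
  obtain M where M: "0 \<le> M" "\<And>x. cmod (complex_of_real (\<nu> x)) \<le> M" using admissible_bounds[OF \<nu>] by metis
  obtain N where N: "0 \<le> N" "\<And>x. cmod (complex_of_real (\<sigma> x)) \<le> N" using admissible_bounds[OF \<sigma>] by metis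
  have "cmod (aform \<nu> \<sigma> u v) \<le> (real CARD('d) * M + N) * (H1_norm u * H1_norm v)" if u: "u \<in> H1p" and v: "v \<in> H1p" for u v
  proof -
    have prod: "sqrt (norm_sq (wderiv j u)) * sqrt (norm_sq (wderiv j v)) \<le> H1_norm u * H1_norm v"
      "sqrt (norm_sq u) * sqrt (norm_sq v) \<le> H1_norm u * H1_norm v" for j
      by (intro mult_mono norm_le_H1_norm u v H1_norm_nonneg real_sqrt_ge_zero norm_sq_nonneg)+
    have 1: "cmod (weighted_ip \<nu> (wderiv j u) (wderiv j v)) \<le> M * (H1_norm u * H1_norm v)" for j
      unfolding weighted_ip_def
      by (rule order_trans[OF weighted_Cauchy_Schwarz[OF admissible_measurable[OF \<nu>] M(2) H1pD(2)[OF u] H1pD(2)[OF v]]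
          mult_left_mono[OF prod(1) M(1)]])
    have 2: "cmod (weighted_ip \<sigma> u v) \<le> N * (H1_norm u * H1_norm v)"
      unfolding weighted_ip_def
      by (rule order_trans[OF weighted_Cauchy_Schwarz[OF admissible_measurable[OF \<sigma>] N(2) H1pD(1)[OF u] H1pD(1)[OF v]]
          mult_left_mono[OF prod(2) N(1)]])
    have "cmod (aform \<nu> \<sigma> u v) \<le> (\<Sum>j\<in>UNIV. cmod (weighted_ip \<nu> (wderiv j u) (wderiv j v))) + cmod (weighted_ip \<sigma> u v)"
      unfolding aform_eq[OF u v] by (intro order_trans[OF norm_triangle_ineq] add_right_mono norm_sum)
    also have "\<dots> \<le> (\<Sum>j\<in>(UNIV :: 'd set). M * (H1_norm u * H1_norm v)) + N * (H1_norm u * H1_norm v)"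
      by (intro add_mono sum_mono 1 2)
    finally show ?thesis by (simp add: algebra_simps)
  qed
  then show ?thesis using M N by (intro exI[of _ "real CARD('d) * M + N"]) auto
qed

lemma aform_coercive: "\<exists>\<alpha>>0. \<forall>v\<in>H1p. \<alpha> * (H1_norm v)\<^sup>2 \<le> Re (aform \<nu> \<sigma> v v)"
proof -
  obtain m where m: "0 < m" "\<And>x. m \<le> \<nu> x" using admissible_bounds[OF \<nu>] by metis
  obtain n where n: "0 < n" "\<And>x. n \<le> \<sigma> x" using admissible_bounds[OF \<sigma>] by metis
  have "min m n * (H1_norm v)\<^sup>2 \<le> Re (aform \<nu> \<sigma> v v)" if v: "v \<in> H1p" for v
  proof -
    have "min m n * (H1_norm v)\<^sup>2 = (\<Sum>j\<in>UNIV. min m n * norm_sq (wderiv j v)) + min m n * norm_sq v"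
      by (simp add: H1_norm_sq[OF v] sum_distrib_left distrib_left)
    also have "\<dots> \<le> (\<Sum>j\<in>UNIV. m * norm_sq (wderiv j v)) + n * norm_sq v"
      by (intro add_mono sum_mono mult_right_mono norm_sq_nonneg) auto
    also have "\<dots> \<le> (\<Sum>j\<in>UNIV. Re (weighted_ip \<nu> (wderiv j v) (wderiv j v))) + Re (weighted_ip \<sigma> v v)"
      by (intro add_mono sum_mono weighted_ip_coercive \<nu> \<sigma> m n H1pD v)
    finally show ?thesis by (simp add: aform_eq v)
  qed
  then show ?thesis using m n by (intro exI[of _ "min m n"]) auto
qed

lemma fcoeff_remainder:
  assumes v: "v \<in> L2_Omega" and F: "finite F"
  shows "fcoeff (\<lambda>x. v x - proj_H1 F v x) k = (if k \<in> F then 0 else fcoeff v k)"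
  unfolding proj_H1_def by (simp add: fcoeff_diff[OF v trig_L2_Omega] fcoeff_trig[OF F])

lemma H1_norm_remainder:
  assumes "v \<in> L2_Omega" "finite F"
  shows "H1_norm (\<lambda>x. v x - proj_H1 F v x) = ell2_norm (drop_on F (\<lambda>k. cwt k * fcoeff v k))"
  unfolding H1_norm_eq_ell2_norm fcoeff_remainder[OF assms] by (rule arg_cong[where f = ell2_norm]) auto

lemma remainder_tendsto_0:
  assumes v: "v \<in> H1p"
  shows "((\<lambda>F. H1_norm (\<lambda>x. v x - proj_H1 F v x)) \<longlongrightarrow> 0) (finite_subsets_at_top UNIV)"
proof -
  define a where "a k = (cmod (cwt k * fcoeff v k))\<^sup>2" for k
  obtain S where S: "(a has_sum S) UNIV" unfolding a_def using H1_norm_has_sum[OF v] by blast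
  have eq: "H1_norm (\<lambda>x. v x - proj_H1 F v x) = sqrt (S - sum a F)" if F: "finite F" for F
  proof -
    have "((\<lambda>k. if k \<in> F then a k else 0) has_sum (sum a F)) UNIV"
      by (rule has_sum_finite_neutralI[OF F]) (auto intro: sum.cong)
    from has_sum_subtract[OF S this]
    have "((\<lambda>k. (cmod (if k \<in> F then 0 else cwt k * fcoeff v k))\<^sup>2) has_sum (S - sum a F)) UNIV"
      by (rule has_sum_cong[THEN iffD1, rotated]) (simp add: a_def)
    then show ?thesis unfolding H1_norm_remainder[OF H1pD(1)[OF v] F] ell2_norm_def by (simp add: infsumI)
  qed
  have "((\<lambda>F. sqrt (S - sum a F)) \<longlongrightarrow> sqrt (S - S)) (finite_subsets_at_top UNIV)"
    using S by (intro tendsto_intros) (simp add: has_sum_def)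
  then have "((\<lambda>F. sqrt (S - sum a F)) \<longlongrightarrow> 0) (finite_subsets_at_top UNIV)" by simp
  then show ?thesis
    by (rule tendsto_cong[THEN iffD1, rotated]) (simp add: eventually_finite_subsets_at_top_weakI eq)
qed

text \<open>
  By boundedness of the form, the error of a partial sum is controlled by the norm of the Fourier
  remainder of \<open>u\<close>, which tends to 0.
\<close>

lemma aform_expansion:
  assumes u: "u \<in> H1p" and v: "v \<in> H1p"
  shows "((\<lambda>k. fcoeff u k * aform \<nu> \<sigma> (phi k) v) has_sum aform \<nu> \<sigma> u v) UNIV"
proof -
  obtain \<beta> where \<beta>: "0 \<le> \<beta>" "\<And>u v. u \<in> H1p \<Longrightarrow> v \<in> H1p \<Longrightarrow> cmod (aform \<nu> \<sigma> u v) \<le> \<beta> * (H1_norm u * H1_norm v)"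
    using aform_bounded by blast
  have rem: "aform \<nu> \<sigma> u v - (\<Sum>k\<in>F. fcoeff u k * aform \<nu> \<sigma> (phi k) v) = aform \<nu> \<sigma> (\<lambda>x. u x - proj_H1 F u x) v"
    "(\<lambda>x. u x - proj_H1 F u x) \<in> H1p" for F
  proof -
    have eq: "(\<lambda>x. u x - proj_H1 F u x) = (\<lambda>x. u x + (\<Sum>k\<in>F. (- fcoeff u k) * phi k x))"
      by (simp add: proj_H1_def sum_negf)
    show "aform \<nu> \<sigma> u v - (\<Sum>k\<in>F. fcoeff u k * aform \<nu> \<sigma> (phi k) v) = aform \<nu> \<sigma> (\<lambda>x. u x - proj_H1 F u x) v"
      unfolding eq aform_add_left[OF u trig_H1p v] aform_trig_left[OF v] by (simp add: sum_negf)
    show "(\<lambda>x. u x - proj_H1 F u x) \<in> H1p" unfolding eq by (rule H1p_add[OF u trig_H1p])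
  qed
  have "((\<lambda>F. aform \<nu> \<sigma> u v - (\<Sum>k\<in>F. fcoeff u k * aform \<nu> \<sigma> (phi k) v)) \<longlongrightarrow> 0) (finite_subsets_at_top UNIV)"
  proof (rule Lim_null_comparison)
    show "\<forall>\<^sub>F F in finite_subsets_at_top UNIV. norm (aform \<nu> \<sigma> u v - (\<Sum>k\<in>F. fcoeff u k * aform \<nu> \<sigma> (phi k) v))
        \<le> \<beta> * (H1_norm (\<lambda>x. u x - proj_H1 F u x) * H1_norm v)"
      unfolding rem(1) by (intro always_eventually allI \<beta>(2) rem(2) v)
    have "((\<lambda>F. \<beta> * (H1_norm (\<lambda>x. u x - proj_H1 F u x) * H1_norm v)) \<longlongrightarrow> \<beta> * (0 * H1_norm v)) (finite_subsets_at_top UNIV)"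
      by (intro tendsto_intros remainder_tendsto_0 u)
    then show "((\<lambda>F. \<beta> * (H1_norm (\<lambda>x. u x - proj_H1 F u x) * H1_norm v)) \<longlongrightarrow> 0) (finite_subsets_at_top UNIV)" by simp
  qed
  from tendsto_diff[OF tendsto_const[of "aform \<nu> \<sigma> u v"] this] show ?thesis by (simp add: has_sum_def)
qed

lemma stiffness_has_sum:
  assumes u: "u \<in> H1p"
  shows "((\<lambda>k. stiffness \<nu> \<sigma> l k * (cwt k * fcoeff u k)) has_sum (aform \<nu> \<sigma> u (phi l) / cwt l)) UNIV"
proof -
  have "stiffness \<nu> \<sigma> l k * (cwt k * fcoeff u k) = (1 / cwt l) * (fcoeff u k * aform \<nu> \<sigma> (phi k) (phi l))" for k
    using cwt_pos[of k] by (simp add: stiffness_def)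
  then show ?thesis
    using has_sum_cmult_right[OF aform_expansion[OF u phi_H1p], of "1 / complex_of_real (cwt l)" l] by simp
qed

lemma stiffness_trig:
  fixes c :: "int^'d \<Rightarrow> complex"
  shows "(\<Sum>k\<in>\<Lambda>. stiffness \<nu> \<sigma> l k * (cwt k * c k)) = aform \<nu> \<sigma> (\<lambda>x. \<Sum>k\<in>\<Lambda>. c k * phi k x) (phi l) / cwt l"
proof -
  have "stiffness \<nu> \<sigma> l k * (cwt k * c k) = c k * aform \<nu> \<sigma> (phi k) (phi l) / cwt l" for k
    using cwt_pos[of k] by (simp add: stiffness_def)
  then show ?thesis by (simp add: aform_trig_left phi_H1p sum_divide_distrib)
qed

text \<open>
  The quadratic form of the stiffness matrix at \<open>v\<close> is the form at the trigonometric polynomial with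
  coefficients \<open>v\<^sub>k / c\<^sub>k\<close>, whose squared norm is the sum of the \<open>|v\<^sub>k|\<^sup>2\<close>.
\<close>

lemma stiffness_coercive:
  "\<exists>\<alpha>>0. \<forall>\<Lambda> v. finite \<Lambda> \<longrightarrow> \<alpha> * (\<Sum>l\<in>\<Lambda>. (cmod (v l))\<^sup>2) \<le>
     Re (\<Sum>l\<in>\<Lambda>. cnj (v l) * (\<Sum>k\<in>\<Lambda>. stiffness \<nu> \<sigma> l k * v k))"
proof -
  obtain \<alpha> where \<alpha>: "0 < \<alpha>" "\<And>v. v \<in> H1p \<Longrightarrow> \<alpha> * (H1_norm v)\<^sup>2 \<le> Re (aform \<nu> \<sigma> v v)"
    using aform_coercive by blast
  have "\<alpha> * (\<Sum>l\<in>\<Lambda>. (cmod (v l))\<^sup>2) \<le> Re (\<Sum>l\<in>\<Lambda>. cnj (v l) * (\<Sum>k\<in>\<Lambda>. stiffness \<nu> \<sigma> l k * v k))"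
    if fin: "finite \<Lambda>" for \<Lambda> v
  proof -
    define w where "w x = (\<Sum>k\<in>\<Lambda>. (v k / cwt k) * phi k x)" for x
    have w: "w \<in> H1p" unfolding w_def by (rule trig_H1p)
    have fw: "fcoeff w k = (if k \<in> \<Lambda> then v k / cwt k else 0)" for k
      unfolding w_def[abs_def] by (rule fcoeff_trig[OF fin])
    have "(\<lambda>k. (cmod (cwt k * fcoeff w k))\<^sup>2) = (\<lambda>k. if k \<in> \<Lambda> then (cmod (v k))\<^sup>2 else 0)"
    proof -
      have "cwt k \<noteq> 0" for k :: "int^'d" using cwt_pos[of k] by simp
      then show ?thesis unfolding fw by auto
    qed
    moreover have "((\<lambda>k. if k \<in> \<Lambda> then (cmod (v k))\<^sup>2 else 0) has_sum (\<Sum>k\<in>\<Lambda>. (cmod (v k))\<^sup>2)) UNIV"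
      by (rule has_sum_finite_neutralI[OF fin]) (auto intro: sum.cong)
    ultimately have n: "(H1_norm w)\<^sup>2 = (\<Sum>k\<in>\<Lambda>. (cmod (v k))\<^sup>2)"
      unfolding H1_norm_eq_ell2_norm ell2_norm_def by (simp add: infsumI sum_nonneg)
    have "(\<Sum>k\<in>\<Lambda>. stiffness \<nu> \<sigma> l k * v k) = aform \<nu> \<sigma> w (phi l) / cwt l" for l
    proof -
      have "(\<Sum>k\<in>\<Lambda>. stiffness \<nu> \<sigma> l k * v k) = (\<Sum>k\<in>\<Lambda>. stiffness \<nu> \<sigma> l k * (cwt k * (v k / cwt k)))"
      proof -
        have "cwt k \<noteq> 0" for k :: "int^'d" using cwt_pos[of k] by simp
        then show ?thesis by simp
      qed
      then show ?thesis unfolding stiffness_trig w_def .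
    qed
    then have "(\<Sum>l\<in>\<Lambda>. cnj (v l) * (\<Sum>k\<in>\<Lambda>. stiffness \<nu> \<sigma> l k * v k)) =
        (\<Sum>l\<in>\<Lambda>. cnj (v l / cwt l) * aform \<nu> \<sigma> w (phi l))" by simp
    also have "\<dots> = aform \<nu> \<sigma> w w"
      using aform_trig_right[OF w, of "\<lambda>k. v k / cwt k" \<Lambda>] by (simp add: w_def[abs_def])
    finally show ?thesis using \<alpha>(2)[OF w] n by simp
  qed
  then show ?thesis using \<alpha>(1) by blast
qed

lemma best_err_H1:
  assumes "u \<in> H1p"
  shows "best_err H1_norm proj_H1 N u = seq_err N (\<lambda>k. cwt k * fcoeff u k)"
  unfolding best_err_def seq_err_def
  by (intro INF_cong refl) (simp add: H1_norm_remainder[OF H1pD(1)[OF assms]])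

lemma best_err_Hm1:
  fixes f :: "(real^'d \<Rightarrow> complex) \<Rightarrow> complex"
  shows "best_err Hm1_norm proj_Hm1 N f = seq_err N (\<lambda>k. dual_fcoeff f k / cwt k)"
  unfolding best_err_def seq_err_def
proof (intro INF_cong refl)
  fix \<Lambda> :: "(int^'d) set" assume \<Lambda>: "\<Lambda> \<in> {\<Lambda>. finite \<Lambda> \<and> card \<Lambda> = N}"
  have "dual_fcoeff (\<lambda>v. f v - proj_Hm1 \<Lambda> f v) k = (if k \<in> \<Lambda> then 0 else dual_fcoeff f k)" for k
    using \<Lambda> by (simp add: dual_fcoeff_def proj_Hm1_def fcoeff_phi if_distrib[of cnj] if_distrib[of "\<lambda>c. _ * c"] cong: if_cong)
  then show "Hm1_norm (\<lambda>v. f v - proj_Hm1 \<Lambda> f v) = ell2_norm (\<lambda>k. if k \<in> \<Lambda> then 0 else dual_fcoeff f k / cwt k)"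
    unfolding Hm1_norm_eq_ell2_norm by (intro arg_cong[where f = ell2_norm]) auto
qed

lemma residual_Hm1p:
  assumes f: "f \<in> Hm1p" and w: "w \<in> H1p"
  shows "residual \<nu> \<sigma> f w \<in> Hm1p"
proof -
  obtain \<beta> where \<beta>: "0 \<le> \<beta>" "\<And>u v. u \<in> H1p \<Longrightarrow> v \<in> H1p \<Longrightarrow> cmod (aform \<nu> \<sigma> u v) \<le> \<beta> * (H1_norm u * H1_norm v)"
    using aform_bounded by blast
  obtain C where C: "\<And>v. v \<in> H1p \<Longrightarrow> cmod (f v) \<le> C * H1_norm v" using f unfolding Hm1p_def by blast
  have "cmod (residual \<nu> \<sigma> f w v) \<le> (C + \<beta> * H1_norm w) * H1_norm v" if v: "v \<in> H1p" for v
    using norm_triangle_ineq4[of "f v" "aform \<nu> \<sigma> w v"] C[OF v] \<beta>(2)[OF w v]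
    by (simp add: residual_def Lop_def algebra_simps)
  then have "\<exists>C. \<forall>v\<in>H1p. cmod (residual \<nu> \<sigma> f w v) \<le> C * H1_norm v" by blast
  moreover have "residual \<nu> \<sigma> f w (\<lambda>x. v x + v' x) = residual \<nu> \<sigma> f w v + residual \<nu> \<sigma> f w v'"
    if "v \<in> H1p" "v' \<in> H1p" for v v'
    using f that by (simp add: Hm1p_def residual_def Lop_def aform_add_right[OF w])
  moreover have "residual \<nu> \<sigma> f w (\<lambda>x. c * v x) = cnj c * residual \<nu> \<sigma> f w v" if "v \<in> H1p" for c v
    using f that by (simp add: Hm1p_def residual_def Lop_def aform_cmult_right[OF w] right_diff_distrib)
  ultimately show ?thesis by (simp add: Hm1p_def)
qed

end

section \<open>The residual of a Galerkin solution\<close>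

theorem proposition5p2:
  fixes \<nu> \<sigma> :: "real^'d \<Rightarrow> real" and \<eta> s :: real
  assumes "admissible_coeff \<nu>" and "admissible_coeff \<sigma>"
    and "stiffness \<nu> \<sigma> \<in> Da \<eta>" and "\<eta> > real CARD('d)"
    and "ell2_invertible (stiffness \<nu> \<sigma>)"
    and "0 < s" and "s < \<eta> - real CARD('d)"
  shows "\<exists>C>0. \<forall>f\<in>Hm1p. \<forall>u \<Lambda> u\<^sub>\<Lambda>.
           weak_solution \<nu> \<sigma> f u \<longrightarrow> u \<in> AsB_H1 s \<longrightarrow>
           finite \<Lambda> \<longrightarrow> galerkin_solution \<nu> \<sigma> f \<Lambda> u\<^sub>\<Lambda> \<longrightarrow>
             residual \<nu> \<sigma> f u\<^sub>\<Lambda> \<in> AsB_Hm1 s \<and>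
             AsB_norm_Hm1 s (residual \<nu> \<sigma> f u\<^sub>\<Lambda>) \<le> C * AsB_norm_H1 s u"
proof -
  interpret elliptic_form \<nu> \<sigma> by unfold_locales (rule assms(1,2))+
  define w where "w m = (1 + knorm m) powr (- \<eta>)" for m :: "int^'d"
  define p where "p = (\<eta> - real CARD('d)) / real CARD('d)"
  define t where "t = s / real CARD('d)"
  obtain T where "lattice_weight w (2 powr \<eta>) p T"
    using lattice_weight_knorm[OF assms(4)] unfolding w_def[abs_def] p_def by blast
  then interpret lattice_weight w "2 powr \<eta>" p T .
  have t: "0 < t" "t < p" using assms(6,7) by (auto simp: t_def p_def divide_strict_right_mono)
  obtain c where c: "0 < c" "\<And>l k. cmod (stiffness \<nu> \<sigma> l k) \<le> c * w (l - k)"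
    using assms(3) by (auto simp: Da_def w_def)
  obtain \<alpha> where \<alpha>: "0 < \<alpha>" and coercive: "\<forall>\<Lambda> v. finite \<Lambda> \<longrightarrow> \<alpha> * (\<Sum>l\<in>\<Lambda>. (cmod (v l))\<^sup>2) \<le>
     Re (\<Sum>l\<in>\<Lambda>. cnj (v l) * (\<Sum>k\<in>\<Lambda>. stiffness \<nu> \<sigma> l k * v k))"
    using stiffness_coercive by blast
  obtain K where K: "0 \<le> K" and resolvent: "\<forall>\<Lambda>. finite \<Lambda> \<longrightarrow> (\<exists>R. (\<forall>l k. cmod (R l k) \<le> K * w (l - k)) \<and>
    residual_matrix (stiffness \<nu> \<sigma>) \<Lambda> R)"
    using galerkin_residual_matrix[OF less_imp_le[OF c(1)] c(2) \<alpha> coercive] by (elim exE conjE) (rule that; assumption)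
  obtain C where C: "0 \<le> C" and preserve: "\<forall>R c U r K. decaying_image c R U r \<longrightarrow> ell2_norm U \<le> K \<longrightarrow>
    (\<forall>N\<ge>1. seq_err N U * real N powr t \<le> K) \<longrightarrow>
    r \<in> ell2 \<and> ell2_norm r \<le> C * c * K \<and> (\<forall>N\<ge>1. seq_err N r * real N powr t \<le> C * c * K)"
    using decaying_matrix_preserves_algebraic_class[OF t infinite_lattice] by (elim exE conjE) (rule that; assumption)
  have main: "residual \<nu> \<sigma> f u\<^sub>\<Lambda> \<in> AsB_Hm1 s \<and>
             AsB_norm_Hm1 s (residual \<nu> \<sigma> f u\<^sub>\<Lambda>) \<le> (2 * C * K + 1) * AsB_norm_H1 s u"
    if f: "f \<in> Hm1p" and sol: "weak_solution \<nu> \<sigma> f u" and us: "u \<in> AsB_H1 s"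
      and fin: "finite \<Lambda>" and gal: "galerkin_solution \<nu> \<sigma> f \<Lambda> u\<^sub>\<Lambda>" for f u \<Lambda> u\<^sub>\<Lambda>
  proof -
    have u: "u \<in> H1p" using sol by (simp add: weak_solution_def)
    define U where "U k = cwt k * fcoeff u k" for k
    obtain a where a: "u\<^sub>\<Lambda> = (\<lambda>x. \<Sum>k\<in>\<Lambda>. a k * phi k x)"
      using gal by (auto simp: galerkin_solution_def VL_def)
    define W where "W k = cwt k * a k" for k
    define F where "F l = f (phi l) / cwt l" for l
    have uL: "u\<^sub>\<Lambda> \<in> H1p" unfolding a by (rule trig_H1p)
    define rr where "rr = residual \<nu> \<sigma> f u\<^sub>\<Lambda>"
    define r where "r l = dual_fcoeff rr l / cwt l" for l
    have AW: "(\<Sum>k\<in>\<Lambda>. stiffness \<nu> \<sigma> l k * W k) = aform \<nu> \<sigma> u\<^sub>\<Lambda> (phi l) / cwt l" for l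
      unfolding W_def a by (rule stiffness_trig)
    have AU: "((\<lambda>k. stiffness \<nu> \<sigma> l k * U k) has_sum F l) UNIV" for l
      using stiffness_has_sum[OF u, of l] sol phi_H1p[of l] by (simp add: U_def F_def weak_solution_def)
    have gal': "(\<Sum>k\<in>\<Lambda>. stiffness \<nu> \<sigma> l k * W k) = F l" if l: "l \<in> \<Lambda>" for l
    proof -
      \<comment> \<open>Every \<open>\<phi>\<^sub>l\<close> with \<open>l \<in> \<Lambda>\<close> is an admissible test function for the Galerkin solution.\<close>
      have "phi l = (\<lambda>x. \<Sum>k\<in>\<Lambda>. (if k = l then 1 else 0) * phi k x)"
        using fin l by (simp add: if_distrib[of "\<lambda>c. c * _"] cong: if_cong)
      then have "phi l \<in> VL \<Lambda>" unfolding VL_def by (intro CollectI exI)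
      then show ?thesis using gal unfolding AW F_def by (simp add: galerkin_solution_def)
    qed
    have r: "F l - (\<Sum>k\<in>\<Lambda>. stiffness \<nu> \<sigma> l k * W k) = r l" for l
      unfolding AW F_def r_def rr_def by (simp add: dual_fcoeff_def residual_def Lop_def diff_divide_distrib)
    obtain R where R: "\<forall>l k. cmod (R l k) \<le> K * w (l - k)" and RU: "\<forall>l. ((\<lambda>k. R l k * U k) has_sum r l) UNIV"
      using resolvent[rule_format, OF fin] AU gal' unfolding r[symmetric] residual_matrix_def by blast
    define b where "b N = best_err H1_norm proj_H1 N u * real N powr (s / real CARD('d))" for N
    define K0 where "K0 = AsB_norm_H1 s u"
    have bU: "b N = seq_err N U * real N powr t" for N
      by (simp add: b_def best_err_H1[OF u] U_def[abs_def] t_def)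
    have bdd: "bdd_above (b ` {1..})" using us by (simp add: alg_class_def b_def[abs_def])
    have bS: "b N \<le> (SUP N\<in>{1..}. b N)" if "1 \<le> N" for N
      by (rule cSUP_upper[OF _ bdd]) (use that in simp)
    have K0: "K0 = ell2_norm U + (SUP N\<in>{1..}. b N)"
      by (simp add: K0_def alg_norm_def H1_norm_eq_ell2_norm U_def[abs_def] b_def[abs_def])
    have "0 \<le> b 1" by (simp add: bU seq_err_nonneg[OF infinite_lattice])
    then have S0: "0 \<le> (SUP N\<in>{1..}. b N)" using bS[of 1] by linarith
    have U2: "U \<in> ell2" unfolding U_def[abs_def] by (rule H1p_ell2[OF u])
    have im: "decaying_image K R U r" using K R U2 RU by (simp add: decaying_image_def)
    have UK: "ell2_norm U \<le> K0" using S0 by (simp add: K0)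
    have K00: "0 \<le> K0" using UK ell2_norm_nonneg[of U] by linarith
    have best: "\<forall>N\<ge>1. seq_err N U * real N powr t \<le> K0"
    proof (intro allI impI)
      fix N :: nat assume "1 \<le> N"
      from bS[OF this] have "b N \<le> K0" unfolding K0 using ell2_norm_nonneg[of U] by linarith
      then show "seq_err N U * real N powr t \<le> K0" by (simp only: bU)
    qed
    have concl: "r \<in> ell2 \<and> ell2_norm r \<le> C * K * K0 \<and> (\<forall>N\<ge>1. seq_err N r * real N powr t \<le> C * K * K0)"
      by (rule preserve[THEN spec, THEN spec, THEN spec, THEN spec, THEN spec, THEN mp, THEN mp, THEN mp, OF im UK best])
    define b' where "b' N = best_err Hm1_norm proj_Hm1 N rr * real N powr (s / real CARD('d))" for N
    have b': "b' N \<le> C * K * K0" if "1 \<le> N" for N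
      using concl that by (simp add: b'_def best_err_Hm1 r_def[abs_def] t_def)
    have "bdd_above (b' ` {1..})" by (rule bdd_aboveI[of _ "C * K * K0"]) (use b' in auto)
    moreover have "rr \<in> Hm1p" unfolding rr_def by (rule residual_Hm1p[OF f uL])
    ultimately have "rr \<in> AsB_Hm1 s" by (simp add: alg_class_def b'_def[abs_def])
    moreover have "AsB_norm_Hm1 s rr \<le> (2 * C * K + 1) * K0"
    proof -
      have "(SUP N\<in>{1..}. b' N) \<le> C * K * K0" by (rule cSUP_least) (use b' in auto)
      moreover have "AsB_norm_Hm1 s rr = ell2_norm r + (SUP N\<in>{1..}. b' N)"
        by (simp add: alg_norm_def Hm1_norm_eq_ell2_norm r_def[abs_def] b'_def[abs_def])
      ultimately have "AsB_norm_Hm1 s rr \<le> C * K * K0 + C * K * K0"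
        using concl by linarith
      then show ?thesis using K00 by (simp add: algebra_simps)
    qed
    ultimately show ?thesis by (simp add: rr_def K0_def)
  qed
  \<comment> \<open>One factor \<open>C * K\<close> for the norm of the residual, one for its approximation errors.\<close>
  have "0 < 2 * C * K + 1" using C K by (simp add: add_nonneg_pos)
  then show ?thesis using main by blast
qed

end
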